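(* Let $(S,\mathfrak n,k)$ be a regular local ring and $I$ an $\mathfrak n$-primary ideal of $S$ with $I\subseteq\mathfrak n^2$ and $\ell(S/I)=6$. Assume the local ring $S/I$ is neither Gorenstein nor Burch. Then $\dim S=3$, $\operatorname{r}(S/I)=2$, $\nu(I)=4$, and $S/I$ has an exact pair of zero-divisors.
   Context: $\operatorname{r}$ denotes type ($\dim_k$ of the socle for artinian rings), $\nu(I)$ the minimal number of generators, $\ell$ length. An ideal $J$ of a local ring $(A,\mathfrak n)$ is Burch if $\mathfrak n(J:\mathfrak n)\ne\mathfrak nJ$; a local ring $R$ is Burch if there exist a maximal $\widehat R$-regular sequence $\mathbf x$, a regular local ring $T$ and a Burch ideal $J$ of $T$ with $\widehat R/(\mathbf x)\cong T/J$. A pair $(x,y)$ of elements of the maximal ideal $\mathfrak m$ of $R$ is an exact pair of zero-divisors if $0:_Rx=yR$ and $0:_Ry=xR$. *)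

theory Defs
  imports "HOL-Algebra.Algebra"
begin

definition local_ring :: "('a, 'm) ring_scheme \<Rightarrow> bool" where
  "local_ring R \<longleftrightarrow> cring R \<and> (\<exists>!m. maximalideal m R)"

definition max_ideal :: "('a, 'm) ring_scheme \<Rightarrow> 'a set" where
  "max_ideal R = (THE m. maximalideal m R)"

definition num_gens :: "('a, 'm) ring_scheme \<Rightarrow> 'a set \<Rightarrow> nat" where
  "num_gens R I = (LEAST n. \<exists>G. finite G \<and> G \<subseteq> carrier R \<and> card G = n \<and> genideal R G = I)"

definition prime_chain :: "('a, 'm) ring_scheme \<Rightarrow> nat \<Rightarrow> bool" where
  "prime_chain R d \<longleftrightarrow> (\<exists>P :: nat \<Rightarrow> 'a set.
      (\<forall>i\<le>d. primeideal (P i) R) \<and> (\<forall>i<d. P i \<subset> P (Suc i)))"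

definition krull_dim_eq :: "('a, 'm) ring_scheme \<Rightarrow> nat \<Rightarrow> bool" where
  "krull_dim_eq R d \<longleftrightarrow> prime_chain R d \<and> (\<forall>e. prime_chain R e \<longrightarrow> e \<le> d)"

definition regular_local_ring :: "('a, 'm) ring_scheme \<Rightarrow> bool" where
  "regular_local_ring R \<longleftrightarrow> local_ring R \<and> noetherian_ring R \<and>
     (\<exists>d. krull_dim_eq R d \<and> num_gens R (max_ideal R) = d)"

definition primary_ideal :: "('a, 'm) ring_scheme \<Rightarrow> 'a set \<Rightarrow> bool" where
  "primary_ideal R I \<longleftrightarrow> ideal I R \<and> I \<noteq> carrier R \<and>
     (\<forall>x\<in>carrier R. \<forall>y\<in>carrier R. x \<otimes>\<^bsub>R\<^esub> y \<in> I \<longrightarrow> x \<notin> I \<longrightarrow>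
        (\<exists>k::nat. y [^]\<^bsub>R\<^esub> k \<in> I))"

definition ideal_radical :: "('a, 'm) ring_scheme \<Rightarrow> 'a set \<Rightarrow> 'a set" where
  "ideal_radical R I = {x \<in> carrier R. \<exists>k::nat. x [^]\<^bsub>R\<^esub> k \<in> I}"

definition primary_to :: "('a, 'm) ring_scheme \<Rightarrow> 'a set \<Rightarrow> 'a set \<Rightarrow> bool" where
  "primary_to R I P \<longleftrightarrow> primary_ideal R I \<and> ideal_radical R I = P"

text \<open>Length of the R-module R/I equals n.  Submodules of R/I are exactly J/I for
  ideals J with I \<subseteq> J, so chains of submodules of R/I are chains of ideals from I to R.\<close>
definition ideal_chain_from :: "('a, 'm) ring_scheme \<Rightarrow> 'a set \<Rightarrow> nat \<Rightarrow> bool" where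
  "ideal_chain_from R I n \<longleftrightarrow> (\<exists>C :: nat \<Rightarrow> 'a set. C 0 = I \<and> C n = carrier R \<and>
      (\<forall>i\<le>n. ideal (C i) R) \<and> (\<forall>i<n. C i \<subset> C (Suc i)))"

definition quot_length_eq :: "('a, 'm) ring_scheme \<Rightarrow> 'a set \<Rightarrow> nat \<Rightarrow> bool" where
  "quot_length_eq R I n \<longleftrightarrow> ideal_chain_from R I n \<and> (\<forall>e. ideal_chain_from R I e \<longrightarrow> e \<le> n)"

definition ideal_colon :: "('a, 'm) ring_scheme \<Rightarrow> 'a set \<Rightarrow> 'a set \<Rightarrow> 'a set" where
  "ideal_colon R J M = {x \<in> carrier R. \<forall>a\<in>M. x \<otimes>\<^bsub>R\<^esub> a \<in> J}"

definition socle :: "('a, 'm) ring_scheme \<Rightarrow> 'a set" where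
  "socle R = ideal_colon R {\<zero>\<^bsub>R\<^esub>} (max_ideal R)"

text \<open>Type r(R) = t: the socle (0 :_R m) has dimension t over the residue field k = R/m,
  i.e. there are t socle elements whose classes form a k-basis (the socle is
  annihilated by m, so it is a k-vector space).\<close>
definition ring_type_eq :: "('a, 'm) ring_scheme \<Rightarrow> nat \<Rightarrow> bool" where
  "ring_type_eq R t \<longleftrightarrow> (\<exists>s :: nat \<Rightarrow> 'a.
     (\<forall>i<t. s i \<in> socle R) \<and>
     (\<forall>x\<in>socle R. \<exists>c. (\<forall>i<t. c i \<in> carrier R) \<and>
          x = finsum R (\<lambda>i. c i \<otimes>\<^bsub>R\<^esub> s i) {..<t}) \<and>
     (\<forall>c. (\<forall>i<t. c i \<in> carrier R) \<longrightarrow>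
          finsum R (\<lambda>i. c i \<otimes>\<^bsub>R\<^esub> s i) {..<t} = \<zero>\<^bsub>R\<^esub> \<longrightarrow>
          (\<forall>i<t. c i \<in> max_ideal R)))"

definition artinian_gorenstein :: "('a, 'm) ring_scheme \<Rightarrow> bool" where
  "artinian_gorenstein R \<longleftrightarrow> ring_type_eq R 1"

definition burch_ideal :: "('a, 'm) ring_scheme \<Rightarrow> 'a set \<Rightarrow> bool" where
  "burch_ideal A J \<longleftrightarrow>
     ideal_prod A (max_ideal A) (ideal_colon A J (max_ideal A)) \<noteq> ideal_prod A (max_ideal A) J"

definition burch_artinian_ring :: "('b, 'm) ring_scheme \<Rightarrow> bool" where
  "burch_artinian_ring R \<longleftrightarrow> (\<exists>(T :: (nat \<Rightarrow> 'b) ring) J.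
     regular_local_ring T \<and> ideal J T \<and> burch_ideal T J \<and> R \<simeq> T Quot J)"

definition exact_pair_zd :: "('a, 'm) ring_scheme \<Rightarrow> 'a \<Rightarrow> 'a \<Rightarrow> bool" where
  "exact_pair_zd R x y \<longleftrightarrow> x \<in> max_ideal R \<and> y \<in> max_ideal R \<and>
     ideal_colon R {\<zero>\<^bsub>R\<^esub>} {x} = cgenideal R y \<and>
     ideal_colon R {\<zero>\<^bsub>R\<^esub>} {y} = cgenideal R x"

end

theory Submission
  imports Defs
begin

text \<open>
  All arguments take place among the ideals of \<open>S\<close>. Let \<open>\<mm>\<close> be the maximal ideal and \<open>d\<close> the dimension.
  That \<open>I\<close> is not Burch means \<open>\<mm>(I : \<mm>) = \<mm>I\<close>. Regularity enters only through Krull's height theorem: \<open>\<mm>\<close> is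
  not the radical of an ideal with fewer than \<open>d\<close> generators. If some \<open>s \<in> (I : \<mm>)\<close> were outside \<open>\<mm>\<^sup>2\<close>, then
  \<open>s\<^sup>2 \<in> \<mm>I \<subseteq> \<mm>\<^sup>3\<close>, contradicting the height theorem; hence the socle lies in \<open>\<mm>\<^sup>2/I\<close>. If \<open>\<mm>\<^sup>2/(\<mm>\<^sup>3 + I)\<close>
  is cyclic, the quotient is then Gorenstein, so the Hilbert function starts \<open>1, d, \<ge> 2\<close> and length six leaves
  \<open>d = 2\<close> or the Hilbert function \<open>1, 3, 2\<close>. For \<open>d = 2\<close> a socle element outside \<open>\<mm>\<^sup>3 + I\<close> and the only quadric in \<open>I\<close>
  would satisfy two linear relations, which is impossible in \<open>k[x, y]\<close>.

  For the Hilbert function \<open>1, 3, 2\<close> one gets \<open>(I : \<mm>) = \<mm>\<^sup>2\<close> and \<open>\<mm>I = \<mm>\<^sup>3\<close>, hence type two and \<open>6 - 2 = 4\<close> generators.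
  The multiplication \<open>\<mm>/\<mm>\<^sup>2 \<times> \<mm>/\<mm>\<^sup>2 \<rightarrow> \<mm>\<^sup>2/I\<close> is a pencil of symmetric bilinear forms in three
  variables without common radical, and \<open>\<mm>I = \<mm>\<^sup>3\<close> excludes members of rank one. Linear forms \<open>x, y\<close> with \<open>xy = 0\<close>
  are an exact pair as soon as neither lies in the radical of a member; they are found over every residue
  field by distinguishing whether a radical vector of some member is isotropic for the whole pencil.
\<close>

section \<open>Saturation at a prime and the descending chain condition\<close>

text \<open>Regularity is given by a chain of primes and a generating set, not as polynomiality of
  the associated graded ring; yet independence of quadrics and cancellation of linear forms are
  needed. Both come from primes given by the height theorem: modulo a prime over all parameters but
  one, the ring is a discrete valuation ring, where no power of the remaining parameter is a
  multiple of a higher one. Vector spaces over the residue field are replaced by ideals to which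
  generators are adjoined one at a time.

  The residue field is arbitrary, so square roots, degenerate members of the pencil and polarisation
  in characteristic two are not at hand. A linear form lies in the radical of a member exactly when
  multiplication by it fails to be onto \<open>\<mm>\<^sup>2/I\<close>; any other one has a kernel
  of dimension \<open>3 - 2 = 1\<close> in \<open>\<mm>/\<mm>\<^sup>2\<close>, which is why
  \<open>xy = 0\<close> then gives exactness. If no member is degenerate, every nonzero linear form
  has a partner; otherwise a radical vector \<open>e\<close> has a line as image, and this yields
  coordinates in which both factors can be written down.\<close>

locale noetherian_cring = noetherian_ring R + cring R for R (structure)
begin

definition adj :: "'a set \<Rightarrow> 'a \<Rightarrow> 'a set" where
  "adj J a = {x. \<exists>j\<in>J. \<exists>c\<in>carrier R. x = j \<oplus> c \<otimes> a}"

text \<open>This is the contraction to \<open>R\<close> of the extension of \<open>J\<close> to the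
  localisation at \<open>P\<close>. The ideals with \<open>sat P J = J\<close> stand for the ideals
  of that localisation, which is therefore never constructed.\<close>

definition sat :: "'a set \<Rightarrow> 'a set \<Rightarrow> 'a set" where
  "sat P J = {a \<in> carrier R. \<exists>s\<in>carrier R - P. s \<otimes> a \<in> J}"

section \<open>Ideals, adjunction of one generator, maximal members of families of ideals\<close>

lemma ideal_carr: "ideal J R \<Longrightarrow> a \<in> J \<Longrightarrow> a \<in> carrier R"
  by (rule ideal.Icarr)

lemma ideal_add: "ideal J R \<Longrightarrow> a \<in> J \<Longrightarrow> b \<in> J \<Longrightarrow> a \<oplus> b \<in> J"
  by (simp add: additive_subgroup.a_closed ideal.axioms(1))

lemma ideal_zero: "ideal J R \<Longrightarrow> \<zero> \<in> J"
  by (simp add: additive_subgroup.zero_closed ideal.axioms(1))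

lemma ideal_neg: "ideal J R \<Longrightarrow> a \<in> J \<Longrightarrow> \<ominus> a \<in> J"
  by (simp add: additive_subgroup.a_inv_closed ideal.axioms(1))

lemma ideal_minus: "ideal J R \<Longrightarrow> a \<in> J \<Longrightarrow> b \<in> J \<Longrightarrow> a \<ominus> b \<in> J"
  by (simp add: a_minus_def ideal_add ideal_neg)

lemma ideal_mult: "ideal J R \<Longrightarrow> a \<in> J \<Longrightarrow> c \<in> carrier R \<Longrightarrow> c \<otimes> a \<in> J"
  by (rule ideal.I_l_closed)

lemma ideal_multr: "ideal J R \<Longrightarrow> a \<in> J \<Longrightarrow> c \<in> carrier R \<Longrightarrow> a \<otimes> c \<in> J"
  by (rule ideal.I_r_closed)

lemmas ideal_closed = ideal_add ideal_zero ideal_neg ideal_minus ideal_mult ideal_multr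

lemma ideal_cancel: "ideal J R \<Longrightarrow> a \<oplus> b \<in> J \<Longrightarrow> b \<in> J \<Longrightarrow> a \<in> carrier R \<Longrightarrow> a \<in> J"
proof -
  assume A: "ideal J R" "a \<oplus> b \<in> J" "b \<in> J" "a \<in> carrier R"
  have b: "b \<in> carrier R" using A ideal_carr by blast
  have "(a \<oplus> b) \<ominus> b \<in> J" using A ideal_minus by blast
  moreover have "(a \<oplus> b) \<ominus> b = a" using A b by algebra
  ultimately show ?thesis by simp
qed

lemma ideal_cancel': "ideal J R \<Longrightarrow> a \<ominus> b \<in> J \<Longrightarrow> b \<in> J \<Longrightarrow> a \<in> carrier R \<Longrightarrow> a \<in> J"
  unfolding a_minus_def by (rule ideal_cancel[of J a "\<ominus> b"]) (auto intro: ideal_neg)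

lemma idealI':
  assumes "J \<subseteq> carrier R" "\<zero> \<in> J" "\<And>a b. a \<in> J \<Longrightarrow> b \<in> J \<Longrightarrow> a \<oplus> b \<in> J"
    "\<And>a c. a \<in> J \<Longrightarrow> c \<in> carrier R \<Longrightarrow> c \<otimes> a \<in> J"
  shows "ideal J R"
proof (rule idealI[OF ring_axioms])
  have "\<ominus> a \<in> J" if "a \<in> J" for a
  proof -
    have "a \<in> carrier R" using that assms by blast
    then have "\<ominus> a = (\<ominus> \<one>) \<otimes> a" by algebra
    then show ?thesis using assms(4)[OF that, of "\<ominus> \<one>"] by simp
  qed
  then show "subgroup J (add_monoid R)"
    using assms by (intro add.subgroupI) (auto simp: a_inv_def)
  show "x \<otimes> a \<in> J" if "a \<in> J" "x \<in> carrier R" for a x using assms(4) that by blast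
  show "a \<otimes> x \<in> J" if "a \<in> J" "x \<in> carrier R" for a x
    using assms(1,4) that m_comm by (metis subsetD)
qed

lemma adjI: "j \<in> J \<Longrightarrow> c \<in> carrier R \<Longrightarrow> j \<oplus> c \<otimes> a \<in> adj J a"
  unfolding adj_def by blast

lemma adjE:
  assumes "x \<in> adj J a"
  obtains j c where "j \<in> J" "c \<in> carrier R" "x = j \<oplus> c \<otimes> a"
  using assms unfolding adj_def by blast

lemma adj_ideal:
  assumes J: "ideal J R" and a: "a \<in> carrier R"
  shows "ideal (adj J a) R"
proof (rule idealI')
  show "adj J a \<subseteq> carrier R" using ideal_carr[OF J] a by (auto elim!: adjE)
  show "\<zero> \<in> adj J a" using adjI[OF ideal_zero[OF J] zero_closed, of a] a by simp
  fix x y assume x: "x \<in> adj J a"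
  { assume y: "y \<in> adj J a"
    obtain j c where 1: "j \<in> J" "c \<in> carrier R" "x = j \<oplus> c \<otimes> a" using x by (rule adjE)
    obtain j' c' where 2: "j' \<in> J" "c' \<in> carrier R" "y = j' \<oplus> c' \<otimes> a" using y by (rule adjE)
    have "j \<in> carrier R" "j' \<in> carrier R" using 1 2 ideal_carr J by auto
    then have "x \<oplus> y = (j \<oplus> j') \<oplus> (c \<oplus> c') \<otimes> a" using 1 2 a by algebra
    then show "x \<oplus> y \<in> adj J a" using adjI[of "j \<oplus> j'" J "c \<oplus> c'" a] ideal_add[OF J] 1 2 by simp }
  { assume y: "y \<in> carrier R"
    obtain j c where 1: "j \<in> J" "c \<in> carrier R" "x = j \<oplus> c \<otimes> a" using x by (rule adjE)
    have "j \<in> carrier R" using 1 ideal_carr J by auto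
    then have "y \<otimes> x = y \<otimes> j \<oplus> (y \<otimes> c) \<otimes> a" using 1 a y by algebra
    then show "y \<otimes> x \<in> adj J a" using adjI[of "y \<otimes> j" J "y \<otimes> c" a] ideal_mult[OF J] 1 y by simp }
qed

lemma adj_sub: "ideal J R \<Longrightarrow> a \<in> carrier R \<Longrightarrow> J \<subseteq> adj J a"
proof
  fix x assume A: "ideal J R" "a \<in> carrier R" "x \<in> J"
  then show "x \<in> adj J a" using adjI[of x J \<zero> a] ideal_carr[of J x] by simp
qed

lemma adj_self: "ideal J R \<Longrightarrow> a \<in> carrier R \<Longrightarrow> a \<in> adj J a"
  using adjI[of \<zero> J \<one> a] ideal_zero[of J] by simp

lemma adj_least: "ideal K R \<Longrightarrow> J \<subseteq> K \<Longrightarrow> a \<in> K \<Longrightarrow> adj J a \<subseteq> K"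
  by (auto elim!: adjE intro!: ideal_add intro: ideal_mult)

lemma adj_mono: "J \<subseteq> K \<Longrightarrow> adj J a \<subseteq> adj K a"
  unfolding adj_def by blast

lemma adj_absorb: "ideal J R \<Longrightarrow> a \<in> J \<Longrightarrow> adj J a = J"
  using adj_least[of J J a] adj_sub[of J a] ideal_carr[of J a] by blast

text \<open>In a noetherian ring a nonempty chain of ideals contains its own union, so Zorn's lemma
  applies to any nonempty family.\<close>

lemma ex_maximal:
  assumes "F \<noteq> {}" "\<And>J. J \<in> F \<Longrightarrow> ideal J R"
  obtains M where "M \<in> F" "\<And>J. J \<in> F \<Longrightarrow> M \<subseteq> J \<Longrightarrow> J = M"
proof -
  have "\<Union>C \<in> F" if "C \<noteq> {}" "subset.chain F C" for C
  proof -
    have "subset.chain {I. ideal I R} C" using that assms(2) by (auto simp: subset.chain_def)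
    from ideal_chain_is_trivial[OF that(1) this] that(2) show ?thesis
      by (auto simp: subset.chain_def)
  qed
  from subset_Zorn_nonempty[OF assms(1) this] that show ?thesis by blast
qed

section \<open>Prime ideals and saturation\<close>

lemma primeD: "primeideal P R \<Longrightarrow> a \<in> carrier R \<Longrightarrow> b \<in> carrier R \<Longrightarrow> a \<otimes> b \<in> P \<Longrightarrow> a \<in> P \<or> b \<in> P"
  by (rule primeideal.I_prime)

lemma prime_ideal: "primeideal P R \<Longrightarrow> ideal P R"
  by (rule primeideal.axioms(1))

lemma prime_one: "primeideal P R \<Longrightarrow> \<one> \<notin> P"
  using ideal.one_imp_carrier primeideal.I_notcarr primeideal.axioms(1) by metis

lemma satI: "a \<in> carrier R \<Longrightarrow> s \<in> carrier R \<Longrightarrow> s \<notin> P \<Longrightarrow> s \<otimes> a \<in> J \<Longrightarrow> a \<in> sat P J"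
  unfolding sat_def by blast

lemma satE:
  assumes "a \<in> sat P J"
  obtains s where "a \<in> carrier R" "s \<in> carrier R" "s \<notin> P" "s \<otimes> a \<in> J"
  using assms unfolding sat_def by blast

lemma sat_ideal:
  assumes P: "primeideal P R" and J: "ideal J R"
  shows "ideal (sat P J) R"
proof (rule idealI')
  show "sat P J \<subseteq> carrier R" unfolding sat_def by blast
  show "\<zero> \<in> sat P J" using satI[of \<zero> \<one> P J] prime_one[OF P] ideal_zero[OF J] by simp
  fix x y assume x: "x \<in> sat P J"
  then obtain s where s: "x \<in> carrier R" "s \<in> carrier R" "s \<notin> P" "s \<otimes> x \<in> J" by (rule satE)
  { assume y: "y \<in> sat P J"
    then obtain t where t: "y \<in> carrier R" "t \<in> carrier R" "t \<notin> P" "t \<otimes> y \<in> J" by (rule satE)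
    have "(s \<otimes> t) \<otimes> (x \<oplus> y) = t \<otimes> (s \<otimes> x) \<oplus> s \<otimes> (t \<otimes> y)" using s t by algebra
    also have "\<dots> \<in> J" using s t by (auto intro!: ideal_add[OF J] ideal_mult[OF J])
    finally show "x \<oplus> y \<in> sat P J" using s t primeD[OF P, of s t] by (intro satI[of _ "s \<otimes> t"]) auto }
  { assume y: "y \<in> carrier R"
    have "s \<otimes> (y \<otimes> x) = y \<otimes> (s \<otimes> x)" using s y by algebra
    also have "\<dots> \<in> J" using s y by (auto intro!: ideal_mult[OF J])
    finally show "y \<otimes> x \<in> sat P J" using s y by (intro satI[of _ s]) auto }
qed

lemma sat_sub: "primeideal P R \<Longrightarrow> ideal J R \<Longrightarrow> J \<subseteq> sat P J"
  using satI[of _ \<one> P J] prime_one ideal_carr by auto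

lemma sat_mono: "J \<subseteq> K \<Longrightarrow> sat P J \<subseteq> sat P K"
  unfolding sat_def by blast

text \<open>Elements outside \<open>P\<close> are outside \<open>Q\<close> too, so they are already
  allowed as denominators. The case \<open>Q = P\<close> is idempotence; a smaller \<open>Q\<close>
  occurs for the substitutes of symbolic powers in the principal ideal theorem.\<close>

lemma sat_sat:
  assumes P: "primeideal P R" and Q: "Q \<subseteq> P" "primeideal Q R" and J: "ideal J R"
  shows "sat P (sat Q J) = sat Q J"
proof
  show "sat P (sat Q J) \<subseteq> sat Q J"
  proof
    fix x assume "x \<in> sat P (sat Q J)"
    then obtain s where s: "x \<in> carrier R" "s \<in> carrier R" "s \<notin> P" "s \<otimes> x \<in> sat Q J" by (rule satE)
    then obtain t where t: "t \<in> carrier R" "t \<notin> Q" "t \<otimes> (s \<otimes> x) \<in> J" using satE by meson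
    have "(t \<otimes> s) \<otimes> x \<in> J" using t s by (simp add: m_assoc)
    then show "x \<in> sat Q J" using s t Q primeD[OF Q(2), of t s] by (intro satI[of _ "t \<otimes> s"]) auto
  qed
  show "sat Q J \<subseteq> sat P (sat Q J)" by (rule sat_sub[OF P sat_ideal[OF Q(2) J]])
qed

lemma sat_closed: "sat P J = J \<Longrightarrow> a \<in> carrier R \<Longrightarrow> s \<in> carrier R \<Longrightarrow> s \<notin> P \<Longrightarrow> s \<otimes> a \<in> J \<Longrightarrow> a \<in> J"
  using satI by blast

lemma colon_ideal: "ideal J R \<Longrightarrow> M \<subseteq> carrier R \<Longrightarrow> ideal (ideal_colon R J M) R"
  by (rule idealI') (auto simp: ideal_colon_def l_distr m_assoc subset_iff intro: ideal_closed)

text \<open>A largest annihilator \<open>(J : a)\<close> with \<open>a\<close> outside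
  \<open>J\<close> is prime. Saturation keeps it inside \<open>P\<close>, and minimality of
  \<open>P\<close> over \<open>J\<close> makes it equal to \<open>P\<close>.\<close>

lemma ex_associated:
  assumes P: "primeideal P R" and J: "ideal J R" "sat P J = J" "J \<noteq> carrier R"
    and min: "\<And>P'. primeideal P' R \<Longrightarrow> J \<subseteq> P' \<Longrightarrow> P' \<subseteq> P \<Longrightarrow> P' = P"
  obtains a where "a \<in> carrier R" "a \<notin> J" "\<And>p. p \<in> P \<Longrightarrow> p \<otimes> a \<in> J"
proof -
  let ?C = "\<lambda>a. ideal_colon R J {a}"
  have C: "p \<in> ?C a \<longleftrightarrow> p \<in> carrier R \<and> p \<otimes> a \<in> J" for p a by (auto simp: ideal_colon_def)
  let ?S = "{?C a |a. a \<in> carrier R - J}"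
  have "?S \<noteq> {}" using J(1,3) ideal_carr by blast
  then obtain M where M: "M \<in> ?S" "\<And>K. K \<in> ?S \<Longrightarrow> M \<subseteq> K \<Longrightarrow> K = M"
    by (rule ex_maximal) (use colon_ideal J in auto)
  then obtain a where a: "a \<in> carrier R" "a \<notin> J" "M = ?C a" by blast
  have Mid: "ideal M R" using a colon_ideal J by simp
  have prime: "primeideal M R"
  proof (rule primeidealI[OF Mid cring_axioms])
    show "carrier R \<noteq> M" using a C[of \<one> a] by auto
    fix b c assume bc: "b \<in> carrier R" "c \<in> carrier R" "b \<otimes> c \<in> M"
    show "b \<in> M \<or> c \<in> M"
    proof (cases "c \<otimes> a \<in> J")
      case True then show ?thesis using C a bc by auto
    next
      case False
      have "M \<subseteq> ?C (c \<otimes> a)"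
      proof
        fix p assume "p \<in> M"
        then have p: "p \<in> carrier R" "p \<otimes> a \<in> J" using C a by auto
        have "p \<otimes> (c \<otimes> a) = c \<otimes> (p \<otimes> a)" using p a bc by algebra
        then show "p \<in> ?C (c \<otimes> a)" unfolding C using p bc ideal_mult[OF J(1)] by simp
      qed
      moreover have "?C (c \<otimes> a) \<in> ?S" using False a bc by blast
      ultimately have "?C (c \<otimes> a) = M" using M by blast
      moreover have "b \<in> ?C (c \<otimes> a)" using bc a by (auto simp: C m_assoc)
      ultimately show ?thesis by blast
    qed
  qed
  have "J \<subseteq> M" using a C J ideal_carr ideal_multr by auto
  moreover have "M \<subseteq> P" using C a(3) sat_closed[OF J(2) a(1)] a(2) by blast
  ultimately have "M = P" using min prime by blast
  then show ?thesis using that[of a] a C by blast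
qed

text \<open>This expresses that the local ring at \<open>P\<close> of \<open>R/J\<close> is artinian
  when \<open>P\<close> is minimal over \<open>J\<close>.\<close>

lemma dcc_saturated:
  assumes P: "primeideal P R" and J: "ideal J R" "sat P J = J"
    and min: "\<And>P'. primeideal P' R \<Longrightarrow> J \<subseteq> P' \<Longrightarrow> P' \<subseteq> P \<Longrightarrow> P' = P"
    and K: "\<And>j::nat. ideal (K j) R" "\<And>j. sat P (K j) = K j" "\<And>j. J \<subseteq> K j" "\<And>j. K (Suc j) \<subseteq> K j"
  shows "\<exists>N. \<forall>j\<ge>N. K j = K N"
proof (rule ccontr)
  \<comment> \<open>Noetherian induction on the lower bound \<open>L\<close>: a largest bad
    \<open>L\<close> is enlarged by an element \<open>a\<close> with \<open>P a\<close> inside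
    \<open>L\<close>, which adds one simple layer after localisation.\<close>
  define good where "good L \<longleftrightarrow> (\<forall>K::nat \<Rightarrow> 'a set. (\<forall>j. ideal (K j) R \<and> sat P (K j) = K j \<and> L \<subseteq> K j \<and>
    K (Suc j) \<subseteq> K j) \<longrightarrow> (\<exists>N. \<forall>j\<ge>N. K j = K N))" for L
  assume "\<not> ?thesis"
  then have "\<not> good J" unfolding good_def using K by blast
  then have "{L. ideal L R \<and> sat P L = L \<and> J \<subseteq> L \<and> \<not> good L} \<noteq> {}" using J by blast
  then obtain L where L: "ideal L R" "sat P L = L" "J \<subseteq> L" "\<not> good L"
    and max: "\<And>L'. ideal L' R \<Longrightarrow> sat P L' = L' \<Longrightarrow> L \<subset> L' \<Longrightarrow> good L'"
    by (rule ex_maximal) blast+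
  have "good L"
  proof (cases "L = carrier R")
    case True
    show ?thesis unfolding good_def True
    proof (intro allI impI)
      fix K :: "nat \<Rightarrow> 'a set"
      assume "\<forall>j. ideal (K j) R \<and> sat P (K j) = K j \<and> carrier R \<subseteq> K j \<and> K (Suc j) \<subseteq> K j"
      then have "K j = carrier R" for j using ideal_carr by blast
      then show "\<exists>N. \<forall>j\<ge>N. K j = K N" by simp
    qed
  next
    case False
    obtain a where a: "a \<in> carrier R" "a \<notin> L" "\<And>p. p \<in> P \<Longrightarrow> p \<otimes> a \<in> L"
      using ex_associated[OF P L(1,2) False] min L(3) by (metis dual_order.trans)
    define A where "A L' = sat P (adj L' a)" for L'
    have A: "ideal (A L') R" "sat P (A L') = A L'" "L' \<subseteq> A L'" "a \<in> A L'" if L': "ideal L' R" for L'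
    proof -
      note adj = adj_ideal[OF L' a(1)] adj_sub[OF L' a(1)] adj_self[OF L' a(1)]
      show "ideal (A L') R" unfolding A_def by (rule sat_ideal[OF P adj(1)])
      show "sat P (A L') = A L'" unfolding A_def by (rule sat_sat[OF P order_refl P adj(1)])
      show "L' \<subseteq> A L'" "a \<in> A L'" unfolding A_def using sat_sub[OF P adj(1)] adj by auto
    qed
    have A_mono: "A L1 \<subseteq> A L2" if "L1 \<subseteq> L2" for L1 L2
      unfolding A_def using sat_mono adj_mono that by metis
    have goodA: "good (A L)" using max[of "A L"] A[OF L(1)] a by blast
    show ?thesis unfolding good_def
    proof (intro allI impI)
      fix K :: "nat \<Rightarrow> 'a set"
      assume *: "\<forall>j. ideal (K j) R \<and> sat P (K j) = K j \<and> L \<subseteq> K j \<and> K (Suc j) \<subseteq> K j"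
      have K: "ideal (K j) R" "sat P (K j) = K j" "L \<subseteq> K j" "K (Suc j) \<subseteq> K j" for j using * by auto
      have anti: "K j \<subseteq> K i" if "i \<le> j" for i j
        using lift_Suc_antimono_le[of K, OF K(4) that] .
      have "\<forall>j. ideal (A (K j)) R \<and> sat P (A (K j)) = A (K j) \<and> A L \<subseteq> A (K j) \<and> A (K (Suc j)) \<subseteq> A (K j)"
        using A(1,2)[OF K(1)] K A_mono by simp
      then obtain N where N: "\<And>j. j \<ge> N \<Longrightarrow> A (K j) = A (K N)" using goodA unfolding good_def by meson
      show "\<exists>N. \<forall>j\<ge>N. K j = K N"
      proof (cases "\<forall>j. a \<in> K j")
        case True
        then have "A (K j) = K j" for j unfolding A_def using adj_absorb K by simp
        then show ?thesis using N by auto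
      next
        case False
        then obtain m where m: "a \<notin> K m" by blast
        have "K N' \<subseteq> K j" if j: "j \<ge> N'" and N': "N' = max N m" for j N'
        proof
          fix u assume u: "u \<in> K N'"
          have "u \<in> A (K N')" using A(3)[OF K(1)] u by blast
          also have "A (K N') = A (K j)" using N[of N'] N[of j] N' j by simp
          finally obtain s where s: "u \<in> carrier R" "s \<in> carrier R" "s \<notin> P" "s \<otimes> u \<in> adj (K j) a"
            unfolding A_def by (rule satE)
          then obtain v c where v: "v \<in> K j" "c \<in> carrier R" "s \<otimes> u = v \<oplus> c \<otimes> a" by (blast elim: adjE)
          have vN: "v \<in> K N'" using v anti[OF j] by blast
          have "v \<in> carrier R" using v K ideal_carr by blast
          then have "c \<otimes> a = s \<otimes> u \<ominus> v" unfolding v(3) using v a by algebra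
          also have "\<dots> \<in> K N'" using u s vN by (auto intro!: ideal_minus[OF K(1)] ideal_mult[OF K(1)])
          \<comment> \<open>If \<open>c\<close> were outside \<open>P\<close>, saturation would put
            \<open>a\<close> into \<open>K N'\<close>, against the choice of \<open>m\<close>. With
            \<open>c\<close> in \<open>P\<close>, the term \<open>c a\<close> lies in
            \<open>L\<close>, below every member of the chain.\<close>
          finally have "c \<in> P" using sat_closed[OF K(2) a(1) v(2)] m anti[of m N'] N' by auto
          then have "c \<otimes> a \<in> K j" using a(3) K(3) by blast
          then have "s \<otimes> u \<in> K j" using v ideal_add[OF K(1)] by simp
          then show "u \<in> K j" using sat_closed[OF K(2)] s by blast
        qed
        then show ?thesis using anti by (metis subset_antisym)
      qed
    qed
  qed
  then show False using L by blast
qed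

end

section \<open>Krull's height theorem\<close>

context noetherian_cring
begin

text \<open>Nakayama's lemma for the localisation at \<open>P\<close>. The condition
  \<open>step\<close> encodes that \<open>M\<close> lies in \<open>P M + L\<close> there, by
  quantifying over all ideals that contain both summands. A maximal saturated ideal above
  \<open>L\<close> that does not contain \<open>M\<close> absorbs \<open>P M\<close>, because
  \<open>s - d p\<close> stays outside \<open>P\<close> whenever \<open>s\<close> does.\<close>

lemma nakayama_saturated:
  assumes P: "primeideal P R" and M: "ideal M R" and L: "ideal L R" "sat P L = L"
    and step: "\<And>L' u. ideal L' R \<Longrightarrow> L \<subseteq> L' \<Longrightarrow> (\<And>w p. w \<in> M \<Longrightarrow> p \<in> P \<Longrightarrow> p \<otimes> w \<in> L') \<Longrightarrow> u \<in> M
      \<Longrightarrow> \<exists>s\<in>carrier R - P. s \<otimes> u \<in> L'"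
  shows "M \<subseteq> L"
proof (rule ccontr)
  assume "\<not> M \<subseteq> L"
  define F where "F = {N. ideal N R \<and> sat P N = N \<and> L \<subseteq> N \<and> \<not> M \<subseteq> N}"
  have "L \<in> F" using L \<open>\<not> M \<subseteq> L\<close> unfolding F_def by simp
  then have "F \<noteq> {}" by blast
  then obtain N where NF: "N \<in> F" and maxF: "\<And>J. J \<in> F \<Longrightarrow> N \<subseteq> J \<Longrightarrow> J = N"
    by (rule ex_maximal[of F]) (auto simp: F_def)
  have N: "ideal N R" "sat P N = N" "L \<subseteq> N" "\<not> M \<subseteq> N" using NF unfolding F_def by simp_all
  have max: "M \<subseteq> N'" if "ideal N' R" "sat P N' = N'" "N \<subset> N'" for N'
    using maxF[of N'] that N(3) unfolding F_def by auto
  have mult: "p \<otimes> w \<in> N" if w: "w \<in> M" and p: "p \<in> P" for w p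
  proof (rule ccontr)
    assume no: "p \<otimes> w \<notin> N"
    have c: "w \<in> carrier R" "p \<in> carrier R" "p \<otimes> w \<in> carrier R"
      using w p ideal_carr[OF M] ideal_carr[OF prime_ideal[OF P]] by auto
    note adj = adj_ideal[OF N(1) c(3)] adj_sub[OF N(1) c(3)] adj_self[OF N(1) c(3)]
    have "N \<subset> sat P (adj N (p \<otimes> w))" using sat_sub[OF P adj(1)] adj no by blast
    then have "M \<subseteq> sat P (adj N (p \<otimes> w))" using max sat_ideal[OF P adj(1)] sat_sat[OF P order_refl P adj(1)] by blast
    then obtain s where s: "s \<in> carrier R" "s \<notin> P" "s \<otimes> w \<in> adj N (p \<otimes> w)" using w by (blast elim: satE)
    then obtain v d where v: "v \<in> N" "d \<in> carrier R" "s \<otimes> w = v \<oplus> d \<otimes> (p \<otimes> w)" by (blast elim: adjE)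
    have vc: "v \<in> carrier R" using v ideal_carr[OF N(1)] by blast
    have "(s \<ominus> d \<otimes> p) \<otimes> w = s \<otimes> w \<ominus> d \<otimes> (p \<otimes> w)" using s c v(2) by algebra
    also have "\<dots> = v" unfolding v(3) using vc v(2) c by algebra
    finally have *: "(s \<ominus> d \<otimes> p) \<otimes> w \<in> N" using v(1) by simp
    have **: "s \<ominus> d \<otimes> p \<notin> P"
      using ideal_cancel'[OF prime_ideal[OF P], of s "d \<otimes> p"] ideal_mult[OF prime_ideal[OF P] p v(2)] s by blast
    have "s \<ominus> d \<otimes> p \<in> carrier R" using s(1) c(2) v(2) by simp
    then have "w \<in> N" using sat_closed[OF N(2) c(1) _ ** *] by blast
    then show False using no ideal_mult[OF N(1)] c by blast
  qed
  have "M \<subseteq> N"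
  proof
    fix u assume u: "u \<in> M"
    then obtain s where "s \<in> carrier R - P" "s \<otimes> u \<in> N" using step[OF N(1,3) mult u] by blast
    then show "u \<in> N" using sat_closed[OF N(2)] u ideal_carr[OF M] by blast
  qed
  then show False using N by blast
qed

lemma prime_pow:
  assumes P: "primeideal P R" and "a \<in> carrier R" "a [^] (k::nat) \<in> P"
  shows "a \<in> P"
  using assms(3)
proof (induction k)
  case 0 then show ?case using prime_one[OF P] by simp
next
  case (Suc k) then show ?case using primeD[OF P, of "a [^] k" a] assms(2) by auto
qed

text \<open>Krull's principal ideal theorem. The symbolic powers of \<open>(y)\<close> at \<open>Q\<close> are replaced by
  the \<open>Q\<close>-saturations of \<open>P0 + (y\<^sup>j)\<close>, which avoids localisation.\<close>

lemma principal_ideal_theorem: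
  assumes P: "primeideal P R" and Q: "primeideal Q R" and P0: "primeideal P0 R"
    and sub: "P0 \<subset> Q" "Q \<subset> P" and x: "x \<in> P"
  obtains P' where "primeideal P' R" "P0 \<subseteq> P'" "x \<in> P'" "P' \<subset> P"
proof (rule ccontr)
  note that' = that
  assume "\<not> thesis"
  \<comment> \<open>Refuting the claim makes \<open>P\<close> minimal over \<open>P0 + (x)\<close>,
    so the chain condition holds for the saturated ideals above it.\<close>
  then have min: "P' = P" if "primeideal P' R" "P0 \<subseteq> P'" "x \<in> P'" "P' \<subseteq> P" for P'
    using that that' by blast
  have xQ: "x \<notin> Q" using min[OF Q] sub by blast
  have xc: "x \<in> carrier R" using x ideal_carr[OF prime_ideal[OF P]] by blast
  obtain y where y: "y \<in> Q" "y \<notin> P0" using sub by blast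
  have yc: "y \<in> carrier R" using y ideal_carr[OF prime_ideal[OF Q]] by blast
  note Pi = prime_ideal[OF P] and Qi = prime_ideal[OF Q] and P0i = prime_ideal[OF P0]
  define J where "J = sat P (adj P0 x)"
  define I where "I j = sat Q (adj P0 (y [^] j))" for j :: nat
  define K where "K j = sat P (adj (I j) x)" for j
  have yjc: "y [^] j \<in> carrier R" for j :: nat using yc by simp
  note aj = adj_ideal[OF P0i yjc] adj_sub[OF P0i yjc] adj_self[OF P0i yjc]
  have Iid: "ideal (I j) R" for j unfolding I_def by (rule sat_ideal[OF Q aj(1)])
  have IQ: "sat Q (I j) = I j" for j unfolding I_def by (rule sat_sat[OF Q order_refl Q aj(1)])
  have IP: "sat P (I j) = I j" for j unfolding I_def by (rule sat_sat[OF P _ Q aj(1)]) (use sub in blast)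
  have P0I: "P0 \<subseteq> I j" and yI: "y [^] j \<in> I j" for j
    unfolding I_def using sat_sub[OF Q aj(1)] aj(2,3) by blast+
  have Idec: "I (Suc j) \<subseteq> I j" for j
  proof -
    have "y [^] Suc j \<in> adj P0 (y [^] j)"
      using ideal_multr[OF aj(1) aj(3) yc] by simp
    then have "adj P0 (y [^] Suc j) \<subseteq> adj P0 (y [^] j)" by (rule adj_least[OF aj(1) aj(2)])
    then show ?thesis unfolding I_def by (rule sat_mono)
  qed
  note ax = adj_ideal[OF Iid xc] adj_sub[OF Iid xc] adj_self[OF Iid xc]
  note a0 = adj_ideal[OF P0i xc] adj_sub[OF P0i xc] adj_self[OF P0i xc]
  have Jsub: "P0 \<subseteq> J" "x \<in> J" unfolding J_def using sat_sub[OF P a0(1)] a0 by blast+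
  have "\<exists>N. \<forall>j\<ge>N. K j = K N"
  proof (rule dcc_saturated[OF P, of J])
    show "ideal J R" "sat P J = J" unfolding J_def by (rule sat_ideal[OF P a0(1)], rule sat_sat[OF P order_refl P a0(1)])
    show "P' = P" if "primeideal P' R" "J \<subseteq> P'" "P' \<subseteq> P" for P' using min that Jsub by blast
    show "ideal (K j) R" "sat P (K j) = K j" for j
      unfolding K_def by (rule sat_ideal[OF P ax(1)], rule sat_sat[OF P order_refl P ax(1)])
    show "J \<subseteq> K j" for j unfolding J_def K_def by (intro sat_mono adj_mono P0I)
    show "K (Suc j) \<subseteq> K j" for j unfolding K_def by (intro sat_mono adj_mono Idec)
  qed
  then obtain N where N: "K (Suc N) = K N" by (meson le_Suc_eq order_refl)
  \<comment> \<open>Equality of two consecutive \<open>K\<close> puts \<open>I N\<close> into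
    \<open>I (Suc N) + (x)\<close> at \<open>P\<close>. The coefficient of \<open>x\<close> lies in
    \<open>I N\<close>, as \<open>x\<close> is outside \<open>Q\<close> and \<open>I N\<close> is
    saturated at \<open>Q\<close>; so Nakayama's lemma removes this term.\<close>
  have "I N \<subseteq> I (Suc N)"
  proof (rule nakayama_saturated[OF P Iid Iid IP])
    fix L' u assume L': "ideal L' R" "I (Suc N) \<subseteq> L'" and mult: "\<And>w p. w \<in> I N \<Longrightarrow> p \<in> P \<Longrightarrow> p \<otimes> w \<in> L'"
      and u: "u \<in> I N"
    have "u \<in> K N" unfolding K_def using sat_sub[OF P ax(1)] ax(2) u by blast
    then have "u \<in> sat P (adj (I (Suc N)) x)" using N unfolding K_def by simp
    then obtain s where s: "u \<in> carrier R" "s \<in> carrier R" "s \<notin> P" "s \<otimes> u \<in> adj (I (Suc N)) x" by (rule satE)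
    then obtain v c where v: "v \<in> I (Suc N)" "c \<in> carrier R" "s \<otimes> u = v \<oplus> c \<otimes> x" by (blast elim: adjE)
    have vc: "v \<in> carrier R" using v ideal_carr[OF Iid] by blast
    have "x \<otimes> c = s \<otimes> u \<ominus> v" unfolding v(3) using v vc xc by algebra
    also have "\<dots> \<in> I N" using ideal_mult[OF Iid u s(2)] v(1) Idec by (intro ideal_minus[OF Iid]) auto
    finally have "c \<in> I N" by (rule sat_closed[OF IQ v(2) xc xQ])
    then have "x \<otimes> c \<in> L'" using mult x by blast
    moreover have "x \<otimes> c = c \<otimes> x" using xc v(2) by algebra
    ultimately have "s \<otimes> u \<in> L'" unfolding v(3) using v L' by (auto intro!: ideal_add[OF L'(1)])
    then show "\<exists>s\<in>carrier R - P. s \<otimes> u \<in> L'" using s by blast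
  qed
  then have "y [^] N \<in> sat Q (adj P0 (y [^] Suc N))" using yI I_def by blast
  then obtain s where s: "s \<in> carrier R" "s \<notin> Q" "s \<otimes> y [^] N \<in> adj P0 (y [^] Suc N)" by (rule satE)
  then obtain p c where p: "p \<in> P0" "c \<in> carrier R" "s \<otimes> y [^] N = p \<oplus> c \<otimes> y [^] Suc N" by (blast elim: adjE)
  have pc: "p \<in> carrier R" using p ideal_carr[OF P0i] by blast
  \<comment> \<open>Since \<open>y\<close> is not in the prime \<open>P0\<close>, cancelling the
    power of \<open>y\<close> leaves \<open>s - c y\<close> in \<open>P0\<close>, and then
    \<open>s\<close> in \<open>Q\<close>, which its choice forbids.\<close>
  have "(s \<ominus> c \<otimes> y) \<otimes> y [^] N = s \<otimes> y [^] N \<ominus> c \<otimes> (y [^] N \<otimes> y)" using s p(2) yc yjc[of N] by algebra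
  also have "\<dots> = p" unfolding p(3) nat_pow_Suc using pc p(2) yc yjc[of N] by algebra
  finally have "(s \<ominus> c \<otimes> y) \<otimes> y [^] N \<in> P0" using p by simp
  then have "s \<ominus> c \<otimes> y \<in> P0" using primeD[OF P0] prime_pow[OF P0 yc] y s p(2) yc yjc by (metis minus_closed m_closed)
  then have "s \<ominus> c \<otimes> y \<in> Q" using sub by blast
  then have "s \<in> Q" using ideal_cancel'[OF Qi] ideal_mult[OF Qi y(1) p(2)] s by blast
  then show False using s by blast
qed

definition is_prime_chain :: "(nat \<Rightarrow> 'a set) \<Rightarrow> nat \<Rightarrow> bool" where
  "is_prime_chain P e \<longleftrightarrow> (\<forall>i\<le>e. primeideal (P i) R) \<and> (\<forall>i<e. P i \<subset> P (Suc i))"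

text \<open>Each element costs one step of the chain. The principal ideal theorem, applied to the
  three highest primes, replaces the last but one by a prime containing \<open>x\<close>; the chain
  that ends in this prime is then treated in the same way.\<close>

lemma prime_chain_move:
  assumes "is_prime_chain P (Suc k)" "x \<in> P (Suc k)"
  shows "\<exists>P'. is_prime_chain P' k \<and> P' k = P (Suc k) \<and> P 0 \<subseteq> P' 0 \<and> x \<in> P' 0"
  using assms
proof (induction k arbitrary: P)
  case 0
  then show ?case by (intro exI[of _ "\<lambda>_. P (Suc 0)"]) (auto simp: is_prime_chain_def)
next
  case (Suc k)
  have pr: "primeideal (P i) R" if "i \<le> Suc (Suc k)" for i using Suc.prems that unfolding is_prime_chain_def by blast
  have sub: "P i \<subset> P (Suc i)" if "i < Suc (Suc k)" for i using Suc.prems that unfolding is_prime_chain_def by blast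
  obtain Q where Q: "primeideal Q R" "P k \<subset> Q" "x \<in> Q" "Q \<subset> P (Suc (Suc k))"
  proof (cases "x \<in> P (Suc k)")
    case True then show ?thesis using that[of "P (Suc k)"] pr sub by simp
  next
    case False
    obtain Q where "primeideal Q R" "P k \<subseteq> Q" "x \<in> Q" "Q \<subset> P (Suc (Suc k))"
      by (rule principal_ideal_theorem[OF pr pr pr sub sub Suc.prems(2)]) auto
    moreover have "P k \<noteq> Q" using \<open>x \<in> Q\<close> False sub[of k] by auto
    ultimately show ?thesis using that[of Q] by auto
  qed
  let ?P = "P(Suc k := Q)"
  have "is_prime_chain ?P (Suc k)" unfolding is_prime_chain_def
  proof (intro conjI allI impI)
    show "primeideal (?P i) R" if "i \<le> Suc k" for i using that pr[of i] Q(1) by simp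
    show "?P i \<subset> ?P (Suc i)" if "i < Suc k" for i using that sub[of i] Q(2) by (cases "i = k") simp_all
  qed
  from Suc.IH[OF this] Q obtain P' where P': "is_prime_chain P' k" "P' k = Q" "P 0 \<subseteq> P' 0" "x \<in> P' 0" by auto
  let ?P' = "P'(Suc k := P (Suc (Suc k)))"
  have "is_prime_chain ?P' (Suc k)"
    unfolding is_prime_chain_def
  proof (intro conjI allI impI)
    have *: "primeideal (P' i) R" if "i \<le> k" for i using that P'(1) unfolding is_prime_chain_def by simp
    have **: "P' i \<subset> P' (Suc i)" if "i < k" for i using that P'(1) unfolding is_prime_chain_def by simp
    show "primeideal (?P' i) R" if "i \<le> Suc k" for i using that pr[of "Suc (Suc k)"] *[of i] by (cases "i = Suc k") simp_all
    show "?P' i \<subset> ?P' (Suc i)" if "i < Suc k" for i using that **[of i] P'(2) Q(4) by (cases "i = k") simp_all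
  qed
  moreover have "?P' k = Q" "?P' 0 = P' 0" "?P' (Suc k) = P (Suc (Suc k))" using P'(2) by simp_all
  ultimately show ?case using P'(3,4) by metis
qed

lemma prime_chain_move_list:
  assumes "is_prime_chain P e" "set xs \<subseteq> P e" "length xs \<le> e"
  shows "\<exists>P'. is_prime_chain P' (e - length xs) \<and> P' (e - length xs) = P e \<and> P 0 \<subseteq> P' 0 \<and> set xs \<subseteq> P' 0"
  using assms
proof (induction xs)
  case Nil then show ?case by auto
next
  case (Cons x xs)
  have "set xs \<subseteq> P e" "length xs \<le> e" using Cons.prems by simp_all
  from Cons.IH[OF Cons.prems(1) this] obtain P' where P': "is_prime_chain P' (e - length xs)"
    "P' (e - length xs) = P e" "P 0 \<subseteq> P' 0" "set xs \<subseteq> P' 0"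
    by blast
  have e: "e - length xs = Suc (e - length (x # xs))" using Cons.prems by simp
  have "x \<in> P' (Suc (e - length (x # xs)))" using P'(2) Cons.prems(2) unfolding e by simp
  from prime_chain_move[OF P'(1)[unfolded e] this] obtain P'' where P'': "is_prime_chain P'' (e - length (x # xs))"
    "P'' (e - length (x # xs)) = P' (Suc (e - length (x # xs)))" "P' 0 \<subseteq> P'' 0" "x \<in> P'' 0"
    by blast
  then show ?case using P' unfolding e by (intro exI[of _ P''] conjI) auto
qed

text \<open>Krull's height theorem, read contrapositively.\<close>

lemma height_theorem:
  assumes "is_prime_chain P e" "set xs \<subseteq> P e" "length xs < e"
  obtains Q where "primeideal Q R" "P 0 \<subseteq> Q" "set xs \<subseteq> Q" "Q \<subset> P e"
proof -
  obtain P' where P': "is_prime_chain P' (e - length xs)" "P' (e - length xs) = P e" "P 0 \<subseteq> P' 0" "set xs \<subseteq> P' 0"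
    using prime_chain_move_list[OF assms(1,2)] assms(3) by auto
  have "P' 0 \<subset> P' k" if "0 < k" "k \<le> e - length xs" for k
    using that
  proof (induction k)
    case (Suc k)
    then have "P' k \<subset> P' (Suc k)" using P'(1) unfolding is_prime_chain_def by auto
    then show ?case using Suc by (cases "k = 0") auto
  qed simp
  from this[of "e - length xs"] have "P' 0 \<subset> P e" using P'(2) assms(3) by simp
  then show ?thesis using that[of "P' 0"] P' unfolding is_prime_chain_def by auto
qed

end

section \<open>Noetherian and regular local rings\<close>

locale noetherian_local_ring = noetherian_cring +
  fixes \<mm> :: "'a set"
  assumes maxi: "maximalideal \<mm> R" and max_unique: "\<And>m. maximalideal m R \<Longrightarrow> m = \<mm>"
begin

lemma mm_ideal: "ideal \<mm> R"
  using maxi by (rule maximalideal.axioms(1))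

lemma mm_prime: "primeideal \<mm> R"
  by (rule maximalideal_prime[OF maxi])

lemma mm_carr: "a \<in> \<mm> \<Longrightarrow> a \<in> carrier R"
  using ideal_carr[OF mm_ideal] .

lemma one_notin_mm: "\<one> \<notin> \<mm>"
  by (rule prime_one[OF mm_prime])

lemma proper_ideal_sub_mm:
  assumes J: "ideal J R" "J \<noteq> carrier R"
  shows "J \<subseteq> \<mm>"
proof -
  define F where "F = {M. ideal M R \<and> J \<subseteq> M \<and> M \<noteq> carrier R}"
  have "F \<noteq> {}" using J unfolding F_def by blast
  then obtain M where M: "M \<in> F" "\<And>K. K \<in> F \<Longrightarrow> M \<subseteq> K \<Longrightarrow> K = M"
    by (rule ex_maximal[of F]) (auto simp: F_def)
  have Mi: "ideal M R" "J \<subseteq> M" "M \<noteq> carrier R" using M(1) unfolding F_def by simp_all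
  have "maximalideal M R"
  proof (rule maximalidealI[OF Mi(1)])
    show "carrier R \<noteq> M" using Mi by simp
    show "K = M \<or> K = carrier R" if "ideal K R" "M \<subseteq> K" "K \<subseteq> carrier R" for K
      using M(2)[of K] that Mi(2) unfolding F_def by auto
  qed
  then show ?thesis using max_unique Mi by simp
qed

lemma unitE:
  assumes "a \<in> carrier R" "a \<notin> \<mm>"
  obtains b where "b \<in> carrier R" "b \<otimes> a = \<one>"
proof -
  have "PIdl a = carrier R"
    using proper_ideal_sub_mm[OF cgenideal_ideal[OF assms(1)]] cgenideal_self[OF assms(1)] assms(2) by blast
  then have "\<one> \<in> PIdl a" by simp
  then show ?thesis using that unfolding cgenideal_def by auto
qed

lemma unit_cancel:
  assumes J: "ideal J R" and "c \<in> carrier R" "c \<notin> \<mm>" "a \<in> carrier R" "c \<otimes> a \<in> J"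
  shows "a \<in> J"
proof -
  obtain b where b: "b \<in> carrier R" "b \<otimes> c = \<one>" using assms(2,3) by (rule unitE)
  have "b \<otimes> (c \<otimes> a) \<in> J" using ideal_mult[OF J assms(5) b(1)] .
  moreover have "b \<otimes> (c \<otimes> a) = a" using b assms by (simp add: m_assoc[symmetric])
  ultimately show ?thesis by simp
qed

lemma sat_mm: "ideal J R \<Longrightarrow> sat \<mm> J = J"
  using sat_sub[OF mm_prime, of J] unit_cancel[of J] by (auto elim: satE)

text \<open>Elements outside the maximal ideal are units, so every ideal is saturated there and the
  localised version applies.\<close>

lemma nakayama:
  assumes M: "ideal M R" and L: "ideal L R"
    and step: "\<And>L'. ideal L' R \<Longrightarrow> L \<subseteq> L' \<Longrightarrow> (\<And>w p. w \<in> M \<Longrightarrow> p \<in> \<mm> \<Longrightarrow> p \<otimes> w \<in> L') \<Longrightarrow> M \<subseteq> L'"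
  shows "M \<subseteq> L"
proof (rule nakayama_saturated[OF mm_prime M L sat_mm[OF L]])
  fix L' u assume *: "ideal L' R" "L \<subseteq> L'" "\<And>w p. w \<in> M \<Longrightarrow> p \<in> \<mm> \<Longrightarrow> p \<otimes> w \<in> L'" and u: "u \<in> M"
  then have "u \<in> L'" using step[OF *] by blast
  then have "\<one> \<otimes> u \<in> L'" using ideal_carr[OF M u] by simp
  then show "\<exists>s\<in>carrier R - \<mm>. s \<otimes> u \<in> L'" using one_notin_mm by blast
qed

text \<open>As the maximal ideal carries \<open>a\<close> into \<open>J\<close>, the coefficient of
  \<open>a\<close> in an element outside \<open>J\<close> must be a unit, and the equation can be
  solved for \<open>a\<close>.\<close>

lemma adj_unit:
  assumes J: "ideal J R" and a: "a \<in> carrier R" "x \<in> adj J a" "x \<notin> J" "\<And>p. p \<in> \<mm> \<Longrightarrow> p \<otimes> a \<in> J"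
  shows "a \<in> adj J x"
proof -
  obtain j c where j: "j \<in> J" "c \<in> carrier R" "x = j \<oplus> c \<otimes> a" using a(2) by (rule adjE)
  have "c \<notin> \<mm>" using a(3,4) j ideal_add[OF J] by blast
  then obtain b where b: "b \<in> carrier R" "b \<otimes> c = \<one>" using j(2) unitE by blast
  have jc: "j \<in> carrier R" using j ideal_carr[OF J] by blast
  have "(\<ominus> (b \<otimes> j)) \<oplus> b \<otimes> x = (b \<otimes> c) \<otimes> a" unfolding j(3) using b(1) j(2) jc a(1) by algebra
  also have "\<dots> = a" using b a by simp
  finally have "a = (\<ominus> (b \<otimes> j)) \<oplus> b \<otimes> x" by simp
  moreover have "\<ominus> (b \<otimes> j) \<in> J" using ideal_neg[OF J] ideal_mult[OF J] j b by blast
  ultimately show ?thesis using adjI[of "\<ominus> (b \<otimes> j)" J b x] b(1) by simp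
qed

lemma adj_commute:
  assumes J: "ideal J R" and ab: "a \<in> carrier R" "b \<in> carrier R"
  shows "adj (adj J a) b = adj (adj J b) a"
proof -
  have "adj (adj J a) b \<subseteq> adj (adj J b) a" if ab: "a \<in> carrier R" "b \<in> carrier R" for a b
  proof (intro adj_least)
    note 1 = adj_ideal[OF J ab(2)] and 2 = adj_ideal[OF adj_ideal[OF J ab(2)] ab(1)]
    show "ideal (adj (adj J b) a) R" "ideal (adj (adj J b) a) R" by (rule 2)+
    show "J \<subseteq> adj (adj J b) a" using adj_sub[OF J ab(2)] adj_sub[OF 1 ab(1)] by blast
    show "a \<in> adj (adj J b) a" by (rule adj_self[OF 1 ab(1)])
    show "b \<in> adj (adj J b) a" using adj_sub[OF 1 ab(1)] adj_self[OF J ab(2)] by blast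
  qed
  then show ?thesis using ab by blast
qed

section \<open>Linear algebra over the residue field by means of ideals\<close>

definition adjl :: "'a set \<Rightarrow> 'a list \<Rightarrow> 'a set" where
  "adjl J fs = foldl adj J fs"

text \<open>Where the maximal ideal carries the listed elements into \<open>J\<close>, this is
  linear independence of their classes over the residue field. It also describes a strictly
  increasing chain of ideals, which ties independence to length.\<close>

fun indep :: "'a set \<Rightarrow> 'a list \<Rightarrow> bool" where
  "indep J [] \<longleftrightarrow> True"
| "indep J (a # as) \<longleftrightarrow> a \<notin> J \<and> indep (adj J a) as"

lemma adjl_Nil [simp]: "adjl J [] = J"
  and adjl_Cons [simp]: "adjl J (f # fs) = adjl (adj J f) fs"
  and adjl_append: "adjl J (fs @ gs) = adjl (adjl J fs) gs"
  unfolding adjl_def by simp_all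

lemma adjl_ideal: "ideal J R \<Longrightarrow> set fs \<subseteq> carrier R \<Longrightarrow> ideal (adjl J fs) R"
  by (induction fs arbitrary: J) (simp_all add: adj_ideal)

lemma adjl_sub: "ideal J R \<Longrightarrow> set fs \<subseteq> carrier R \<Longrightarrow> J \<subseteq> adjl J fs"
proof (induction fs arbitrary: J)
  case (Cons f fs)
  then show ?case using Cons.IH[of "adj J f"] adj_ideal[of J f] adj_sub[of J f] by auto
qed simp

lemma adjl_gens: "ideal J R \<Longrightarrow> set fs \<subseteq> carrier R \<Longrightarrow> set fs \<subseteq> adjl J fs"
proof (induction fs arbitrary: J)
  case (Cons f fs)
  then show ?case using Cons.IH[of "adj J f"] adj_ideal[of J f] adj_self[of J f] adjl_sub[of "adj J f" fs] by auto
qed simp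

lemma adjl_least: "ideal K R \<Longrightarrow> J \<subseteq> K \<Longrightarrow> set fs \<subseteq> K \<Longrightarrow> adjl J fs \<subseteq> K"
proof (induction fs arbitrary: J)
  case (Cons f fs)
  then show ?case using Cons.IH[of "adj J f"] adj_least[of K J f] by simp
qed simp

lemma adjl_mono: "J \<subseteq> K \<Longrightarrow> adjl J fs \<subseteq> adjl K fs"
proof (induction fs arbitrary: J K)
  case (Cons f fs)
  then show ?case using Cons.IH[of "adj J f" "adj K f"] adj_mono[of J K f] by simp
qed simp

lemma indep_append: "indep J (as @ bs) \<longleftrightarrow> indep J as \<and> indep (adjl J as) bs"
  by (induction as arbitrary: J) simp_all

text \<open>Steinitz exchange. If \<open>a\<close> lies in \<open>J + (f)\<close> for the first
  generator \<open>f\<close>, it replaces \<open>f\<close>; otherwise \<open>f\<close> is kept and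
  the replacement takes place among the later generators, modulo \<open>J + (f)\<close>.\<close>

lemma exchange:
  assumes "ideal J R" "set fs \<subseteq> carrier R" "\<And>f p. f \<in> set fs \<Longrightarrow> p \<in> \<mm> \<Longrightarrow> p \<otimes> f \<in> J"
    "a \<in> adjl J fs" "a \<notin> J"
  shows "\<exists>fs'. length fs = Suc (length fs') \<and> set fs' \<subseteq> set fs \<and> adjl J fs \<subseteq> adjl (adj J a) fs'"
  using assms
proof (induction fs arbitrary: J)
  case Nil then show ?case by simp
next
  case (Cons f fs)
  have f: "f \<in> carrier R" "set fs \<subseteq> carrier R" using Cons.prems by simp_all
  note J = Cons.prems(1)
  note aJ = adj_ideal[OF J f(1)]
  have ac: "a \<in> carrier R" using ideal_carr[OF adjl_ideal[OF J Cons.prems(2)] Cons.prems(4)] .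
  show ?case
  proof (cases "a \<in> adj J f")
    case True
    have "f \<in> adj J a" by (rule adj_unit[OF J f(1) True Cons.prems(5)]) (use Cons.prems(3) in simp)
    then have "adj J f \<subseteq> adj J a" by (rule adj_least[OF adj_ideal[OF J ac] adj_sub[OF J ac]])
    then have "adjl J (f # fs) \<subseteq> adjl (adj J a) fs" using adjl_mono by simp
    then show ?thesis by (intro exI[of _ fs]) auto
  next
    case False
    have "p \<otimes> g \<in> adj J f" if "g \<in> set fs" "p \<in> \<mm>" for g p
      using Cons.prems(3)[of g p] that adj_sub[OF J f(1)] by auto
    then obtain fs' where fs': "length fs = Suc (length fs')" "set fs' \<subseteq> set fs" "adjl (adj J f) fs \<subseteq> adjl (adj (adj J f) a) fs'"
      using Cons.IH[OF aJ f(2)] Cons.prems(4) False by auto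
    then show ?thesis
      unfolding adj_commute[OF J f(1) ac] by (intro exI[of _ "f # fs'"]) auto
  qed
qed

lemma exchange_list:
  assumes "ideal J R" "set fs \<subseteq> carrier R" "\<And>f p. f \<in> set fs \<Longrightarrow> p \<in> \<mm> \<Longrightarrow> p \<otimes> f \<in> J"
    "indep J as" "set as \<subseteq> adjl J fs"
  shows "\<exists>fs'. length fs = length as + length fs' \<and> set fs' \<subseteq> set fs \<and> adjl J fs \<subseteq> adjl (adjl J as) fs'"
  using assms
proof (induction as arbitrary: J fs)
  case Nil then show ?case by auto
next
  case (Cons a as)
  note J = Cons.prems(1)
  have ac: "a \<in> carrier R" using ideal_carr[OF adjl_ideal[OF J Cons.prems(2)]] Cons.prems(5) by auto
  obtain gs where gs: "length fs = Suc (length gs)" "set gs \<subseteq> set fs" "adjl J fs \<subseteq> adjl (adj J a) gs"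
    using exchange[OF Cons.prems(1-3), of a] Cons.prems(4,5) by auto
  have "\<exists>fs'. length gs = length as + length fs' \<and> set fs' \<subseteq> set gs \<and> adjl (adj J a) gs \<subseteq> adjl (adjl (adj J a) as) fs'"
  proof (rule Cons.IH[OF adj_ideal[OF J ac]])
    show "set gs \<subseteq> carrier R" using gs Cons.prems by blast
    show "p \<otimes> f \<in> adj J a" if "f \<in> set gs" "p \<in> \<mm>" for f p
      using that gs Cons.prems(3) adj_sub[OF J ac] by blast
    show "indep (adj J a) as" "set as \<subseteq> adjl (adj J a) gs" using Cons.prems(4,5) gs(3) by auto
  qed
  then obtain fs' where "length gs = length as + length fs'" "set fs' \<subseteq> set gs"
    "adjl (adj J a) gs \<subseteq> adjl (adjl (adj J a) as) fs'" by blast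
  then show ?case using gs by (intro exI[of _ fs']) auto
qed

lemma ex_basis:
  assumes "ideal J R" "set fs \<subseteq> carrier R"
  shows "\<exists>as. set as \<subseteq> set fs \<and> length as \<le> length fs \<and> indep J as \<and> adjl J as = adjl J fs"
  using assms
proof (induction fs arbitrary: J)
  case Nil then show ?case by auto
next
  case (Cons f fs)
  show ?case
  proof (cases "f \<in> J")
    case True
    then obtain as where "set as \<subseteq> set fs \<and> length as \<le> length fs \<and> indep J as \<and> adjl J as = adjl J fs"
      using Cons.IH[of J] Cons.prems by auto
    then show ?thesis using adj_absorb[OF Cons.prems(1) True] by (intro exI[of _ as]) auto
  next
    case False
    then obtain as where "set as \<subseteq> set fs \<and> length as \<le> length fs \<and> indep (adj J f) as \<and> adjl (adj J f) as = adjl (adj J f) fs"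
      using Cons.IH[of "adj J f"] Cons.prems adj_ideal[of J f] by auto
    then show ?thesis using False by (intro exI[of _ "f # as"]) auto
  qed
qed

text \<open>Expresses that \<open>A/B\<close> has length at least \<open>k\<close>, in the shape of
  \<open>ideal_chain_from\<close> but with an arbitrary top, so that chains can be prolonged from
  below.\<close>

definition chain_len :: "'a set \<Rightarrow> 'a set \<Rightarrow> nat \<Rightarrow> bool" where
  "chain_len B A k \<longleftrightarrow> (\<exists>C. C 0 = B \<and> C k = A \<and> (\<forall>i\<le>k. ideal (C i) R) \<and> (\<forall>i<k. C i \<subset> C (Suc i)))"

lemma chain_len_refl: "ideal A R \<Longrightarrow> chain_len A A 0"
  unfolding chain_len_def by (intro exI[of _ "\<lambda>_. A"]) simp

lemma chain_len_Cons:
  assumes "ideal B R" "B \<subset> B'" "chain_len B' A k"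
  shows "chain_len B A (Suc k)"
proof -
  obtain C where C: "C 0 = B'" "C k = A" "\<forall>i\<le>k. ideal (C i) R" "\<forall>i<k. C i \<subset> C (Suc i)"
    using assms(3) unfolding chain_len_def by blast
  show ?thesis unfolding chain_len_def
  proof (intro exI[of _ "\<lambda>i. case i of 0 \<Rightarrow> B | Suc j \<Rightarrow> C j"] conjI allI impI)
    show "ideal (case i of 0 \<Rightarrow> B | Suc j \<Rightarrow> C j) R" if "i \<le> Suc k" for i
      using that C(3) assms(1) by (cases i) simp_all
    show "(case i of 0 \<Rightarrow> B | Suc j \<Rightarrow> C j) \<subset> (case Suc i of 0 \<Rightarrow> B | Suc j \<Rightarrow> C j)" if "i < Suc k" for i
      using that C(1,4) assms(2) by (cases i) simp_all
  qed (simp_all add: C(2))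
qed

lemma chain_len_indep:
  assumes "ideal J R" "set as \<subseteq> carrier R" "indep J as" "chain_len (adjl J as) A k"
  shows "chain_len J A (length as + k)"
  using assms
proof (induction as arbitrary: J)
  case (Cons a as)
  have a: "a \<in> carrier R" using Cons.prems by simp
  have "chain_len (adj J a) A (length as + k)"
    using Cons.prems Cons.IH[OF adj_ideal[OF Cons.prems(1) a]] by simp
  moreover have "J \<subset> adj J a" using adj_sub[OF Cons.prems(1) a] adj_self[OF Cons.prems(1) a] Cons.prems(3) by auto
  ultimately show ?case using chain_len_Cons[OF Cons.prems(1)] by simp
qed simp

section \<open>Powers of the maximal ideal\<close>

primrec pw :: "nat \<Rightarrow> 'a set" where
  "pw 0 = carrier R"
| "pw (Suc k) = ideal_prod R \<mm> (pw k)"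

lemma pw_ideal: "ideal (pw k) R"
  by (induction k) (simp_all add: oneideal ideal_prod_is_ideal mm_ideal)

lemma pw_carr: "a \<in> pw k \<Longrightarrow> a \<in> carrier R"
  using ideal_carr[OF pw_ideal] .

lemma pw_1: "pw (Suc 0) = \<mm>"
  using ideal_prod_one[OF mm_ideal] by simp

lemma pw_2: "pw 2 = ideal_prod R \<mm> \<mm>"
  using pw_1 by (simp add: numeral_2_eq_2)

lemma ideal_prod_least:
  assumes "ideal L R" "\<And>a b. a \<in> A \<Longrightarrow> b \<in> B \<Longrightarrow> a \<otimes> b \<in> L"
  shows "ideal_prod R A B \<subseteq> L"
proof
  fix x assume "x \<in> ideal_prod R A B"
  then show "x \<in> L" by induction (auto intro: assms ideal_add)
qed

lemma pw_Suc_least: "ideal L R \<Longrightarrow> (\<And>a b. a \<in> \<mm> \<Longrightarrow> b \<in> pw k \<Longrightarrow> a \<otimes> b \<in> L) \<Longrightarrow> pw (Suc k) \<subseteq> L"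
  using ideal_prod_least by simp

lemma pw_Suc_sub: "pw (Suc k) \<subseteq> pw k"
  by (rule pw_Suc_least[OF pw_ideal]) (auto intro: ideal_mult[OF pw_ideal] mm_carr)

lemma pw_anti: "i \<le> j \<Longrightarrow> pw j \<subseteq> pw i"
  by (rule lift_Suc_antimono_le[of pw]) (use pw_Suc_sub in auto)

lemma pw_mm_mult: "a \<in> \<mm> \<Longrightarrow> b \<in> pw k \<Longrightarrow> a \<otimes> b \<in> pw (Suc k)"
  using ideal_prod.prod[of a \<mm> b "pw k" R] by simp

lemma pw_mult: "a \<in> pw i \<Longrightarrow> b \<in> pw j \<Longrightarrow> a \<otimes> b \<in> pw (i + j)"
proof (induction i arbitrary: a)
  case 0 then show ?case using ideal_mult[OF pw_ideal] by simp
next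
  case (Suc i)
  have bc: "b \<in> carrier R" using Suc.prems pw_carr by blast
  \<comment> \<open>The elements that carry \<open>b\<close> into the required power form an ideal,
    so it suffices to check products.\<close>
  have "pw (Suc i) \<subseteq> {a \<in> carrier R. a \<otimes> b \<in> pw (Suc i + j)}"
  proof (rule pw_Suc_least)
    show "ideal {a \<in> carrier R. a \<otimes> b \<in> pw (Suc i + j)} R"
      by (rule idealI') (use bc in \<open>auto simp: l_distr m_assoc simp del: pw.simps intro: ideal_closed[OF pw_ideal]\<close>)
    fix p c assume p: "p \<in> \<mm>" "c \<in> pw i"
    have "p \<otimes> (c \<otimes> b) \<in> pw (Suc (i + j))" using Suc.IH[OF p(2) Suc.prems(2)] by (rule pw_mm_mult[OF p(1)])
    then show "p \<otimes> c \<in> {a \<in> carrier R. a \<otimes> b \<in> pw (Suc i + j)}"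
      using p mm_carr pw_carr bc by (simp add: m_assoc)
  qed
  then show ?case using Suc.prems by blast
qed

lemma pw_nat_pow: "a \<in> \<mm> \<Longrightarrow> a [^] (k::nat) \<in> pw k"
proof (induction k)
  case (Suc k)
  then have "a \<otimes> a [^] k \<in> pw (Suc k)" by (intro pw_mm_mult) auto
  then show ?case using Suc.prems mm_carr m_comm by (simp del: pw.simps)
qed simp

lemma adj_sum_mult:
  assumes Q: "ideal Q R" and x: "x \<in> carrier R" "y \<in> carrier R" and a: "a \<in> adj Q x" and b: "b \<in> adj Q y"
  shows "a \<otimes> b \<in> adj Q (x \<otimes> y)"
proof -
  obtain p c where p: "p \<in> Q" "c \<in> carrier R" "a = p \<oplus> c \<otimes> x" using a by (rule adjE)
  obtain q e where q: "q \<in> Q" "e \<in> carrier R" "b = q \<oplus> e \<otimes> y" using b by (rule adjE)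
  have pc: "p \<in> carrier R" "q \<in> carrier R" using p q ideal_carr[OF Q] by auto
  have "a \<otimes> b = (p \<otimes> (q \<oplus> e \<otimes> y) \<oplus> (c \<otimes> x) \<otimes> q) \<oplus> (c \<otimes> e) \<otimes> (x \<otimes> y)"
    unfolding p(3) q(3) using pc p(2) q(2) x by algebra
  moreover have "p \<otimes> (q \<oplus> e \<otimes> y) \<oplus> (c \<otimes> x) \<otimes> q \<in> Q"
    using pc p(1,2) q(1,2) x by (intro ideal_add[OF Q] ideal_mult[OF Q] ideal_multr[OF Q]) auto
  ultimately show ?thesis using adjI[of _ Q "c \<otimes> e" "x \<otimes> y"] p q by simp
qed

end

section \<open>Regular local rings and their discrete valuation quotients\<close>

locale regular_local = noetherian_local_ring +
  fixes d :: nat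
  assumes dim_chain: "\<exists>P. is_prime_chain P d \<and> P d = \<mm>"
    and mm_gens: "\<exists>xs. length xs = d \<and> set xs \<subseteq> carrier R \<and> \<mm> = adjl {\<zero>} xs"
begin

lemma height_mm:
  assumes "set ys \<subseteq> \<mm>" "length ys < d"
  obtains Q where "primeideal Q R" "set ys \<subseteq> Q" "Q \<subset> \<mm>"
proof -
  obtain P where P: "is_prime_chain P d" "P d = \<mm>" using dim_chain by blast
  obtain Q where "primeideal Q R" "P 0 \<subseteq> Q" "set ys \<subseteq> Q" "Q \<subset> P d"
    by (rule height_theorem[OF P(1)]) (use assms P in auto)
  then show ?thesis using that P by simp
qed

text \<open>Modulo \<open>Q\<close> the elements of \<open>fs\<close> vanish, so \<open>x\<close>
  alone spans the cotangent space there, and Nakayama's lemma lifts this to the maximal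
  ideal.\<close>

lemma mm_span_mod:
  assumes Q: "ideal Q R" and fs: "set fs \<subseteq> Q" "x \<in> \<mm>" and span: "\<mm> \<subseteq> adjl (pw 2) (x # fs)"
  shows "\<mm> \<subseteq> adj Q x"
proof (rule nakayama[OF mm_ideal adj_ideal[OF Q mm_carr[OF fs(2)]]])
  fix L' assume L': "ideal L' R" "adj Q x \<subseteq> L'" "\<And>w p. w \<in> \<mm> \<Longrightarrow> p \<in> \<mm> \<Longrightarrow> p \<otimes> w \<in> L'"
  have "pw 2 \<subseteq> L'" unfolding pw_2 by (rule ideal_prod_least[OF L'(1)]) (use L'(3) in blast)
  moreover have "set (x # fs) \<subseteq> L'"
    using L'(2) fs adj_sub[OF Q mm_carr[OF fs(2)]] adj_self[OF Q mm_carr[OF fs(2)]] by auto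
  ultimately have "adjl (pw 2) (x # fs) \<subseteq> L'" by (intro adjl_least[OF L'(1)])
  then show "\<mm> \<subseteq> L'" using span by blast
qed

text \<open>Fewer than \<open>d\<close> elements lie in a prime strictly below \<open>\<mm>\<close>;
  if they spanned modulo \<open>\<mm>\<^sup>2\<close>, Nakayama's lemma would make that prime
  contain \<open>\<mm>\<close>.\<close>

lemma span_length:
  assumes "set fs \<subseteq> \<mm>" "\<mm> \<subseteq> adjl (pw 2) fs"
  shows "d \<le> length fs"
proof (rule ccontr)
  assume "\<not> d \<le> length fs"
  then obtain Q where Q: "primeideal Q R" "set fs \<subseteq> Q" "Q \<subset> \<mm>" using height_mm[OF assms(1)] by auto
  \<comment> \<open>Zero takes the place of the extra parameter in
    \<open>mm_span_mod\<close>.\<close>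
  have z: "\<zero> \<in> \<mm>" by (rule ideal_zero[OF mm_ideal])
  have "adj (pw 2) \<zero> = pw 2" by (rule adj_absorb[OF pw_ideal ideal_zero[OF pw_ideal]])
  then have "\<mm> \<subseteq> adj Q \<zero>"
    using mm_span_mod[OF prime_ideal[OF Q(1)] Q(2) z] assms(2) by simp
  then show False using adj_absorb[OF prime_ideal[OF Q(1)] ideal_zero[OF prime_ideal[OF Q(1)]]] Q by blast
qed

lemma mm_basis:
  obtains xs where "length xs = d" "set xs \<subseteq> \<mm>" "indep (pw 2) xs" "adjl (pw 2) xs = \<mm>"
proof -
  obtain xs where xs: "length xs = d" "set xs \<subseteq> carrier R" "\<mm> = adjl {\<zero>} xs" using mm_gens by blast
  have xm: "set xs \<subseteq> \<mm>" using adjl_gens[OF zeroideal xs(2)] xs(3) by simp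
  have le: "adjl (pw 2) xs \<subseteq> \<mm>"
    using adjl_least[OF mm_ideal _ xm, of "pw 2"] pw_anti[of "Suc 0" 2] pw_1 by simp
  have "\<mm> \<subseteq> adjl (pw 2) xs" using adjl_mono[of "{\<zero>}" "pw 2" xs] ideal_zero[OF pw_ideal] xs(3) by simp
  with le have eq: "adjl (pw 2) xs = \<mm>" by blast
  obtain as where as: "set as \<subseteq> set xs" "length as \<le> length xs" "indep (pw 2) as" "adjl (pw 2) as = adjl (pw 2) xs"
    using ex_basis[OF pw_ideal xs(2)] by blast
  have "d \<le> length as" by (rule span_length) (use as xm eq in auto)
  then show ?thesis using that[of as] as xm eq xs(1) by auto
qed

text \<open>Steinitz exchange against a regular system of parameters, used to complete given linear
  forms to such a system.\<close>

lemma basis_extend: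
  assumes "set ys \<subseteq> \<mm>" "indep (pw 2) ys"
  obtains zs where "set zs \<subseteq> \<mm>" "length ys + length zs = d" "adjl (pw 2) (ys @ zs) = \<mm>"
proof -
  obtain xs where xs: "length xs = d" "set xs \<subseteq> \<mm>" "indep (pw 2) xs" "adjl (pw 2) xs = \<mm>" by (rule mm_basis)
  have xc: "set xs \<subseteq> carrier R" using xs mm_carr by blast
  have "\<exists>fs'. length xs = length ys + length fs' \<and> set fs' \<subseteq> set xs \<and> adjl (pw 2) xs \<subseteq> adjl (adjl (pw 2) ys) fs'"
  proof (rule exchange_list[OF pw_ideal xc])
    show "p \<otimes> f \<in> pw 2" if "f \<in> set xs" "p \<in> \<mm>" for f p
      using ideal_prod.prod[of p \<mm> f \<mm> R] that xs(2) unfolding pw_2 by blast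
  qed (use assms xs in auto)
  then obtain zs where zs: "length xs = length ys + length zs" "set zs \<subseteq> set xs" "\<mm> \<subseteq> adjl (pw 2) (ys @ zs)"
    using xs(4) adjl_append by auto
  moreover have "adjl (pw 2) (ys @ zs) \<subseteq> \<mm>"
    using adjl_least[OF mm_ideal _, of "pw 2" "ys @ zs"] pw_anti[of "Suc 0" 2] pw_1 assms(1) zs xs by auto
  ultimately show ?thesis using that[of zs] xs by auto
qed

text \<open>The quotient by \<open>Q\<close> is a domain whose maximal ideal is generated by the
  nonzero class of \<open>x\<close>, hence a discrete valuation ring with uniformizer
  \<open>x\<close>. The last two claims say that elements of \<open>pw t\<close> have valuation at
  least \<open>t\<close> and that a unit times \<open>x^t\<close> has valuation exactly
  \<open>t\<close>; they take over the task of reading off the coefficient of \<open>x^t\<close> in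
  the associated graded ring.\<close>

lemma regular_parameter:
  assumes x: "x \<in> \<mm>" and ys: "set ys \<subseteq> \<mm>" "length ys < d" and span: "\<mm> \<subseteq> adjl (pw 2) (x # ys)"
  obtains Q where "primeideal Q R" "set ys \<subseteq> Q" "Q \<subset> \<mm>" "x \<notin> Q" "\<And>t. pw t \<subseteq> adj Q (x [^] t)"
    "\<And>t c. c \<in> carrier R \<Longrightarrow> c \<otimes> x [^] (t::nat) \<in> adj Q (x [^] Suc t) \<Longrightarrow> c \<in> \<mm>"
proof -
  obtain Q where Q: "primeideal Q R" "set ys \<subseteq> Q" "Q \<subset> \<mm>" by (rule height_mm[OF ys])
  note Qi = prime_ideal[OF Q(1)] and xc = mm_carr[OF x]
  have mm: "\<mm> \<subseteq> adj Q x" by (rule mm_span_mod[OF Qi Q(2) x span])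
  have xQ: "x \<notin> Q" using mm adj_absorb[OF Qi, of x] Q(3) by blast
  have pow: "pw t \<subseteq> adj Q (x [^] t)" for t
  proof (induction t)
    case 0
    have "\<one> \<in> adj Q \<one>" by (rule adj_self[OF Qi one_closed])
    then have "adj Q \<one> = carrier R" using ideal.one_imp_carrier[OF adj_ideal[OF Qi one_closed]] by simp
    then show ?case by simp
  next
    case (Suc t)
    show ?case
    proof (rule pw_Suc_least[OF adj_ideal[OF Qi]])
      fix a b assume "a \<in> \<mm>" "b \<in> pw t"
      then have "a \<otimes> b \<in> adj Q (x \<otimes> x [^] t)" using mm Suc by (intro adj_sum_mult[OF Qi]) (auto simp: xc)
      then show "a \<otimes> b \<in> adj Q (x [^] Suc t)" using xc m_comm by simp
    qed (simp add: xc)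
  qed
  have "c \<in> \<mm>" if c: "c \<in> carrier R" "c \<otimes> x [^] t \<in> adj Q (x [^] Suc t)" for t :: nat and c
  proof -
    obtain q e where q: "q \<in> Q" "e \<in> carrier R" "c \<otimes> x [^] t = q \<oplus> e \<otimes> x [^] Suc t" using c(2) by (rule adjE)
    have qc: "q \<in> carrier R" "x [^] t \<in> carrier R" using q ideal_carr[OF Qi] xc by auto
    have "(c \<ominus> e \<otimes> x) \<otimes> x [^] t = c \<otimes> x [^] t \<ominus> e \<otimes> (x [^] t \<otimes> x)" using c(1) qc q(2) xc by algebra
    also have "\<dots> = q" unfolding q(3) nat_pow_Suc using qc q(2) xc by algebra
    finally have "(c \<ominus> e \<otimes> x) \<otimes> x [^] t \<in> Q" using q(1) by simp
    moreover have "c \<ominus> e \<otimes> x \<in> carrier R" using c q xc by simp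
    ultimately have "c \<ominus> e \<otimes> x \<in> Q" using primeD[OF Q(1) _ qc(2)] prime_pow[OF Q(1) xc] xQ by blast
    then show ?thesis using ideal_cancel'[OF mm_ideal, of c "e \<otimes> x"] Q(3) ideal_mult[OF mm_ideal x q(2)] c(1) by blast
  qed
  then show ?thesis using that[OF Q xQ pow] by blast
qed

end

section \<open>The quotient by an ideal that is not Burch\<close>

text \<open>The assumption \<open>not_gorenstein\<close> denies that a single nonzero class spans
  the socle of the quotient, so exhibiting such a class is always a contradiction.\<close>

locale non_burch_quotient = regular_local +
  fixes I :: "'a set"
  assumes I_ideal: "ideal I R" and I_sub: "I \<subseteq> pw 2"
    and len6: "\<And>e. chain_len I (carrier R) e \<Longrightarrow> e \<le> 6"
    and not_burch: "ideal_prod R \<mm> (ideal_colon R I \<mm>) = ideal_prod R \<mm> I"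
    and not_gorenstein: "\<And>t. t \<in> ideal_colon R I \<mm> \<Longrightarrow> t \<notin> I \<Longrightarrow> \<not> ideal_colon R I \<mm> \<subseteq> adj I t"
begin

abbreviation "soc \<equiv> ideal_colon R I \<mm>"

lemma soc_iff: "s \<in> soc \<longleftrightarrow> s \<in> carrier R \<and> (\<forall>p\<in>\<mm>. p \<otimes> s \<in> I)"
  using mm_carr m_comm unfolding ideal_colon_def by auto

lemma soc_mult: "s \<in> soc \<Longrightarrow> p \<in> \<mm> \<Longrightarrow> p \<otimes> s \<in> ideal_prod R \<mm> I"
  using ideal_prod.prod[of p \<mm> s soc R] not_burch by simp

lemma mI_sub: "ideal_prod R \<mm> I \<subseteq> pw 3"
  by (rule ideal_prod_least[OF pw_ideal]) (use pw_mm_mult[of _ _ 2] I_sub in \<open>auto simp: numeral_3_eq_3 numeral_2_eq_2 simp del: pw.simps\<close>)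

lemma I_sub_mm: "I \<subseteq> \<mm>"
  using I_sub pw_anti[of "Suc 0" 2] pw_1 by simp

text \<open>In dimension zero the ring is a field, and then the class of one spans the socle of the
  quotient.\<close>

lemma d_pos: "0 < d"
proof (rule ccontr)
  assume "\<not> 0 < d"
  then have mm0: "\<mm> = {\<zero>}" using mm_gens by auto
  have "soc = carrier R" by (auto simp: ideal_colon_def mm0 ideal_zero[OF I_ideal])
  moreover have "\<one> \<notin> I" using I_sub_mm one_notin_mm by blast
  moreover have "carrier R \<subseteq> adj I \<one>" using adjI[OF ideal_zero[OF I_ideal], of _ \<one>] by auto
  ultimately show False using not_gorenstein[of \<one>] by simp
qed

lemma mm_not_sub_pw2: "\<not> \<mm> \<subseteq> pw 2"
  using span_length[of "[]"] d_pos by auto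

lemma soc_sub: "soc \<subseteq> pw 2"
proof
  fix s assume s: "s \<in> soc"
  then have sc: "s \<in> carrier R" using soc_iff by blast
  have sm: "s \<in> \<mm>"
  proof (rule ccontr)
    assume "s \<notin> \<mm>"
    have "p \<in> I" if "p \<in> \<mm>" for p
      using unit_cancel[OF I_ideal sc \<open>s \<notin> \<mm>\<close> mm_carr[OF that]] s that unfolding ideal_colon_def by blast
    then show False using mm_not_sub_pw2 I_sub by blast
  qed
  show "s \<in> pw 2"
  proof (rule ccontr)
    assume n: "s \<notin> pw 2"
    \<comment> \<open>Completed to a regular system of parameters, \<open>s\<close> becomes a
      uniformizer modulo a prime over the others; there its square, coming from
      \<open>\<mm>\<^sup>3\<close>, would be a multiple of its cube.\<close>
    obtain zs where zs: "set zs \<subseteq> \<mm>" "length [s] + length zs = d" "adjl (pw 2) ([s] @ zs) = \<mm>"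
      by (rule basis_extend[of "[s]"]) (use sm n in auto)
    obtain Q where Q: "\<And>t. pw t \<subseteq> adj Q (s [^] t)"
      "\<And>t c. c \<in> carrier R \<Longrightarrow> c \<otimes> s [^] (t::nat) \<in> adj Q (s [^] Suc t) \<Longrightarrow> c \<in> \<mm>"
      by (rule regular_parameter[of s zs]) (use sm zs in auto)
    have "s \<otimes> s \<in> pw 3" using soc_mult[OF s sm] mI_sub by blast
    then have "\<one> \<otimes> s [^] (2::nat) \<in> adj Q (s [^] Suc 2)"
      using Q(1)[of 3] sc by (simp add: numeral_2_eq_2 numeral_3_eq_3 subset_iff del: pw.simps)
    then show False using Q(2)[of \<one> 2] one_notin_mm by simp
  qed
qed

text \<open>This is the preimage of the \<open>k\<close>-th power of the maximal ideal of the
  quotient by \<open>I\<close>.\<close>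

definition J :: "nat \<Rightarrow> 'a set" where
  "J k = pw k <+> I"

lemma J_ideal: "ideal (J k) R"
  unfolding J_def by (rule add_ideals[OF pw_ideal I_ideal])

lemma pw_sub_J: "pw k \<subseteq> J k"
proof
  fix a assume a: "a \<in> pw k"
  then have "a = a \<oplus> \<zero>" using pw_carr by simp
  then show "a \<in> J k" unfolding J_def set_add_def' using a ideal_zero[OF I_ideal] by blast
qed

lemma I_sub_J: "I \<subseteq> J k"
proof
  fix a assume a: "a \<in> I"
  then have "a = \<zero> \<oplus> a" using ideal_carr[OF I_ideal] by simp
  then show "a \<in> J k" unfolding J_def set_add_def' using a ideal_zero[OF pw_ideal] by blast
qed

lemma J_least: "ideal K R \<Longrightarrow> pw k \<subseteq> K \<Longrightarrow> I \<subseteq> K \<Longrightarrow> J k \<subseteq> K"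
  unfolding J_def set_add_def' by (auto intro!: ideal_add)

lemma J_anti: "i \<le> j \<Longrightarrow> J j \<subseteq> J i"
  using J_least[OF J_ideal] pw_anti[of i j] pw_sub_J I_sub_J by blast

lemma J_mult:
  assumes a: "a \<in> pw i" and b: "b \<in> J j"
  shows "a \<otimes> b \<in> J (i + j)"
proof -
  obtain w v where w: "w \<in> pw j" "v \<in> I" "b = w \<oplus> v" using b unfolding J_def set_add_def' by blast
  have "a \<otimes> w \<in> J (i + j)" using pw_mult[OF a w(1)] pw_sub_J by blast
  moreover have "a \<otimes> v \<in> J (i + j)" using ideal_mult[OF I_ideal w(2) pw_carr[OF a]] I_sub_J by blast
  moreover have "a \<otimes> b = a \<otimes> w \<oplus> a \<otimes> v"
    unfolding w(3) using pw_carr[OF a] pw_carr[OF w(1)] ideal_carr[OF I_ideal w(2)] by algebra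
  ultimately show ?thesis using ideal_add[OF J_ideal] by simp
qed

lemma J_mult_mm: "a \<in> \<mm> \<Longrightarrow> b \<in> J j \<Longrightarrow> a \<otimes> b \<in> J (Suc j)"
  using J_mult[of a "Suc 0" b j] pw_1 by simp

text \<open>Nakayama's lemma in the quotient: consecutive powers of its maximal ideal agree only
  when they vanish.\<close>

lemma pw_sub_I_nakayama: "pw k \<subseteq> J (Suc k) \<Longrightarrow> pw k \<subseteq> I"
proof (rule nakayama[OF pw_ideal I_ideal])
  fix L' assume k: "pw k \<subseteq> J (Suc k)" and L': "ideal L' R" "I \<subseteq> L'" "\<And>w p. w \<in> pw k \<Longrightarrow> p \<in> \<mm> \<Longrightarrow> p \<otimes> w \<in> L'"
  have "pw (Suc k) \<subseteq> L'" by (rule pw_Suc_least[OF L'(1)]) (rule L'(3))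
  then show "pw k \<subseteq> L'" using J_least[OF L'(1) _ L'(2)] k by blast
qed

lemma J_eq_I: "pw k \<subseteq> I \<Longrightarrow> J k = I"
  using J_least[OF I_ideal] I_sub_J by blast

text \<open>Otherwise Nakayama's lemma makes the \<open>J k\<close> strictly decreasing, and
  together with \<open>I\<close> they form a chain longer than the length permits.\<close>

lemma pw_nilpotent: "\<exists>k. pw k \<subseteq> I"
proof (rule ccontr)
  assume "\<not> ?thesis"
  then have no: "\<not> pw k \<subseteq> I" for k by blast
  have "chain_len (J k) (carrier R) k" for k
  proof (induction k)
    case 0
    have "J 0 = carrier R" using pw_sub_J[of 0] ideal_carr[OF J_ideal] by auto
    then show ?case using chain_len_refl[OF oneideal] by simp
  next
    case (Suc k)
    have "\<not> J k \<subseteq> J (Suc k)" using pw_sub_I_nakayama[of k] pw_sub_J[of k] no[of k] by blast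
    then have "J (Suc k) \<subset> J k" using J_anti[of k "Suc k"] by auto
    then show ?case by (rule chain_len_Cons[OF J_ideal _ Suc.IH])
  qed
  from this[of 7] have "chain_len I (carrier R) (Suc 7)"
    by (rule chain_len_Cons[OF I_ideal, rotated]) (use I_sub_J pw_sub_J no[of 7] in blast)
  from len6[OF this] show False by simp
qed

text \<open>If \<open>\<mm>\<^sup>2/\<mm>\<^sup>3\<close> of the quotient is cyclic, then it is spanned by some product \<open>uv\<close>, each
  later \<open>\<mm>\<^sup>k/\<mm>\<^sup>k\<^sup>+\<^sup>1\<close> is spanned by \<open>v\<^sup>k\<^sup>-\<^sup>2uv\<close>, and the socle is the last nonzero power.\<close>

lemma second_layer_not_cyclic:
  assumes q: "q \<in> pw 2" shows "\<not> pw 2 \<subseteq> adj (J 3) q"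
proof
  assume span: "pw 2 \<subseteq> adj (J 3) q"
  have n2: "\<not> pw 2 \<subseteq> J 3"
  proof
    assume "pw 2 \<subseteq> J 3"
    then have "pw 2 \<subseteq> I" using pw_sub_I_nakayama[of 2] by (simp add: numeral_3_eq_3 numeral_2_eq_2 del: pw.simps)
    then have "\<mm> \<subseteq> soc" using ideal_prod.prod[of _ \<mm> _ \<mm> R] mm_carr unfolding soc_iff subset_iff pw_2 by blast
    then show False using soc_sub mm_not_sub_pw2 by blast
  qed
  have J23: "p \<otimes> a \<in> J 3" if "a \<in> pw 2" "p \<in> \<mm>" for a p
    using J_mult_mm[of p a 2] that pw_sub_J[of 2] by (auto simp: numeral_3_eq_3 numeral_2_eq_2 simp del: pw.simps)
  \<comment> \<open>\<open>\<mm>\<^sup>2\<close> is generated by products and is not contained in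
    \<open>J 3\<close>, so one product survives and can replace \<open>q\<close> as spanning
    element.\<close>
  obtain u v where uv: "u \<in> \<mm>" "v \<in> \<mm>" "u \<otimes> v \<notin> J 3"
    using n2 ideal_prod_least[OF J_ideal, of \<mm> \<mm> 3] unfolding pw_2 by blast
  have uvc: "u \<in> carrier R" "v \<in> carrier R" using uv mm_carr by auto
  have uv2: "u \<otimes> v \<in> pw 2" using uv ideal_prod.prod[of u \<mm> v \<mm> R] unfolding pw_2 by blast
  have "q \<in> adj (J 3) (u \<otimes> v)"
    by (rule adj_unit[OF J_ideal pw_carr[OF q] _ uv(3)]) (use span uv2 J23[OF q] in blast)+
  then have span: "pw 2 \<subseteq> adj (J 3) (u \<otimes> v)"
    using adj_least[OF adj_ideal[OF J_ideal] adj_sub[OF J_ideal]] span uvc by (meson m_closed subset_trans)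
  define t where "t k = v [^] k \<otimes> (u \<otimes> v)" for k :: nat
  have tc: "t k \<in> carrier R" for k unfolding t_def using uvc by simp
  have tp: "t k \<in> pw (k + 2)" for k unfolding t_def by (rule pw_mult[OF pw_nat_pow[OF uv(2)] uv2])
  have layer: "pw (k + 2) \<subseteq> adj (J (k + 3)) (t k)" for k
  proof (induction k)
    case 0
    have "t 0 = u \<otimes> v" unfolding t_def using uvc by simp
    then show ?case using span unfolding add_0 by simp
  next
    case (Suc k)
    have "pw (Suc (k + 2)) \<subseteq> adj (J (k + 4)) (t (Suc k))"
    proof (rule pw_Suc_least[OF adj_ideal[OF J_ideal tc]])
      fix a b assume a: "a \<in> \<mm>" and b: "b \<in> pw (k + 2)"
      obtain j c where j: "j \<in> J (k + 3)" "c \<in> carrier R" "b = j \<oplus> c \<otimes> t k" using Suc.IH b by (blast elim: adjE)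
      have "a \<otimes> u \<in> pw 2" using a uv ideal_prod.prod[of a \<mm> u \<mm> R] unfolding pw_2 by blast
      then obtain j' e where j': "j' \<in> J 3" "e \<in> carrier R" "a \<otimes> u = j' \<oplus> e \<otimes> (u \<otimes> v)"
        using span by (blast elim: adjE)
      define z where "z = v [^] k"
      have c: "a \<in> carrier R" "j \<in> carrier R" "j' \<in> carrier R" "z \<in> carrier R"
        using mm_carr[OF a] ideal_carr[OF J_ideal j(1)] ideal_carr[OF J_ideal j'(1)] uvc z_def by auto
      \<comment> \<open>Regrouping is the point: in \<open>a v^k u v\<close> the factor
        \<open>a u\<close> is again a multiple of \<open>u v\<close> modulo \<open>J 3\<close>,
        which raises the exponent of \<open>v\<close> by one.\<close>
      have "a \<otimes> b = a \<otimes> j \<oplus> c \<otimes> (z \<otimes> v) \<otimes> (a \<otimes> u)"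
        unfolding j(3) t_def z_def[symmetric] using c j(2) uvc by algebra
      also have "\<dots> = (a \<otimes> j \<oplus> c \<otimes> ((z \<otimes> v) \<otimes> j')) \<oplus> (c \<otimes> e) \<otimes> ((z \<otimes> v) \<otimes> (u \<otimes> v))"
        unfolding j'(3) using c j(2) j'(2) uvc by algebra
      also have "(z \<otimes> v) \<otimes> (u \<otimes> v) = t (Suc k)" unfolding t_def z_def by simp
      finally have "a \<otimes> b = (a \<otimes> j \<oplus> c \<otimes> ((z \<otimes> v) \<otimes> j')) \<oplus> (c \<otimes> e) \<otimes> t (Suc k)" .
      moreover have "a \<otimes> j \<oplus> c \<otimes> ((z \<otimes> v) \<otimes> j') \<in> J (k + 4)"
      proof (intro ideal_add[OF J_ideal] ideal_mult[OF J_ideal _ j(2)])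
        show "a \<otimes> j \<in> J (k + 4)" using J_mult_mm[OF a j(1)] by (simp add: eval_nat_numeral)
        have "z \<otimes> v \<in> pw (Suc k)" using pw_nat_pow[OF uv(2), of "Suc k"] unfolding z_def by (simp del: pw.simps)
        from J_mult[OF this j'(1)] show "z \<otimes> v \<otimes> j' \<in> J (k + 4)" by (simp add: eval_nat_numeral)
      qed
      ultimately show "a \<otimes> b \<in> adj (J (k + 4)) (t (Suc k))" using adjI j(2) j'(2) by simp
    qed
    then show ?case by (simp add: eval_nat_numeral del: pw.simps)
  qed
  define N where "N = (LEAST k. pw k \<subseteq> I)"
  have N: "pw N \<subseteq> I" unfolding N_def using pw_nilpotent by (rule LeastI_ex)
  have Nmin: "\<not> pw k \<subseteq> I" if "k < N" for k using not_less_Least[of k "\<lambda>k. pw k \<subseteq> I"] that unfolding N_def by blast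
  have "\<not> N \<le> 2"
  proof
    assume "N \<le> 2"
    then have "pw 2 \<subseteq> I" using pw_anti[of N 2] N by blast
    then show False using n2 I_sub_J by blast
  qed
  \<comment> \<open>\<open>N\<close> is at least 3, and \<open>t m\<close> spans the last power not
    contained in \<open>I\<close>, whose exponent is \<open>N - 1 = m + 2\<close>.\<close>
  define m where "m = N - 3"
  have Nm: "N = m + 3" unfolding m_def using \<open>\<not> N \<le> 2\<close> by simp
  have JN: "J (m + 3) = I" using J_eq_I[OF N] Nm by simp
  have last: "pw (m + 2) \<subseteq> adj I (t m)" using layer[of m] JN by simp
  have tI: "t m \<notin> I" using last adj_absorb[OF I_ideal, of "t m"] Nmin[of "m + 2"] Nm by auto
  have tsoc: "t m \<in> soc" unfolding soc_iff
  proof (intro conjI ballI tc)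
    fix p assume "p \<in> \<mm>"
    from pw_mm_mult[OF this tp[of m]] show "p \<otimes> t m \<in> I" using N Nm by (auto simp: eval_nat_numeral simp del: pw.simps)
  qed
  have "s \<in> adj I (t m)" if s: "s \<in> soc" for s
  proof -
    have sc: "s \<in> carrier R" using s soc_iff by blast
    \<comment> \<open>The socle element is pushed down the filtration. If it survived in layer
      \<open>i + 2\<close>, it would span that layer; being killed by the maximal ideal, it would
      make the next power vanish although its exponent \<open>i + 3\<close> is still below
      \<open>N\<close>.\<close>
    have "i \<le> m \<Longrightarrow> s \<in> J (i + 2)" for i
    proof (induction i)
      case 0 then show ?case unfolding add_0 using s soc_sub pw_sub_J[of 2] by blast
    next
      case (Suc i)
      then have "s \<in> J (i + 2)" using Suc_leD by blast
      also have "J (i + 2) \<subseteq> adj (J (i + 3)) (t i)"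
        by (rule J_least[OF adj_ideal[OF J_ideal tc] layer]) (use I_sub_J adj_sub[OF J_ideal tc] in blast)
      finally have si: "s \<in> adj (J (i + 3)) (t i)" .
      have "s \<in> J (i + 3)"
      proof (rule ccontr)
        assume no: "s \<notin> J (i + 3)"
        have "p \<otimes> t i \<in> J (i + 3)" if "p \<in> \<mm>" for p
          using pw_mm_mult[OF that tp[of i]] pw_sub_J[of "i + 3"] by (auto simp: eval_nat_numeral simp del: pw.simps)
        from adj_unit[OF J_ideal tc si no this] have "t i \<in> adj (J (i + 3)) s" .
        then have "adj (J (i + 3)) (t i) \<subseteq> adj (J (i + 3)) s"
          by (rule adj_least[OF adj_ideal[OF J_ideal sc] adj_sub[OF J_ideal sc]])
        then have sp: "pw (i + 2) \<subseteq> adj (J (i + 3)) s" using layer[of i] by blast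
        have "pw (Suc (i + 2)) \<subseteq> J (i + 4)"
        proof (rule pw_Suc_least[OF J_ideal])
          fix a b assume a: "a \<in> \<mm>" and b: "b \<in> pw (i + 2)"
          obtain j c where j: "j \<in> J (i + 3)" "c \<in> carrier R" "b = j \<oplus> c \<otimes> s" using sp b by (blast elim: adjE)
          have c: "a \<in> carrier R" "j \<in> carrier R" using mm_carr[OF a] ideal_carr[OF J_ideal j(1)] by auto
          have "a \<otimes> b = a \<otimes> j \<oplus> c \<otimes> (a \<otimes> s)" unfolding j(3) using c j(2) sc by algebra
          also have "\<dots> \<in> J (i + 4)"
          proof (intro ideal_add[OF J_ideal] ideal_mult[OF J_ideal _ j(2)])
            show "a \<otimes> j \<in> J (i + 4)" using J_mult_mm[OF a j(1)] by (simp add: eval_nat_numeral)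
            show "a \<otimes> s \<in> J (i + 4)" using s a I_sub_J unfolding soc_iff by blast
          qed
          finally show "a \<otimes> b \<in> J (i + 4)" .
        qed
        then have "pw (i + 3) \<subseteq> J (Suc (i + 3))" by (simp add: eval_nat_numeral del: pw.simps)
        then have "pw (i + 3) \<subseteq> I" by (rule pw_sub_I_nakayama)
        then show False using Nmin[of "i + 3"] Suc.prems Nm by simp
      qed
      then show ?case by (simp add: eval_nat_numeral)
    qed
    from this[of m] have "s \<in> J (m + 2)" by simp
    moreover have "J (m + 2) \<subseteq> adj I (t m)" by (rule J_least[OF adj_ideal[OF I_ideal tc] last adj_sub[OF I_ideal tc]])
    ultimately show ?thesis by blast
  qed
  then show False using not_gorenstein[OF tsoc tI] by blast
qed

section \<open>Bounds on the dimension by counting length\<close>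

lemma J3_sub: "J 3 \<subseteq> pw 2"
  by (rule J_least[OF pw_ideal pw_anti I_sub]) simp

text \<open>The steps are one above \<open>\<mm>\<close>, \<open>d\<close> from
  \<open>\<mm>\<^sup>2\<close> up to \<open>\<mm>\<close>, and two from \<open>J 3\<close> up to
  \<open>\<mm>\<^sup>2\<close>, since no single element spans the second layer.\<close>

lemma J3_chain: "chain_len (J 3) (carrier R) (d + 3)"
proof -
  have "adj (J 3) \<zero> = J 3" by (rule adj_absorb[OF J_ideal ideal_zero[OF J_ideal]])
  then obtain q where q: "q \<in> pw 2" "q \<notin> J 3" using second_layer_not_cyclic[OF ideal_zero[OF pw_ideal]] by auto
  have qc: "q \<in> carrier R" using q pw_carr by blast
  obtain xs where xs: "length xs = d" "set xs \<subseteq> \<mm>" "indep (pw 2) xs" "adjl (pw 2) xs = \<mm>" by (rule mm_basis)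
  have "chain_len \<mm> (carrier R) (Suc 0)"
    by (rule chain_len_Cons[OF mm_ideal _ chain_len_refl[OF oneideal]]) (use mm_carr one_notin_mm in blast)
  then have "chain_len (pw 2) (carrier R) (length xs + Suc 0)"
    by (intro chain_len_indep[OF pw_ideal]) (use xs mm_carr in auto)
  moreover have "adj (J 3) q \<subset> pw 2"
    using adj_least[OF pw_ideal J3_sub q(1)] second_layer_not_cyclic[OF q(1)] by blast
  ultimately have "chain_len (adj (J 3) q) (carrier R) (Suc (d + 1))"
    using chain_len_Cons[OF adj_ideal[OF J_ideal qc]] xs(1) by simp
  moreover have "J 3 \<subset> adj (J 3) q" using adj_sub[OF J_ideal qc] adj_self[OF J_ideal qc] q(2) by blast
  ultimately show ?thesis using chain_len_Cons[OF J_ideal] by (simp add: eval_nat_numeral)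
qed

lemma len_bound:
  assumes "chain_len B (carrier R) k" "I \<subset> B"
  shows "k \<le> 5"
  using len6[OF chain_len_Cons[OF I_ideal assms(2,1)]] by simp

lemma d_le_3: "d \<le> 3" and J3_eq: "d = 3 \<Longrightarrow> J 3 = I"
proof -
  have "d + 3 \<le> 5" if "J 3 \<noteq> I" using len_bound[OF J3_chain] that I_sub_J[of 3] by blast
  moreover have "d + 3 \<le> 6" if "J 3 = I" using len6 J3_chain that by simp
  ultimately show "d \<le> 3" "d = 3 \<Longrightarrow> J 3 = I" by linarith+
qed

text \<open>If \<open>x\<close> generates the maximal ideal, then \<open>x\<^sup>2\<close> generates
  its square, and the second layer would be cyclic.\<close>

lemma d_ge_2: "2 \<le> d"
proof (rule ccontr)
  assume "\<not> 2 \<le> d"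
  then have d1: "d = 1" using d_pos by simp
  obtain xs where xs: "length xs = d" "set xs \<subseteq> \<mm>" "adjl (pw 2) xs = \<mm>" by (rule mm_basis)
  then obtain x where x: "xs = [x]" using d1 by (auto simp: length_Suc_conv)
  have xm: "x \<in> \<mm>" and xc: "x \<in> carrier R" using xs x mm_carr by auto
  have mm: "\<mm> \<subseteq> adj {\<zero>} x" using mm_span_mod[OF zeroideal, of "[]" x] xs x by simp
  have "pw 2 \<subseteq> adj {\<zero>} (x \<otimes> x)" unfolding pw_2
    by (rule ideal_prod_least[OF adj_ideal[OF zeroideal]]) (use mm adj_sum_mult[OF zeroideal xc xc] xc in auto)
  also have "\<dots> \<subseteq> adj (J 3) (x \<otimes> x)" by (rule adj_mono) (use ideal_zero[OF J_ideal] in simp)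
  finally show False using second_layer_not_cyclic[of "x \<otimes> x"] ideal_prod.prod[OF xm xm, of R] pw_2 by simp
qed

end

section \<open>Dimension two is impossible\<close>

context regular_local
begin

lemma span_swap:
  assumes "x \<in> \<mm>" "y \<in> \<mm>" "\<mm> \<subseteq> adjl (pw 2) [x, y]"
  shows "\<mm> \<subseteq> adjl (pw 2) [y, x]"
  using assms adj_commute[OF pw_ideal, of x y 2] mm_carr by simp

text \<open>Write \<open>q = j + e y\<close> with \<open>j\<close> in \<open>(x)\<close>. The prime
  \<open>Q\<close> contains \<open>e y\<close> but not \<open>y\<close>, hence it contains
  \<open>e\<close>. So \<open>Q\<close> lies in \<open>(x) + \<mm> Q\<close>, and Nakayama's lemma
  applies.\<close>

lemma prime_over_parameter:
  assumes x: "x \<in> \<mm>" and y: "y \<in> \<mm>" and span: "\<mm> \<subseteq> adjl (pw 2) [x, y]"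
    and Q: "primeideal Q R" "x \<in> Q" "Q \<subset> \<mm>"
  shows "y \<notin> Q" "Q = adj {\<zero>} x"
proof -
  note Qi = prime_ideal[OF Q(1)] and xc = mm_carr[OF x] and yc = mm_carr[OF y]
  note ax = adj_ideal[OF zeroideal xc] adj_self[OF zeroideal xc]
  have mm: "\<mm> \<subseteq> adj (adj {\<zero>} x) y"
    by (rule mm_span_mod[OF ax(1) _ y span_swap[OF x y span]]) (use ax in simp)
  have le: "adj {\<zero>} x \<subseteq> Q" by (rule adj_least[OF Qi _ Q(2)]) (use ideal_zero[OF Qi] in simp)
  show yQ: "y \<notin> Q" using mm adj_least[OF Qi le, of y] Q(3) by blast
  have "Q \<subseteq> adj {\<zero>} x"
  proof (rule nakayama[OF Qi ax(1)])
    fix L' assume L': "ideal L' R" "adj {\<zero>} x \<subseteq> L'" "\<And>w p. w \<in> Q \<Longrightarrow> p \<in> \<mm> \<Longrightarrow> p \<otimes> w \<in> L'"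
    show "Q \<subseteq> L'"
    proof
      fix q assume q: "q \<in> Q"
      then have "q \<in> adj (adj {\<zero>} x) y" using mm Q(3) by blast
      then obtain j e where j: "j \<in> adj {\<zero>} x" "e \<in> carrier R" "q = j \<oplus> e \<otimes> y" by (rule adjE)
      have jc: "j \<in> carrier R" using ideal_carr[OF ax(1) j(1)] .
      have "e \<otimes> y = q \<ominus> j" unfolding j(3) using jc j(2) yc by algebra
      then have "e \<otimes> y \<in> Q" using ideal_minus[OF Qi q] le j(1) by auto
      then have "e \<in> Q" using primeD[OF Q(1) j(2) yc] yQ by blast
      then have "y \<otimes> e \<in> L'" using L'(3) y by blast
      then show "q \<in> L'" unfolding j(3) using j(1,2) L'(1,2) yc m_comm[of y e] by (auto intro: ideal_add)
    qed
  qed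
  then show "Q = adj {\<zero>} x" using le by blast
qed

text \<open>The bottom prime \<open>P 0\<close> of a chain of length two does not contain
  \<open>x\<close>, since otherwise both lower primes would equal \<open>(x)\<close>. It lies in
  \<open>(x)\<close>, so its elements are \<open>x c\<close> with \<open>c\<close> again in
  \<open>P 0\<close>, and Nakayama's lemma makes it zero. Thus the ring is a domain and
  \<open>x\<close> a prime element.\<close>

lemma dim2_primes:
  assumes d2: "d = 2" and x: "x \<in> \<mm>" and y: "y \<in> \<mm>" and span: "\<mm> \<subseteq> adjl (pw 2) [x, y]"
  shows "primeideal {\<zero>} R" "primeideal (adj {\<zero>} x) R" "y \<notin> adj {\<zero>} x" "x \<noteq> \<zero>"
proof -
  obtain P where P: "is_prime_chain P 2" "P 2 = \<mm>" using dim_chain d2 by blast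
  have pr: "primeideal (P 0) R" "primeideal (P 1) R" and sub: "P 0 \<subset> P 1" "P 1 \<subset> \<mm>"
    using P unfolding is_prime_chain_def by (auto simp: numeral_2_eq_2)
  note P0i = prime_ideal[OF pr(1)]
  obtain Q where Q: "primeideal Q R" "P 0 \<subseteq> Q" "x \<in> Q" "Q \<subset> \<mm>"
    using height_theorem[OF P(1), of "[x]"] P(2) x by auto
  note par = prime_over_parameter[OF x y span]
  have Qx: "Q = adj {\<zero>} x" and yQ: "y \<notin> Q" using par[OF Q(1,3,4)] by auto
  have xP: "x \<notin> P 0"
  proof
    assume xP: "x \<in> P 0"
    have "P 0 \<subset> \<mm>" "x \<in> P 1" using sub xP by auto
    then have "P 0 = adj {\<zero>} x" "P 1 = adj {\<zero>} x" using par(2)[OF pr(1) xP] par(2)[OF pr(2)] sub by blast+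
    then show False using sub by blast
  qed
  have "P 0 \<subseteq> {\<zero>}"
  proof (rule nakayama[OF P0i zeroideal])
    fix L' assume L': "ideal L' R" "{\<zero>} \<subseteq> L'" "\<And>w p. w \<in> P 0 \<Longrightarrow> p \<in> \<mm> \<Longrightarrow> p \<otimes> w \<in> L'"
    show "P 0 \<subseteq> L'"
    proof
      fix p assume p: "p \<in> P 0"
      then obtain c where c: "c \<in> carrier R" "p = \<zero> \<oplus> c \<otimes> x" using Q(2) Qx by (blast elim: adjE)
      then have px: "p = x \<otimes> c" using mm_carr[OF x] m_comm by simp
      then have "c \<in> P 0" using primeD[OF pr(1) mm_carr[OF x] c(1)] p xP by auto
      then show "p \<in> L'" using L'(3) x px by simp
    qed
  qed
  then have "P 0 = {\<zero>}" using ideal_zero[OF P0i] by blast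
  then show "primeideal {\<zero>} R" "x \<noteq> \<zero>" using pr xP by auto
  show "primeideal (adj {\<zero>} x) R" "y \<notin> adj {\<zero>} x" using Q yQ Qx by auto
qed

text \<open>Every monomial of degree \<open>t + 1\<close> in \<open>x\<close> and \<open>y\<close>
  other than the pure power of \<open>y\<close> is divisible by \<open>x\<close>, with a cofactor of
  degree \<open>t\<close>.\<close>

lemma pw_decomp:
  assumes x: "x \<in> \<mm>" and y: "y \<in> \<mm>" and span: "\<mm> \<subseteq> adjl (pw 2) [x, y]"
    and w: "w \<in> pw (Suc t)"
  obtains h u where "h \<in> pw t" "u \<in> carrier R" "w = x \<otimes> h \<oplus> u \<otimes> y [^] Suc t"
proof -
  note xc = mm_carr[OF x] and yc = mm_carr[OF y]
  define V where "V t = {x \<otimes> h |h. h \<in> pw t}" for t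
  have Xid: "ideal (V t) R" for t
  proof (rule idealI')
    show "V t \<subseteq> carrier R" unfolding V_def using xc pw_carr by blast
    have "\<zero> = x \<otimes> \<zero>" using xc by simp
    then show "\<zero> \<in> V t" unfolding V_def using ideal_zero[OF pw_ideal[of t]] by blast
    fix a assume "a \<in> V t"
    then obtain h where h: "h \<in> pw t" "a = x \<otimes> h" unfolding V_def by blast
    { fix b assume "b \<in> V t"
      then obtain g where g: "g \<in> pw t" "b = x \<otimes> g" unfolding V_def by blast
      have "a \<oplus> b = x \<otimes> (h \<oplus> g)" using h g xc pw_carr by (simp add: r_distr)
      then show "a \<oplus> b \<in> V t" unfolding V_def using ideal_add[OF pw_ideal h(1) g(1)] by blast }
    { fix c assume c: "c \<in> carrier R"
      have "c \<otimes> a = x \<otimes> (c \<otimes> h)" unfolding h(2) using c xc pw_carr[OF h(1)] by algebra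
      then show "c \<otimes> a \<in> V t" unfolding V_def using ideal_mult[OF pw_ideal h(1) c] by blast }
  qed
  have mm: "\<mm> \<subseteq> adj (adj {\<zero>} x) y"
    by (rule mm_span_mod[OF adj_ideal[OF zeroideal xc] _ y span_swap[OF x y span]])
      (use adj_self[OF zeroideal xc] in simp)
  have "pw (Suc t) \<subseteq> adj (V t) (y [^] Suc t)" for t
  proof (induction t)
    case 0
    have "adj {\<zero>} x \<subseteq> V 0"
    proof
      fix a assume "a \<in> adj {\<zero>} x"
      then obtain c where c: "c \<in> carrier R" "a = \<zero> \<oplus> c \<otimes> x" by (blast elim: adjE)
      then have "a = x \<otimes> c" using xc m_comm by simp
      then show "a \<in> V 0" unfolding V_def using c(1) by auto
    qed
    then have "adj (adj {\<zero>} x) y \<subseteq> adj (V 0) (y [^] Suc 0)" using adj_mono[of _ _ y] yc by simp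
    then show ?case using mm pw_1 by auto
  next
    case (Suc t)
    show ?case
    proof (rule pw_Suc_least[OF adj_ideal[OF Xid]])
      fix a b assume a: "a \<in> \<mm>" and b: "b \<in> pw (Suc t)"
      obtain j e where j: "j \<in> adj {\<zero>} x" "e \<in> carrier R" "a = j \<oplus> e \<otimes> y" using a mm by (blast elim: adjE)
      then obtain f where f: "f \<in> carrier R" "j = \<zero> \<oplus> f \<otimes> x" by (blast elim: adjE)
      obtain h u where h: "h \<in> pw t" "u \<in> carrier R" "b = x \<otimes> h \<oplus> u \<otimes> y [^] Suc t"
        using Suc.IH b unfolding V_def by (blast elim: adjE)
      define Y where "Y = y [^] Suc t"
      have Yc: "Y \<in> carrier R" and hc: "h \<in> carrier R" and bc: "b \<in> carrier R"
        using yc Y_def pw_carr[OF h(1)] pw_carr[OF b] by simp_all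
      have 1: "y \<otimes> h \<in> pw (Suc t)" using pw_mm_mult[OF y h(1)] .
      have "a \<otimes> b = f \<otimes> x \<otimes> b \<oplus> e \<otimes> y \<otimes> b" unfolding j(3) f(2) using f(1) j(2) xc yc bc by algebra
      also have "e \<otimes> y \<otimes> b = e \<otimes> y \<otimes> (x \<otimes> h \<oplus> u \<otimes> Y)" unfolding h(3) Y_def ..
      also have "f \<otimes> x \<otimes> b \<oplus> e \<otimes> y \<otimes> (x \<otimes> h \<oplus> u \<otimes> Y) = x \<otimes> (f \<otimes> b \<oplus> e \<otimes> (y \<otimes> h)) \<oplus> (e \<otimes> u) \<otimes> (Y \<otimes> y)"
        using f(1) j(2) xc yc bc hc h(2) Yc by algebra
      also have "Y \<otimes> y = y [^] Suc (Suc t)" unfolding Y_def by simp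
      finally have *: "a \<otimes> b = x \<otimes> (f \<otimes> b \<oplus> e \<otimes> (y \<otimes> h)) \<oplus> (e \<otimes> u) \<otimes> y [^] Suc (Suc t)" .
      have "f \<otimes> b \<oplus> e \<otimes> (y \<otimes> h) \<in> pw (Suc t)"
        using ideal_add[OF pw_ideal ideal_mult[OF pw_ideal b f(1)] ideal_mult[OF pw_ideal 1 j(2)]] .
      then have "x \<otimes> (f \<otimes> b \<oplus> e \<otimes> (y \<otimes> h)) \<in> V (Suc t)" unfolding V_def by blast
      then show "a \<otimes> b \<in> adj (V (Suc t)) (y [^] Suc (Suc t))" unfolding * by (rule adjI) (use j h in simp)
    qed (use yc in simp)
  qed
  then obtain j u where "j \<in> V t" "u \<in> carrier R" "w = j \<oplus> u \<otimes> y [^] Suc t" using w by (blast elim: adjE)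
  then show ?thesis using that unfolding V_def by blast
qed

text \<open>In the decomposition \<open>x g = x h + u y^(t+1)\<close> the prime element
  \<open>x\<close> divides \<open>u\<close>, because it does not divide \<open>y\<close>; then
  \<open>x\<close> cancels in the domain. In other words, linear forms are nonzerodivisors on the
  associated graded ring.\<close>

lemma dim2_cancel:
  assumes d2: "d = 2" and x: "x \<in> \<mm>" "x \<notin> pw 2" and g: "g \<in> carrier R" "x \<otimes> g \<in> pw (Suc t)"
  shows "g \<in> pw t"
proof -
  obtain zs where zs: "set zs \<subseteq> \<mm>" "length [x] + length zs = d" "adjl (pw 2) ([x] @ zs) = \<mm>"
    by (rule basis_extend[of "[x]"]) (use x in auto)
  then obtain y where y: "zs = [y]" using d2 by (auto simp: length_Suc_conv)
  have ym: "y \<in> \<mm>" and span: "\<mm> \<subseteq> adjl (pw 2) [x, y]" using zs y by auto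
  note xc = mm_carr[OF x(1)] and yc = mm_carr[OF ym]
  note D = dim2_primes[OF d2 x(1) ym span]
  obtain h u where h: "h \<in> pw t" "u \<in> carrier R" "x \<otimes> g = x \<otimes> h \<oplus> u \<otimes> y [^] Suc t"
    by (rule pw_decomp[OF x(1) ym span g(2)])
  define Y where "Y = y [^] Suc t"
  have Yc: "Y \<in> carrier R" and hc: "h \<in> carrier R" using Y_def yc pw_carr h by auto
  have "u \<otimes> Y = x \<otimes> g \<ominus> x \<otimes> h" unfolding h(3) Y_def[symmetric] using xc hc Yc h(2) by algebra
  also have "\<dots> = \<zero> \<oplus> (g \<ominus> h) \<otimes> x" using xc hc g(1) by algebra
  also have "\<dots> \<in> adj {\<zero>} x" by (rule adjI) (use g hc in auto)
  finally have "u \<otimes> Y \<in> adj {\<zero>} x" .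
  then have "u \<in> adj {\<zero>} x" using primeD[OF D(2) h(2) Yc] prime_pow[OF D(2) yc] D(3) unfolding Y_def by blast
  then obtain v where v: "v \<in> carrier R" "u = \<zero> \<oplus> v \<otimes> x" by (blast elim: adjE)
  have "x \<otimes> (g \<ominus> (h \<oplus> v \<otimes> Y)) = x \<otimes> g \<ominus> (x \<otimes> h \<oplus> (\<zero> \<oplus> v \<otimes> x) \<otimes> Y)"
    using xc hc Yc g(1) v(1) by algebra
  also have "\<dots> = x \<otimes> g \<ominus> x \<otimes> g" unfolding h(3) v(2) Y_def ..
  also have "\<dots> = \<zero>" using xc g(1) by algebra
  finally have "x \<otimes> (g \<ominus> (h \<oplus> v \<otimes> Y)) \<in> {\<zero>}" by simp
  then have "g \<ominus> (h \<oplus> v \<otimes> Y) = \<zero>" using primeD[OF D(1) xc] D(4) g(1) hc Yc v(1) by auto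
  then have "g = h \<oplus> v \<otimes> Y" using g(1) hc Yc v(1) by simp
  moreover have "Y \<in> pw t" unfolding Y_def using pw_nat_pow[OF ym, of "Suc t"] pw_Suc_sub by blast
  ultimately show ?thesis using h(1) v(1) by (auto intro!: ideal_add[OF pw_ideal] intro: ideal_mult[OF pw_ideal])
qed

text \<open>Modulo \<open>\<mm>\<^sup>3\<close>, the hypothesis says that \<open>s x\<close> and \<open>s y\<close> are multiples of \<open>Q\<close> by linear forms. If
  the first of these involves \<open>y\<close>, then \<open>x\<close> divides \<open>Q\<close>, say \<open>Q = x M\<close>; this makes \<open>s\<close> a
  multiple of \<open>M\<close> as well, and cancelling \<open>M\<close> in the second relation gives a contradiction.\<close>

lemma dim2_quadric_relation:
  assumes d2: "d = 2" and s: "s \<in> pw 2" and Q: "Q \<in> pw 2"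
    and rel: "\<And>p. p \<in> \<mm> \<Longrightarrow> \<exists>l\<in>\<mm>. \<exists>w\<in>pw 4. p \<otimes> s = l \<otimes> Q \<oplus> w"
  shows "s \<in> adj (pw 3) Q"
proof (rule ccontr)
  assume no: "s \<notin> adj (pw 3) Q"
  obtain xs where xs: "length xs = d" "set xs \<subseteq> \<mm>" "indep (pw 2) xs" "adjl (pw 2) xs = \<mm>" by (rule mm_basis)
  then obtain x y where xy: "xs = [x, y]" using d2 by (auto simp: numeral_2_eq_2 length_Suc_conv)
  have x: "x \<in> \<mm>" "x \<notin> pw 2" and y: "y \<in> \<mm>" and span: "\<mm> \<subseteq> adjl (pw 2) [x, y]" using xs xy by auto
  note xc = mm_carr[OF x(1)] and yc = mm_carr[OF y] and sc = pw_carr[OF s] and Qc = pw_carr[OF Q]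
  note D = dim2_primes[OF d2 x(1) y span]
  note ax = adj_ideal[OF zeroideal xc]
  have mult_x: "x \<otimes> c \<in> adj {\<zero>} x" if "c \<in> carrier R" for c
    using adjI[of \<zero> "{\<zero>}" c x] that xc m_comm[of x c] by simp
  have mm: "\<exists>a\<in>carrier R. \<exists>b\<in>carrier R. l = a \<otimes> x \<oplus> b \<otimes> y" if l: "l \<in> \<mm>" for l
  proof -
    have "l \<in> adj (adj {\<zero>} x) y"
      using mm_span_mod[OF ax, of "[x]" y] span_swap[OF x(1) y span] y l adj_self[OF zeroideal xc] by auto
    then obtain j b where b: "j \<in> adj {\<zero>} x" "b \<in> carrier R" "l = j \<oplus> b \<otimes> y" by (rule adjE)
    obtain a where "a \<in> carrier R" "j = \<zero> \<oplus> a \<otimes> x" using b(1) by (blast elim: adjE)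
    then show ?thesis using b xc by auto
  qed
  obtain l1 w1 where 1: "l1 \<in> \<mm>" "w1 \<in> pw 4" "x \<otimes> s = l1 \<otimes> Q \<oplus> w1" using rel[OF x(1)] by blast
  obtain l2 w2 where 2: "l2 \<in> \<mm>" "w2 \<in> pw 4" "y \<otimes> s = l2 \<otimes> Q \<oplus> w2" using rel[OF y] by blast
  obtain a b where ab: "a \<in> carrier R" "b \<in> carrier R" "l1 = a \<otimes> x \<oplus> b \<otimes> y" using mm[OF 1(1)] by blast
  obtain c e where ce: "c \<in> carrier R" "e \<in> carrier R" "l2 = c \<otimes> x \<oplus> e \<otimes> y" using mm[OF 2(1)] by blast
  note wc = pw_carr[OF 1(2)] pw_carr[OF 2(2)]
  have in_adj: "a \<otimes> Q \<oplus> r \<in> adj (pw 3) Q" if "a \<in> carrier R" "r \<in> pw 3" for a r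
    using adjI[OF that(2,1), of Q] that Qc pw_carr a_comm by simp
  have s1: "x \<otimes> (s \<ominus> a \<otimes> Q) = b \<otimes> (y \<otimes> Q) \<oplus> w1"
  proof -
    have "x \<otimes> (s \<ominus> a \<otimes> Q) = x \<otimes> s \<ominus> a \<otimes> (x \<otimes> Q)" using xc sc ab(1) Qc by algebra
    also have "\<dots> = b \<otimes> (y \<otimes> Q) \<oplus> w1" unfolding 1(3) ab(3) using xc yc ab(1,2) Qc wc by algebra
    finally show ?thesis .
  qed
  have yQ: "y \<otimes> Q \<in> pw 3" using pw_mm_mult[OF y Q] by (simp add: eval_nat_numeral del: pw.simps)
  have s1c: "s \<ominus> a \<otimes> Q \<in> carrier R" using sc Qc ab by simp
  \<comment> \<open>If \<open>b\<close> were not a unit, the right side of \<open>s1\<close> would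
    have order four, and division by \<open>x\<close> would put \<open>s\<close> into
    \<open>\<mm>\<^sup>3 + (Q)\<close>.\<close>
  have bm: "b \<notin> \<mm>"
  proof
    assume "b \<in> \<mm>"
    then have "b \<otimes> (y \<otimes> Q) \<in> pw 4" using pw_mm_mult[OF _ yQ, of b] by (simp add: eval_nat_numeral del: pw.simps)
    then have "x \<otimes> (s \<ominus> a \<otimes> Q) \<in> pw (Suc 3)" unfolding s1 using 1(2) ideal_add[OF pw_ideal] by (simp del: pw.simps)
    then have "s \<ominus> a \<otimes> Q \<in> pw 3" by (rule dim2_cancel[OF d2 x s1c])
    from in_adj[OF ab(1) this] have "a \<otimes> Q \<oplus> (s \<ominus> a \<otimes> Q) \<in> adj (pw 3) Q" .
    moreover have "a \<otimes> Q \<oplus> (s \<ominus> a \<otimes> Q) = s" using sc Qc ab(1) by algebra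
    ultimately show False using no by simp
  qed
  \<comment> \<open>Modulo the prime \<open>(x)\<close> the element \<open>y\<close> is nonzero and
    \<open>b + g y\<close> is still a unit.\<close>
  have unit_contra: False if g: "g \<in> carrier R" and t: "b \<otimes> y [^] t \<oplus> g \<otimes> y [^] Suc t \<in> adj {\<zero>} x" for g and t :: nat
  proof -
    define Y where "Y = y [^] t"
    have Yc: "Y \<in> carrier R" unfolding Y_def using yc by simp
    have "(b \<oplus> g \<otimes> y) \<otimes> Y = b \<otimes> Y \<oplus> g \<otimes> (Y \<otimes> y)" using g ab(2) yc Yc by algebra
    then have "(b \<oplus> g \<otimes> y) \<otimes> Y \<in> adj {\<zero>} x" using t unfolding Y_def by simp
    then have "b \<oplus> g \<otimes> y \<in> adj {\<zero>} x"
      using primeD[OF D(2) _ Yc, of "b \<oplus> g \<otimes> y"] prime_pow[OF D(2) yc, of t] D(3) g ab(2) yc unfolding Y_def by blast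
    then have "b \<oplus> g \<otimes> y \<in> \<mm>" using adj_least[OF mm_ideal _ x(1), of "{\<zero>}"] ideal_zero[OF mm_ideal] by blast
    then show False using ideal_cancel[OF mm_ideal _ ideal_mult[OF mm_ideal y g] ab(2)] bm by blast
  qed
  obtain M f where M: "M \<in> pw (Suc 0)" "f \<in> carrier R" "Q = x \<otimes> M \<oplus> f \<otimes> y [^] Suc (Suc 0)"
    by (rule pw_decomp[OF x(1) y span, of Q "Suc 0"]) (use Q in \<open>simp add: numeral_2_eq_2 del: pw.simps\<close>)
  have Mm: "M \<in> \<mm>" and Mc: "M \<in> carrier R" using M(1) pw_1 mm_carr by auto
  have Q': "Q = x \<otimes> M \<oplus> f \<otimes> (y \<otimes> y)" using M(3) yc by simp
  obtain h g where hg: "h \<in> pw 3" "g \<in> carrier R" "w1 = x \<otimes> h \<oplus> g \<otimes> y [^] Suc 3"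
    by (rule pw_decomp[OF x(1) y span, of w1 3]) (use 1(2) in \<open>simp add: eval_nat_numeral del: pw.simps\<close>)
  have hc: "h \<in> carrier R" using hg pw_carr by blast
  have y4: "y [^] Suc 3 = y \<otimes> y \<otimes> y \<otimes> y" using yc by (simp add: eval_nat_numeral)
  \<comment> \<open>Reducing the first relation modulo \<open>x\<close> leaves
    \<open>(b f + g y) y\<^sup>3 = 0\<close>, so the coefficient \<open>f\<close> of
    \<open>y\<^sup>2\<close> in \<open>Q\<close> is not a unit, and \<open>Q\<close> equals
    \<open>x M\<close> up to order three.\<close>
  have fm: "f \<in> \<mm>"
  proof -
    have "b \<otimes> f \<otimes> (y \<otimes> y \<otimes> y) \<oplus> g \<otimes> y \<otimes> (y \<otimes> y \<otimes> y) = x \<otimes> (s \<ominus> a \<otimes> Q) \<ominus> x \<otimes> (b \<otimes> y \<otimes> M \<oplus> h)"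
      unfolding s1 unfolding hg(3) y4 unfolding Q' using ab(2) xc yc M(2) Mc hc hg(2) by algebra
    also have "\<dots> = x \<otimes> (s \<ominus> a \<otimes> Q \<ominus> (b \<otimes> y \<otimes> M \<oplus> h))" using xc sc ab yc Mc hc Qc by algebra
    also have "\<dots> \<in> adj {\<zero>} x" by (rule mult_x) (use sc ab yc Mc hc Qc in simp)
    finally have *: "b \<otimes> f \<otimes> (y \<otimes> y \<otimes> y) \<oplus> g \<otimes> y \<otimes> (y \<otimes> y \<otimes> y) \<in> adj {\<zero>} x" .
    have "(b \<otimes> f \<oplus> g \<otimes> y) \<otimes> (y \<otimes> y \<otimes> y) = b \<otimes> f \<otimes> (y \<otimes> y \<otimes> y) \<oplus> g \<otimes> y \<otimes> (y \<otimes> y \<otimes> y)"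
      using ab(2) M(2) hg(2) yc by algebra
    with * have "(b \<otimes> f \<oplus> g \<otimes> y) \<otimes> (y \<otimes> y \<otimes> y) \<in> adj {\<zero>} x" by simp
    then have "b \<otimes> f \<oplus> g \<otimes> y \<in> adj {\<zero>} x"
      using primeD[OF D(2)] D(3) ab(2) M(2) hg(2) yc by (metis a_closed m_closed)
    then have "b \<otimes> f \<oplus> g \<otimes> y \<in> \<mm>" using adj_least[OF mm_ideal _ x(1), of "{\<zero>}"] ideal_zero[OF mm_ideal] by blast
    then have "b \<otimes> f \<in> \<mm>" using ideal_cancel[OF mm_ideal _ ideal_mult[OF mm_ideal y hg(2)]] ab(2) M(2) by blast
    then show ?thesis using primeD[OF mm_prime ab(2) M(2)] bm by blast
  qed
  define m3 where "m3 = f \<otimes> (y \<otimes> y)"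
  have m3: "m3 \<in> pw 3"
    using pw_mm_mult[OF fm, of "y \<otimes> y" 2] ideal_prod.prod[OF y y, of R] pw_2 unfolding m3_def
    by (simp add: eval_nat_numeral del: pw.simps)
  have m3c: "m3 \<in> carrier R" using pw_carr[OF m3] .
  have Q'': "Q = x \<otimes> M \<oplus> m3" using Q' unfolding m3_def .
  \<comment> \<open>Dividing the first relation by \<open>x\<close> shows that \<open>s\<close> is
    \<open>a Q + b y M\<close> up to this remainder of order three.\<close>
  define r where "r = s \<ominus> a \<otimes> Q \<ominus> b \<otimes> (y \<otimes> M)"
  have rc: "r \<in> carrier R" unfolding r_def using sc ab Qc yc Mc by simp
  have r: "r \<in> pw 3"
  proof (rule dim2_cancel[OF d2 x rc])
    have "x \<otimes> r = x \<otimes> (s \<ominus> a \<otimes> Q) \<ominus> b \<otimes> (y \<otimes> (x \<otimes> M))" unfolding r_def using xc sc ab Qc yc Mc by algebra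
    also have "\<dots> = b \<otimes> (y \<otimes> m3) \<oplus> w1" unfolding s1 unfolding Q'' using xc ab yc Mc m3c wc by algebra
    also have "\<dots> \<in> pw 4"
      using pw_mm_mult[OF y m3] 1(2) ab(2) by (auto simp: eval_nat_numeral simp del: pw.simps intro!: ideal_add[OF pw_ideal] ideal_mult[OF pw_ideal])
    finally show "x \<otimes> r \<in> pw (Suc 3)" by (simp add: eval_nat_numeral del: pw.simps)
  qed
  have sr: "s = a \<otimes> Q \<oplus> (b \<otimes> (y \<otimes> M) \<oplus> r)" unfolding r_def using sc ab Qc yc Mc by algebra
  have M2: "M \<notin> pw 2"
  proof
    assume "M \<in> pw 2"
    then have "y \<otimes> M \<in> pw 3" using pw_mm_mult[OF y] by (simp add: eval_nat_numeral del: pw.simps)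
    then have "b \<otimes> (y \<otimes> M) \<oplus> r \<in> pw 3" using ideal_add[OF pw_ideal ideal_mult[OF pw_ideal _ ab(2)] r] by blast
    then show False using in_adj[OF ab(1)] no sr by simp
  qed
  \<comment> \<open>Substituting \<open>x M\<close> for \<open>Q\<close> and
    \<open>a Q + b y M\<close> for \<open>s\<close> turns \<open>y s - l2 Q\<close> into
    \<open>M z\<close> up to order four. The coefficient of \<open>y\<^sup>2\<close> in
    \<open>z\<close> is the unit \<open>b\<close>, which survives modulo \<open>x\<close>.\<close>
  define z where "z = b \<otimes> (y \<otimes> y) \<oplus> x \<otimes> (a \<otimes> y \<ominus> c \<otimes> x \<ominus> e \<otimes> y)"
  have zc: "z \<in> carrier R" unfolding z_def using ab ce xc yc by simp
  have "M \<otimes> z = y \<otimes> (a \<otimes> (x \<otimes> M \<oplus> m3) \<oplus> (b \<otimes> (y \<otimes> M) \<oplus> r)) \<ominus> (c \<otimes> x \<oplus> e \<otimes> y) \<otimes> (x \<otimes> M \<oplus> m3)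
      \<ominus> (a \<otimes> (y \<otimes> m3) \<oplus> y \<otimes> r \<ominus> (c \<otimes> x \<oplus> e \<otimes> y) \<otimes> m3)"
    unfolding z_def using ab(1,2) ce(1,2) xc yc Mc m3c rc by algebra
  also have "\<dots> = y \<otimes> s \<ominus> l2 \<otimes> Q \<ominus> (a \<otimes> (y \<otimes> m3) \<oplus> y \<otimes> r \<ominus> l2 \<otimes> m3)"
    unfolding ce(3)[symmetric] Q''[symmetric] sr[symmetric] ..
  also have "y \<otimes> s \<ominus> l2 \<otimes> Q = w2" unfolding 2(3) using mm_carr[OF 2(1)] Qc wc(2) by algebra
  also have "w2 \<ominus> (a \<otimes> (y \<otimes> m3) \<oplus> y \<otimes> r \<ominus> l2 \<otimes> m3) \<in> pw 4"
  proof -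
    have 3: "y \<otimes> m3 \<in> pw 4" "y \<otimes> r \<in> pw 4" "l2 \<otimes> m3 \<in> pw 4"
      using pw_mm_mult[OF y m3] pw_mm_mult[OF y r] pw_mm_mult[OF 2(1) m3] by (simp_all add: eval_nat_numeral del: pw.simps)
    show ?thesis using ideal_minus[OF pw_ideal 2(2) ideal_minus[OF pw_ideal ideal_add[OF pw_ideal ideal_mult[OF pw_ideal 3(1) ab(1)] 3(2)] 3(3)]] .
  qed
  finally have "M \<otimes> z \<in> pw (Suc 3)" by (simp add: eval_nat_numeral del: pw.simps)
  then have "z \<in> pw 3" by (rule dim2_cancel[OF d2 Mm M2 zc])
  then have "z \<in> pw (Suc 2)" by (simp add: eval_nat_numeral del: pw.simps)
  then obtain h' g' where hg': "h' \<in> pw 2" "g' \<in> carrier R" "z = x \<otimes> h' \<oplus> g' \<otimes> y [^] Suc 2"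
    by (rule pw_decomp[OF x(1) y span])
  have hc': "h' \<in> carrier R" using hg' pw_carr by blast
  have y3: "y [^] Suc 2 = y \<otimes> y \<otimes> y" using yc by (simp add: eval_nat_numeral)
  have "b \<otimes> (y \<otimes> y) \<oplus> (\<ominus> g') \<otimes> (y \<otimes> y \<otimes> y) = z \<ominus> g' \<otimes> (y \<otimes> y \<otimes> y) \<ominus> x \<otimes> (a \<otimes> y \<ominus> c \<otimes> x \<ominus> e \<otimes> y)"
    unfolding z_def using ab ce(1,2) xc yc hg'(2) by algebra
  also have "\<dots> = x \<otimes> (h' \<ominus> (a \<otimes> y \<ominus> c \<otimes> x \<ominus> e \<otimes> y))"
    unfolding hg'(3) y3 using ab(1,2) ce(1,2) xc yc hg'(2) hc' by algebra
  also have "\<dots> \<in> adj {\<zero>} x" by (rule mult_x) (use hc' ab ce xc yc in simp)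
  finally have "b \<otimes> (y \<otimes> y) \<oplus> (\<ominus> g') \<otimes> (y \<otimes> y \<otimes> y) \<in> adj {\<zero>} x" .
  then show False using unit_contra[of "\<ominus> g'" 2] hg'(2) yc by (simp add: eval_nat_numeral)
qed

end

context non_burch_quotient
begin

lemma d_not_2: "d \<noteq> 2"
proof
  assume d2: "d = 2"
  have chain: "chain_len (J 3) (carrier R) 5" using J3_chain d2 by simp
  \<comment> \<open>The quotient by \<open>J 3\<close> already has length at least five, so
    \<open>J 3\<close> exceeds \<open>I\<close> by at most one simple layer.\<close>
  have between: "K = J 3" if K: "ideal K R" "I \<subset> K" "K \<subseteq> J 3" for K
  proof (rule ccontr)
    assume "K \<noteq> J 3"
    then have "K \<subset> J 3" using K(3) by blast
    from len_bound[OF chain_len_Cons[OF K(1) this chain] K(2)] show False by simp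
  qed
  have J4: "J 4 = I"
  proof (rule ccontr)
    assume "J 4 \<noteq> I"
    then have "J 4 = J 3" using between[OF J_ideal] I_sub_J[of 4] J_anti[of 3 4] by auto
    then have "pw 3 \<subseteq> J (Suc 3)" using pw_sub_J[of 3] by (simp add: eval_nat_numeral del: pw.simps)
    then have "pw 3 \<subseteq> I" by (rule pw_sub_I_nakayama)
    then show False using J_eq_I[of 3] \<open>J 4 = J 3\<close> \<open>J 4 \<noteq> I\<close> by simp
  qed
  \<comment> \<open>If \<open>J 3\<close> is \<open>I\<close> plus one socle class \<open>t\<close>,
    that class does not span the socle, so a further socle element lies outside
    \<open>J 3\<close>.\<close>
  obtain s where s: "s \<in> soc" "s \<notin> J 3"
  proof (cases "J 3 = I")
    case True
    have "adj (J 3) \<zero> = J 3" by (rule adj_absorb[OF J_ideal ideal_zero[OF J_ideal]])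
    then obtain s where s: "s \<in> pw 2" "s \<notin> J 3" using second_layer_not_cyclic[OF ideal_zero[OF pw_ideal]] by auto
    have "p \<otimes> s \<in> I" if "p \<in> \<mm>" for p
      using pw_mm_mult[OF that s(1)] pw_sub_J[of 3] True by (auto simp: eval_nat_numeral simp del: pw.simps)
    then show ?thesis using that[of s] s soc_iff pw_carr by blast
  next
    case False
    then obtain t where t: "t \<in> J 3" "t \<notin> I" using I_sub_J[of 3] by blast
    have tc: "t \<in> carrier R" using ideal_carr[OF J_ideal t(1)] .
    have "I \<subset> adj I t" using adj_sub[OF I_ideal tc] adj_self[OF I_ideal tc] t(2) by blast
    then have "adj I t = J 3" using between[OF adj_ideal[OF I_ideal tc]] adj_least[OF J_ideal I_sub_J t(1)] by simp
    moreover have "t \<in> soc" using J_mult_mm[OF _ t(1)] J4 tc unfolding soc_iff by (auto simp: eval_nat_numeral)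
    ultimately show ?thesis using not_gorenstein[OF _ t(2)] that by blast
  qed
  have s2: "s \<in> pw 2" using s soc_sub by blast
  \<comment> \<open>Quadrics in two parameters are spanned by three products, so two independent
    ones in \<open>I\<close> would leave a cyclic second layer. If \<open>I\<close> lies in
    \<open>\<mm>\<^sup>3\<close>, then \<open>Q\<close> is zero.\<close>
  obtain Q where Q: "Q \<in> I" "I \<subseteq> adj (pw 3) Q"
  proof (cases "I \<subseteq> pw 3")
    case True
    then show ?thesis using that[of \<zero>] ideal_zero[OF I_ideal] adj_sub[OF pw_ideal[of 3] zero_closed] by blast
  next
    case False
    then obtain Q where Q: "Q \<in> I" "Q \<notin> pw 3" by blast
    have "I \<subseteq> adj (pw 3) Q"
    proof
      fix Q' assume Q': "Q' \<in> I"
      show "Q' \<in> adj (pw 3) Q"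
      proof (rule ccontr)
        assume nQ': "Q' \<notin> adj (pw 3) Q"
        obtain xs where xs: "length xs = d" "set xs \<subseteq> \<mm>" "indep (pw 2) xs" "adjl (pw 2) xs = \<mm>" by (rule mm_basis)
        then obtain x y where xy: "xs = [x, y]" using d2 by (auto simp: numeral_2_eq_2 length_Suc_conv)
        have x: "x \<in> \<mm>" and y: "y \<in> \<mm>" and span: "\<mm> \<subseteq> adjl (pw 2) [x, y]" using xs xy by auto
        note xc = mm_carr[OF x] and yc = mm_carr[OF y]
        define fs where "fs = [x \<otimes> x, x \<otimes> y, y \<otimes> y]"
        have fs2: "set fs \<subseteq> pw 2" unfolding fs_def pw_2 using ideal_prod.prod[of _ \<mm> _ \<mm> R] x y by auto
        have fsc: "set fs \<subseteq> carrier R" using fs2 pw_carr by blast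
        note A = adjl_ideal[OF pw_ideal[of 3] fsc] adjl_gens[OF pw_ideal[of 3] fsc]
        have span2: "pw 2 \<subseteq> adjl (pw 3) fs"
        proof
          fix w assume "w \<in> pw 2"
          then have "w \<in> pw (Suc (Suc 0))" by (simp add: numeral_2_eq_2 del: pw.simps)
          then obtain h u where h: "h \<in> pw (Suc 0)" "u \<in> carrier R" "w = x \<otimes> h \<oplus> u \<otimes> y [^] Suc (Suc 0)"
            by (rule pw_decomp[OF x y span])
          obtain h' u' where h': "h' \<in> pw 0" "u' \<in> carrier R" "h = x \<otimes> h' \<oplus> u' \<otimes> y [^] Suc 0"
            by (rule pw_decomp[OF x y span h(1)])
          have "w = h' \<otimes> (x \<otimes> x) \<oplus> u' \<otimes> (x \<otimes> y) \<oplus> u \<otimes> (y \<otimes> y)"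
          proof -
            have hc: "h' \<in> carrier R" using h' by simp
            have y1: "y [^] Suc 0 = y" "y [^] Suc (Suc 0) = y \<otimes> y" using yc by simp_all
            show ?thesis unfolding h(3) h'(3) y1 using hc h'(2) h(2) xc yc by algebra
          qed
          also have "\<dots> \<in> adjl (pw 3) fs"
            using ideal_mult[OF A(1) _ _] A(2) h'(1,2) h(2) unfolding fs_def[THEN arg_cong[where f=set]]
            by (auto intro!: ideal_add[OF A(1)])
          finally show "w \<in> adjl (pw 3) fs" .
        qed
        have "\<exists>fs'. length fs = length [Q, Q'] + length fs' \<and> set fs' \<subseteq> set fs \<and>
          adjl (pw 3) fs \<subseteq> adjl (adjl (pw 3) [Q, Q']) fs'"
        proof (rule exchange_list[OF pw_ideal fsc])
          show "p \<otimes> f \<in> pw 3" if "f \<in> set fs" "p \<in> \<mm>" for f p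
            using pw_mm_mult[of p f 2] that fs2 by (auto simp: eval_nat_numeral simp del: pw.simps)
          show "indep (pw 3) [Q, Q']" using Q nQ' by simp
          show "set [Q, Q'] \<subseteq> adjl (pw 3) fs" using span2 I_sub Q Q' by auto
        qed
        then obtain fs' where fs': "length fs' = 1" "set fs' \<subseteq> set fs" "pw 2 \<subseteq> adjl (adjl (pw 3) [Q, Q']) fs'"
          using span2 unfolding fs_def by auto
        then obtain q where q: "fs' = [q]" by (auto simp: length_Suc_conv)
        have "adjl (pw 3) [Q, Q'] \<subseteq> J 3" by (rule adjl_least[OF J_ideal pw_sub_J]) (use Q Q' I_sub_J in auto)
        then have "pw 2 \<subseteq> adj (J 3) q" using fs'(3) q adjl_mono[of _ "J 3" fs'] by auto
        moreover have "q \<in> pw 2" using fs' q fs2 by auto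
        ultimately show False using second_layer_not_cyclic by blast
      qed
    qed
    then show ?thesis using that Q by blast
  qed
  have Q2: "Q \<in> pw 2" using Q I_sub by blast
  note Qc = pw_carr[OF Q2]
  have "s \<in> adj (pw 3) Q"
  proof (rule dim2_quadric_relation[OF d2 s2 Q2])
    fix p assume p: "p \<in> \<mm>"
    \<comment> \<open>Up to order four, elements of \<open>\<mm> I\<close> are multiples of
      \<open>Q\<close> by elements of \<open>\<mm>\<close>; since \<open>I\<close> is not Burch,
      \<open>p s\<close> is among them.\<close>
    have closed: "\<exists>l\<in>\<mm>. \<exists>w\<in>pw 4. z = l \<otimes> Q \<oplus> w" if "z \<in> ideal_prod R \<mm> I" for z
      using that
    proof induction
      case (prod i j)
      obtain v c where v: "v \<in> pw 3" "c \<in> carrier R" "j = v \<oplus> c \<otimes> Q" using prod(2) Q(2) by (blast elim: adjE)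
      have "i \<otimes> j = (i \<otimes> c) \<otimes> Q \<oplus> i \<otimes> v"
        unfolding v(3) using mm_carr[OF prod(1)] v(2) pw_carr[OF v(1)] Qc by algebra
      moreover have "i \<otimes> v \<in> pw 4" using pw_mm_mult[OF prod(1) v(1)] by (simp add: eval_nat_numeral del: pw.simps)
      ultimately show ?case using ideal_multr[OF mm_ideal prod(1) v(2)] by blast
    next
      case (sum s1 s2)
      then obtain l1 w1 l2 w2 where 1: "l1 \<in> \<mm>" "w1 \<in> pw 4" "s1 = l1 \<otimes> Q \<oplus> w1"
        and 2: "l2 \<in> \<mm>" "w2 \<in> pw 4" "s2 = l2 \<otimes> Q \<oplus> w2" by blast
      have "s1 \<oplus> s2 = (l1 \<oplus> l2) \<otimes> Q \<oplus> (w1 \<oplus> w2)"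
        unfolding 1(3) 2(3) using 1(1,2) mm_carr[OF 1(1)] mm_carr[OF 2(1)] pw_carr[OF 1(2)] pw_carr[OF 2(2)] Qc by algebra
      then show ?case using ideal_add[OF mm_ideal 1(1) 2(1)] ideal_add[OF pw_ideal 1(2) 2(2)] by blast
    qed
    then show "\<exists>l\<in>\<mm>. \<exists>w\<in>pw 4. p \<otimes> s = l \<otimes> Q \<oplus> w" using soc_mult[OF s(1) p] by blast
  qed
  also have "adj (pw 3) Q \<subseteq> J 3" by (rule adj_least[OF J_ideal pw_sub_J]) (use Q I_sub_J in blast)
  finally show False using s by blast
qed

lemma d_eq_3: "d = 3"
  using d_le_3 d_ge_2 d_not_2 by simp

end

section \<open>Dimension three: numerical invariants\<close>

context noetherian_local_ring
begin

lemma steinitz: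
  assumes "ideal J R" "set fs \<subseteq> carrier R" "\<And>f p. f \<in> set fs \<Longrightarrow> p \<in> \<mm> \<Longrightarrow> p \<otimes> f \<in> J"
    "indep J as" "set as \<subseteq> adjl J fs"
  shows "length as \<le> length fs"
  using exchange_list[OF assms] by auto

lemma colon_mem: "b \<in> ideal_colon R K {g} \<longleftrightarrow> b \<in> carrier R \<and> b \<otimes> g \<in> K"
  by (auto simp: ideal_colon_def)

text \<open>The elements carrying \<open>u\<close> into \<open>K\<close> form an ideal that contains
  \<open>\<mm>\<^sup>2\<close>, since \<open>K\<close> contains \<open>\<mm>\<^sup>3\<close>; so
  generators modulo \<open>\<mm>\<^sup>2\<close> decide.\<close>

lemma mult_span_left:
  assumes K: "ideal K R" "pw 3 \<subseteq> K" and xs: "set xs \<subseteq> \<mm>" "\<mm> \<subseteq> adjl (pw 2) xs"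
    and u: "u \<in> \<mm>" "\<And>h. h \<in> set xs \<Longrightarrow> h \<otimes> u \<in> K" and b: "b \<in> \<mm>"
  shows "b \<otimes> u \<in> K"
proof -
  have C: "ideal (ideal_colon R K {u}) R" by (rule colon_ideal[OF K(1)]) (use u mm_carr in auto)
  have "pw 2 \<subseteq> ideal_colon R K {u}"
  proof
    fix w assume w: "w \<in> pw 2"
    have "u \<otimes> w \<in> pw 3" using pw_mm_mult[OF u(1) w] by (simp add: eval_nat_numeral del: pw.simps)
    then show "w \<in> ideal_colon R K {u}" unfolding colon_mem
      using K(2) pw_carr[OF w] m_comm[OF pw_carr[OF w] mm_carr[OF u(1)]] by auto
  qed
  moreover have "set xs \<subseteq> ideal_colon R K {u}" using u(2) xs(1) mm_carr unfolding subset_iff colon_mem by blast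
  ultimately have "adjl (pw 2) xs \<subseteq> ideal_colon R K {u}" by (rule adjl_least[OF C])
  then show ?thesis using xs(2) b colon_mem by blast
qed

lemma mult_span:
  assumes K: "ideal K R" "pw 3 \<subseteq> K" and xs: "set xs \<subseteq> \<mm>" "\<mm> \<subseteq> adjl (pw 2) xs"
    and prods: "\<And>g h. g \<in> set xs \<Longrightarrow> h \<in> set xs \<Longrightarrow> g \<otimes> h \<in> K"
  shows "pw 2 \<subseteq> K"
  unfolding pw_2
proof (rule ideal_prod_least[OF K(1)])
  fix a b assume a: "a \<in> \<mm>" and b: "b \<in> \<mm>"
  have "b \<otimes> h \<in> K" if "h \<in> set xs" for h
    by (rule mult_span_left[OF K xs _ _ b]) (use that xs prods in auto)
  then have "h \<otimes> b \<in> K" if "h \<in> set xs" for h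
    using that m_comm[OF mm_carr[OF b] mm_carr[of h]] xs(1) by (metis subsetD)
  then show "a \<otimes> b \<in> K" by (rule mult_span_left[OF K xs b _ a])
qed

lemma span_trans:
  assumes "\<mm> \<subseteq> adjl (pw 2) xs" "set ys \<subseteq> \<mm>" "set xs \<subseteq> adjl (pw 2) ys"
  shows "\<mm> \<subseteq> adjl (pw 2) ys"
proof -
  have ys: "set ys \<subseteq> carrier R" using assms mm_carr by blast
  show ?thesis
    using adjl_least[OF adjl_ideal[OF pw_ideal ys] adjl_sub[OF pw_ideal ys] assms(3)] assms(1) by blast
qed

end

section \<open>Quadrics in three parameters\<close>

context regular_local
begin

text \<open>Modulo a prime over \<open>y\<close> and \<open>z\<close> the element \<open>x\<close>
  is a uniformizer, and \<open>x\<^sup>2\<close> is not a multiple of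
  \<open>x\<^sup>3\<close>.\<close>

lemma square_notin:
  assumes d: "d = 3" and m: "x \<in> \<mm>" "y \<in> \<mm>" "z \<in> \<mm>" and span: "\<mm> \<subseteq> adjl (pw 2) [x, y, z]"
  shows "x \<otimes> x \<notin> adjl (pw 3) [y, z]"
proof
  assume a: "x \<otimes> x \<in> adjl (pw 3) [y, z]"
  obtain Q where Q: "primeideal Q R" "set [y, z] \<subseteq> Q" "\<And>t. pw t \<subseteq> adj Q (x [^] t)"
      "\<And>t c. c \<in> carrier R \<Longrightarrow> c \<otimes> x [^] (t::nat) \<in> adj Q (x [^] Suc t) \<Longrightarrow> c \<in> \<mm>"
    by (rule regular_parameter[of x "[y, z]"]) (use m d span in auto)
  note xc = mm_carr[OF m(1)]
  have x3: "x [^] (3::nat) \<in> carrier R" using xc by simp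
  note Qi = prime_ideal[OF Q(1)]
  have "adjl (pw 3) [y, z] \<subseteq> adj Q (x [^] (3::nat))"
    by (rule adjl_least[OF adj_ideal[OF Qi x3] Q(3)]) (use Q(2) adj_sub[OF Qi x3] in blast)
  then have "\<one> \<otimes> x [^] (2::nat) \<in> adj Q (x [^] Suc 2)" using a xc by (auto simp: eval_nat_numeral)
  then show False using Q(4)[of \<one> 2] one_notin_mm by simp
qed

text \<open>Setting \<open>x\<close> equal to \<open>y\<close> turns the mixed product into a
  square: \<open>y\<close>, \<open>x - y\<close> and \<open>z\<close> are again parameters, and
  modulo \<open>x - y\<close> the product \<open>x y\<close> becomes
  \<open>y\<^sup>2\<close>.\<close>

lemma product_notin:
  assumes d: "d = 3" and m: "x \<in> \<mm>" "y \<in> \<mm>" "z \<in> \<mm>" and span: "\<mm> \<subseteq> adjl (pw 2) [x, y, z]"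
  shows "x \<otimes> y \<notin> adjl (pw 3) [z]"
proof
  assume a: "x \<otimes> y \<in> adjl (pw 3) [z]"
  note c = mm_carr[OF m(1)] mm_carr[OF m(2)] mm_carr[OF m(3)]
  have xy: "x \<ominus> y \<in> \<mm>" using ideal_minus[OF mm_ideal m(1,2)] .
  have xyc: "x \<ominus> y \<in> carrier R" using c by simp
  let ?ys = "[y, x \<ominus> y, z]"
  have ysc: "set ?ys \<subseteq> carrier R" using c by simp
  note Y = adjl_ideal[OF pw_ideal[of 2] ysc] adjl_gens[OF pw_ideal[of 2] ysc]
  have "x = (x \<ominus> y) \<oplus> y" using c by algebra
  moreover have "(x \<ominus> y) \<oplus> y \<in> adjl (pw 2) ?ys" by (rule ideal_add[OF Y(1)]) (use Y(2) in auto)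
  ultimately have "\<mm> \<subseteq> adjl (pw 2) ?ys"
    by (intro span_trans[OF span]) (use m xy Y(2) in auto)
  then have n: "y \<otimes> y \<notin> adjl (pw 3) [x \<ominus> y, z]" by (rule square_notin[OF d m(2) xy m(3)])
  have zc: "set [x \<ominus> y, z] \<subseteq> carrier R" using c by simp
  note Z = adjl_ideal[OF pw_ideal[of 3] zc] adjl_gens[OF pw_ideal[of 3] zc] adjl_sub[OF pw_ideal[of 3] zc]
  have "adjl (pw 3) [z] \<subseteq> adjl (pw 3) [x \<ominus> y, z]" by (rule adjl_least[OF Z(1) Z(3)]) (use Z(2) in auto)
  then have "x \<otimes> y \<in> adjl (pw 3) [x \<ominus> y, z]" using a by blast
  moreover have "y \<otimes> (x \<ominus> y) \<in> adjl (pw 3) [x \<ominus> y, z]" by (rule ideal_mult[OF Z(1) _ c(2)]) (use Z(2) in auto)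
  ultimately have "x \<otimes> y \<ominus> y \<otimes> (x \<ominus> y) \<in> adjl (pw 3) [x \<ominus> y, z]" by (rule ideal_minus[OF Z(1)])
  moreover have "x \<otimes> y \<ominus> y \<otimes> (x \<ominus> y) = y \<otimes> y" using c by algebra
  ultimately show False using n by simp
qed

lemma dim3_quadrics_basis:
  assumes d: "d = 3"
  obtains fs where "length fs = 6" "set fs \<subseteq> pw 2" "indep (pw 3) fs" "pw 2 \<subseteq> adjl (pw 3) fs"
proof -
  obtain xs where xs: "length xs = d" "set xs \<subseteq> \<mm>" "indep (pw 2) xs" "adjl (pw 2) xs = \<mm>" by (rule mm_basis)
  then obtain x y z where xyz: "xs = [x, y, z]" using d by (auto simp: numeral_3_eq_3 length_Suc_conv)
  have m: "x \<in> \<mm>" "y \<in> \<mm>" "z \<in> \<mm>" and span: "\<mm> \<subseteq> adjl (pw 2) [x, y, z]" using xs xyz by auto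
  note c = mm_carr[OF m(1)] mm_carr[OF m(2)] mm_carr[OF m(3)]
  have perm: "\<mm> \<subseteq> adjl (pw 2) ys" if "set ys = {x, y, z}" for ys
  proof (rule span_trans[OF span])
    show "set ys \<subseteq> \<mm>" using that m by auto
    have "set ys \<subseteq> carrier R" using that c by auto
    from adjl_gens[OF pw_ideal this] show "set [x, y, z] \<subseteq> adjl (pw 2) ys" using that by auto
  qed
  have sub: "adjl (pw 3) gs \<subseteq> adjl (pw 3) hs"
    if hs: "set hs \<subseteq> {x, y, z}" and gs: "\<And>g. g \<in> set gs \<Longrightarrow> \<exists>h\<in>set hs. \<exists>a\<in>carrier R. g = a \<otimes> h" for gs hs
  proof -
    have hc: "set hs \<subseteq> carrier R" using hs c by auto
    note H = adjl_ideal[OF pw_ideal[of 3] hc] adjl_gens[OF pw_ideal[of 3] hc] adjl_sub[OF pw_ideal[of 3] hc]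
    have "set gs \<subseteq> adjl (pw 3) hs"
    proof
      fix g assume "g \<in> set gs"
      then obtain h a where "h \<in> set hs" "a \<in> carrier R" "g = a \<otimes> h" using gs by blast
      then show "g \<in> adjl (pw 3) hs" using ideal_mult[OF H(1)] H(2) by blast
    qed
    then show ?thesis by (rule adjl_least[OF H(1,3)])
  qed
  \<comment> \<open>Mixed products precede squares, so that each entry is separated from all earlier
    ones by setting suitable parameters to zero.\<close>
  define fs where "fs = [z \<otimes> y, z \<otimes> x, x \<otimes> y, x \<otimes> x, y \<otimes> y, z \<otimes> z]"
  have fs2: "set fs \<subseteq> pw 2" unfolding fs_def pw_2 using ideal_prod.prod[of _ \<mm> _ \<mm> R] m by auto
  have fsc: "set fs \<subseteq> carrier R" using fs2 pw_carr by blast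
  note A = adjl_ideal[OF pw_ideal[of 3] fsc] adjl_gens[OF pw_ideal[of 3] fsc] adjl_sub[OF pw_ideal[of 3] fsc]
  have "pw 2 \<subseteq> adjl (pw 3) fs"
  proof (rule mult_span[OF A(1,3) _ span])
    have C: "y \<otimes> z = z \<otimes> y" "x \<otimes> z = z \<otimes> x" "y \<otimes> x = x \<otimes> y" using c m_comm by auto
    show "g \<otimes> h \<in> adjl (pw 3) fs" if "g \<in> set [x, y, z]" "h \<in> set [x, y, z]" for g h
      using A(2) that C unfolding fs_def by auto
  qed (use m in auto)
  moreover have "indep (pw 3) fs"
  proof -
    have 1: "z \<otimes> y \<notin> adjl (pw 3) []"
      using product_notin[OF d m(3,2,1) perm] sub[of "[x]" "[]"] by auto
    have 2: "z \<otimes> x \<notin> adjl (pw 3) [z \<otimes> y]"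
      using product_notin[OF d m(3,1,2) perm] sub[of "[y]" "[z \<otimes> y]"] c by auto
    have "z \<otimes> y = y \<otimes> z" "z \<otimes> x = x \<otimes> z" "x \<otimes> y = y \<otimes> x" using c m_comm by auto
    note cm = this
    have 3: "x \<otimes> y \<notin> adjl (pw 3) [z \<otimes> y, z \<otimes> x]"
    proof -
      have "adjl (pw 3) [z \<otimes> y, z \<otimes> x] \<subseteq> adjl (pw 3) [z]" by (rule sub) (use c cm in auto)
      then show ?thesis using product_notin[OF d m(1,2,3) span] by blast
    qed
    have 4: "x \<otimes> x \<notin> adjl (pw 3) [z \<otimes> y, z \<otimes> x, x \<otimes> y]"
    proof -
      have "adjl (pw 3) [z \<otimes> y, z \<otimes> x, x \<otimes> y] \<subseteq> adjl (pw 3) [y, z]" by (rule sub) (use c cm(2) in auto)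
      then show ?thesis using square_notin[OF d m(1,2,3) span] by blast
    qed
    have 5: "y \<otimes> y \<notin> adjl (pw 3) [z \<otimes> y, z \<otimes> x, x \<otimes> y, x \<otimes> x]"
    proof -
      have "adjl (pw 3) [z \<otimes> y, z \<otimes> x, x \<otimes> y, x \<otimes> x] \<subseteq> adjl (pw 3) [x, z]" by (rule sub) (use c cm(1,3) in auto)
      then show ?thesis using square_notin[OF d m(2,1,3) perm] by auto
    qed
    have 6: "z \<otimes> z \<notin> adjl (pw 3) [z \<otimes> y, z \<otimes> x, x \<otimes> y, x \<otimes> x, y \<otimes> y]"
    proof -
      have "adjl (pw 3) [z \<otimes> y, z \<otimes> x, x \<otimes> y, x \<otimes> x, y \<otimes> y] \<subseteq> adjl (pw 3) [x, y]" by (rule sub) (use c in auto)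
      then show ?thesis using square_notin[OF d m(3,1,2) perm] by auto
    qed
    show ?thesis unfolding fs_def using 1 2 3 4 5 6 by simp
  qed
  ultimately show ?thesis using that[of fs] fs2 unfolding fs_def by simp
qed

end

section \<open>Type and number of generators\<close>

context non_burch_quotient
begin

lemma pw3_sub_I: "pw 3 \<subseteq> I"
  using J3_eq[OF d_eq_3] pw_sub_J[of 3] by simp

lemma pw2_not_sub_I: "\<not> pw 2 \<subseteq> I"
  using second_layer_not_cyclic[OF ideal_zero[OF pw_ideal]] J3_eq[OF d_eq_3]
    adj_absorb[OF I_ideal ideal_zero[OF I_ideal]] by simp

lemma soc_eq: "soc = pw 2"
proof
  have "p \<otimes> s \<in> I" if "s \<in> pw 2" "p \<in> \<mm>" for s p
    using pw_mm_mult[OF that(2,1)] pw3_sub_I by (auto simp: eval_nat_numeral simp del: pw.simps)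
  then show "pw 2 \<subseteq> soc" using soc_iff pw_carr by blast
qed (rule soc_sub)

lemma mI_eq: "ideal_prod R \<mm> I = pw 3"
  using not_burch soc_eq by (simp add: eval_nat_numeral)

text \<open>The quotient by \<open>\<mm>\<^sup>2\<close> uses up \<open>1 + 3\<close> of the six
  steps. Two independent classes with a span smaller than \<open>\<mm>\<^sup>2\<close> would add
  three more and give a chain of length seven.\<close>

lemma pw2_eq:
  assumes "G \<in> pw 2" "G \<notin> I" "F \<in> pw 2" "F \<notin> adj I G"
  shows "adj (adj I G) F = pw 2"
proof (rule ccontr)
  note c = pw_carr[OF assms(1)] pw_carr[OF assms(3)]
  assume no: "adj (adj I G) F \<noteq> pw 2"
  obtain xs where xs: "length xs = d" "set xs \<subseteq> \<mm>" "indep (pw 2) xs" "adjl (pw 2) xs = \<mm>" by (rule mm_basis)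
  have "chain_len \<mm> (carrier R) (Suc 0)"
    by (rule chain_len_Cons[OF mm_ideal _ chain_len_refl[OF oneideal]]) (use mm_carr one_notin_mm in blast)
  then have "chain_len (pw 2) (carrier R) (length xs + Suc 0)"
    by (intro chain_len_indep[OF pw_ideal]) (use xs mm_carr in auto)
  moreover have "adj (adj I G) F \<subset> pw 2"
    using adj_least[OF pw_ideal adj_least[OF pw_ideal I_sub assms(1)] assms(3)] no by blast
  ultimately have "chain_len (adj (adj I G) F) (carrier R) (Suc (length xs + Suc 0))"
    by (intro chain_len_Cons[OF adj_ideal[OF adj_ideal[OF I_ideal c(1)] c(2)]])
  then have "chain_len (adj (adj I G) F) (carrier R) 5" using xs(1) d_eq_3 by (simp add: eval_nat_numeral)
  then have "chain_len I (carrier R) (length [G, F] + 5)"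
    by (intro chain_len_indep[OF I_ideal]) (use assms c in auto)
  from len6[OF this] show False by simp
qed

text \<open>\<open>H/I\<close> is a nonzero proper subspace of the plane
  \<open>\<mm>\<^sup>2/I\<close>, hence a line spanned by any of its nonzero vectors.\<close>

lemma line_eq:
  assumes H: "ideal H R" "I \<subseteq> H" "H \<subseteq> pw 2" "\<not> pw 2 \<subseteq> H" and G: "G \<in> H" "G \<notin> I"
  shows "H = adj I G"
proof
  show "adj I G \<subseteq> H" by (rule adj_least[OF H(1,2) G(1)])
  show "H \<subseteq> adj I G"
  proof (rule ccontr)
    assume "\<not> H \<subseteq> adj I G"
    then obtain F where F: "F \<in> H" "F \<notin> adj I G" by blast
    have "adj (adj I G) F = pw 2" by (rule pw2_eq) (use G F H in auto)
    then show False using adj_least[OF H(1) adj_least[OF H(1,2) G(1)] F(1)] H(4) by simp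
  qed
qed

lemma socle_basis:
  obtains q1 q2 where "q1 \<in> pw 2" "q2 \<in> pw 2" "q1 \<notin> I" "q2 \<notin> adj I q1" "adj (adj I q1) q2 = pw 2"
proof -
  obtain q1 where q1: "q1 \<in> pw 2" "q1 \<notin> I" using pw2_not_sub_I by blast
  have "\<not> pw 2 \<subseteq> adj I q1" using second_layer_not_cyclic[OF q1(1)] J3_eq[OF d_eq_3] by simp
  then obtain q2 where "q2 \<in> pw 2" "q2 \<notin> adj I q1" by blast
  then show ?thesis using that[of q1 q2] q1 pw2_eq by simp
qed

lemma pw2_mult: "f \<in> pw 2 \<Longrightarrow> p \<in> \<mm> \<Longrightarrow> p \<otimes> f \<in> pw 3"
  using pw_mm_mult[of p f 2] by (simp add: eval_nat_numeral del: pw.simps)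

text \<open>Because \<open>\<mm> I = \<mm>\<^sup>3\<close>, minimal generators of \<open>I\<close>
  form a basis of \<open>I/\<mm>\<^sup>3\<close>. Two socle classes complete it to a basis of
  \<open>\<mm>\<^sup>2/\<mm>\<^sup>3\<close>, which has as many elements as there are quadratic
  monomials.\<close>

lemma I_generators:
  obtains as where "length as = 4" "set as \<subseteq> I" "indep (pw 3) as" "Idl (set as) = I"
proof -
  obtain A where A: "A \<subseteq> carrier R" "finite A" "I = Idl A" using finetely_gen[OF I_ideal] by blast
  obtain fs where fs: "set fs = A" using finite_list[OF A(2)] by blast
  have fsI: "set fs \<subseteq> I" using genideal_self[OF A(1)] fs A(3) by simp
  have fsc: "set fs \<subseteq> carrier R" using fs A by simp
  obtain as where as: "set as \<subseteq> set fs" "indep (pw 3) as" "adjl (pw 3) as = adjl (pw 3) fs"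
    using ex_basis[OF pw_ideal fsc] by blast
  have "I \<subseteq> adjl (pw 3) fs"
    unfolding A(3) by (rule genideal_minimal[OF adjl_ideal[OF pw_ideal fsc]]) (use adjl_gens[OF pw_ideal fsc] fs in blast)
  then have asI: "adjl (pw 3) as = I" using adjl_least[OF I_ideal pw3_sub_I fsI] as(3) by blast
  have asc: "set as \<subseteq> carrier R" using as fsc by blast
  obtain q1 q2 where q: "q1 \<in> pw 2" "q2 \<in> pw 2" "q1 \<notin> I" "q2 \<notin> adj I q1" "adj (adj I q1) q2 = pw 2"
    by (rule socle_basis)
  let ?bs = "as @ [q1, q2]"
  have b: "indep (pw 3) ?bs" "adjl (pw 3) ?bs = pw 2" "set ?bs \<subseteq> pw 2"
    using as q asI I_sub fsI by (auto simp: indep_append adjl_append)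
  obtain ms where ms: "length ms = 6" "set ms \<subseteq> pw 2" "indep (pw 3) ms" "pw 2 \<subseteq> adjl (pw 3) ms"
    by (rule dim3_quadrics_basis[OF d_eq_3])
  have c2: "set fs \<subseteq> carrier R" "\<And>f p. f \<in> set fs \<Longrightarrow> p \<in> \<mm> \<Longrightarrow> p \<otimes> f \<in> pw 3" if "set fs \<subseteq> pw 2" for fs
    using that pw_carr pw2_mult by blast+
  have "length ?bs \<le> length ms"
    by (rule steinitz[OF pw_ideal c2[OF ms(2)] b(1)]) (use b(3) ms(4) in blast)+
  moreover have "length ms \<le> length ?bs"
    by (rule steinitz[OF pw_ideal c2[OF b(3)] ms(3)]) (use b(2) ms(2) in blast)+
  ultimately have "length ?bs = length ms" by (rule order_antisym)
  then have len: "length as = 4" using ms(1) by simp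
  have "Idl (set as) = I"
  proof
    show "Idl (set as) \<subseteq> I" by (rule genideal_minimal[OF I_ideal]) (use as fsI in blast)
    show "I \<subseteq> Idl (set as)"
    proof (rule nakayama[OF I_ideal genideal_ideal[OF asc]])
      fix L' assume L': "ideal L' R" "Idl (set as) \<subseteq> L'" "\<And>w p. w \<in> I \<Longrightarrow> p \<in> \<mm> \<Longrightarrow> p \<otimes> w \<in> L'"
      have "pw 3 \<subseteq> L'" unfolding mI_eq[symmetric] by (rule ideal_prod_least[OF L'(1)]) (rule L'(3))
      then have "adjl (pw 3) as \<subseteq> L'" using adjl_least[OF L'(1)] L'(2) genideal_self[OF asc] by blast
      then show "I \<subseteq> L'" using asI by simp
    qed
  qed
  then show ?thesis using that[OF len] as fsI by blast
qed

lemma num_gens_I: "num_gens R I = 4"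
proof -
  obtain as where as: "length as = 4" "set as \<subseteq> I" "indep (pw 3) as" "Idl (set as) = I" by (rule I_generators)
  have ge: "4 \<le> card G" if G: "finite G" "G \<subseteq> carrier R" "Idl G = I" for G
  proof -
    obtain gs where gs: "set gs = G" "distinct gs" using finite_distinct_list[OF G(1)] by blast
    have gc: "set gs \<subseteq> carrier R" using gs G by simp
    have gI: "set gs \<subseteq> I" using genideal_self[OF G(2)] gs G by simp
    have "Idl G \<subseteq> adjl (pw 3) gs"
      by (rule genideal_minimal[OF adjl_ideal[OF pw_ideal gc]]) (use adjl_gens[OF pw_ideal gc] gs in blast)
    then have "set as \<subseteq> adjl (pw 3) gs" using as G by blast
    then have "length as \<le> length gs" by (intro steinitz[OF pw_ideal gc _ as(3)]) (use gI I_sub pw2_mult in blast)+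
    then show ?thesis using as(1) distinct_card[OF gs(2)] gs(1) by simp
  qed
  have asc: "set as \<subseteq> carrier R" using as ideal_carr[OF I_ideal] by blast
  \<comment> \<open>The lower bound for generating sets rules out repetitions in the list.\<close>
  have "card (set as) = 4" using ge[of "set as"] asc as card_length[of as] by simp
  then show ?thesis unfolding num_gens_def using ge asc as(4)
    by (intro Least_equality) (blast intro: exI[of _ "set as"])+
qed

text \<open>Symmetric bilinear forms of rank one in the pencil dual to \<open>\<mm>\<^sup>2/I\<close> are excluded: for such a
  form \<open>\<mm>I\<close> would miss the cube of the parameter outside its radical.\<close>

lemma no_rank_one:
  assumes H: "ideal H R" "I \<subseteq> H" "\<not> pw 2 \<subseteq> H" and u: "u \<in> \<mm>" "\<And>p. p \<in> \<mm> \<Longrightarrow> p \<otimes> u \<in> H"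
    and v: "v \<in> \<mm>" "\<And>p. p \<in> \<mm> \<Longrightarrow> p \<otimes> v \<in> H" and un: "u \<notin> pw 2"
  shows "v \<in> adj (pw 2) u"
proof (rule ccontr)
  assume vn: "v \<notin> adj (pw 2) u"
  obtain zs where zs: "set zs \<subseteq> \<mm>" "length [u, v] + length zs = d" "adjl (pw 2) ([u, v] @ zs) = \<mm>"
    by (rule basis_extend[of "[u, v]"]) (use u v un vn in auto)
  then obtain w where w: "zs = [w]" using d_eq_3 by (auto simp: length_Suc_conv)
  have wm: "w \<in> \<mm>" and span: "\<mm> \<subseteq> adjl (pw 2) [u, v, w]" using zs w by auto
  note c = mm_carr[OF u(1)] mm_carr[OF v(1)] mm_carr[OF wm]
  have wc: "set [w, u, v] \<subseteq> carrier R" using c by simp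
  have span': "\<mm> \<subseteq> adjl (pw 2) [w, u, v]"
    by (rule span_trans[OF span]) (use wm u v adjl_gens[OF pw_ideal[of 2] wc] in auto)
  obtain Q where Q: "primeideal Q R" "set [u, v] \<subseteq> Q" "\<And>t. pw t \<subseteq> adj Q (w [^] t)"
      "\<And>t c. c \<in> carrier R \<Longrightarrow> c \<otimes> w [^] (t::nat) \<in> adj Q (w [^] Suc t) \<Longrightarrow> c \<in> \<mm>"
    by (rule regular_parameter[of w "[u, v]"]) (use wm u v d_eq_3 span' in auto)
  note Qi = prime_ideal[OF Q(1)]
  have w3: "w [^] (3::nat) \<in> carrier R" "w \<otimes> w \<in> carrier R" using c by simp_all
  note Q3 = adj_ideal[OF Qi w3(1)] adj_sub[OF Qi w3(1)]
  \<comment> \<open>\<open>K\<close> contains all products of the parameters \<open>u, v, w\<close>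
    except possibly \<open>w\<^sup>2\<close>, so \<open>\<mm>\<^sup>2\<close> lies in
    \<open>K + (w\<^sup>2)\<close>; membership in \<open>H\<close> then only tests the coefficient
    of \<open>w\<^sup>2\<close>.\<close>
  define K where "K = H \<inter> adj Q (w [^] (3::nat))"
  have K: "ideal K R" unfolding K_def by (rule i_intersect[OF H(1) Q3(1)])
  note Kw = adj_ideal[OF K w3(2)] adj_sub[OF K w3(2)] adj_self[OF K w3(2)]
  have hK: "h \<otimes> g \<in> K" if "g \<in> {u, v}" "h \<in> \<mm>" for g h
    unfolding K_def using that u(2) v(2) ideal_mult[OF Qi, of g h] Q(2) Q3(2) mm_carr by auto
  have hK': "g \<otimes> h \<in> K" if "g \<in> {u, v}" "h \<in> \<mm>" for g h
    using hK[OF that] m_comm[of g h] mm_carr[OF that(2)] c that(1) by auto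
  have span2: "pw 2 \<subseteq> adj K (w \<otimes> w)"
  proof (rule mult_span[OF Kw(1) _ _ span])
    show "pw 3 \<subseteq> adj K (w \<otimes> w)" using pw3_sub_I H(2) Q(3)[of 3] Kw(2) unfolding K_def by blast
    show "g \<otimes> h \<in> adj K (w \<otimes> w)" if "g \<in> set [u, v, w]" "h \<in> set [u, v, w]" for g h
    proof (cases "g = w \<and> h = w")
      case True then show ?thesis using Kw by simp
    next
      case False
      then have "g \<in> {u, v} \<and> h \<in> \<mm> \<or> h \<in> {u, v} \<and> g \<in> \<mm>" using that u v wm by auto
      then show ?thesis using hK hK' Kw(2) by blast
    qed
  qed (use u v wm in auto)
  have wH: "w \<otimes> w \<notin> H"
  proof
    assume "w \<otimes> w \<in> H"
    then have "adj K (w \<otimes> w) \<subseteq> H" by (intro adj_least[OF H(1)]) (auto simp: K_def)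
    then show False using span2 H(3) by blast
  qed
  \<comment> \<open>Elements of \<open>I\<close> lie in \<open>H\<close>, so their coefficient at
    \<open>w\<^sup>2\<close> is not a unit; this gains one order modulo \<open>Q\<close>.\<close>
  have I3: "I \<subseteq> adj Q (w [^] (3::nat))"
  proof
    fix a assume a: "a \<in> I"
    then have "a \<in> adj K (w \<otimes> w)" using I_sub span2 by blast
    then obtain k e where k: "k \<in> K" "e \<in> carrier R" "a = k \<oplus> e \<otimes> (w \<otimes> w)" by (rule adjE)
    have kc: "k \<in> carrier R" using ideal_carr[OF K k(1)] .
    have "e \<otimes> (w \<otimes> w) = a \<ominus> k" unfolding k(3) using kc k(2) w3(2) by algebra
    then have "e \<otimes> (w \<otimes> w) \<in> H" using a k(1) H(2) ideal_minus[OF H(1)] unfolding K_def by auto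
    then have "e \<in> \<mm>" using unit_cancel[OF H(1) k(2) _ w3(2)] wH by blast
    moreover have "w \<otimes> w \<in> pw 2" unfolding pw_2 using ideal_prod.prod[OF wm wm, of R] .
    ultimately have "e \<otimes> (w \<otimes> w) \<in> adj Q (w [^] (3::nat))" using pw2_mult Q(3)[of 3] by blast
    then show "a \<in> adj Q (w [^] (3::nat))" unfolding k(3) using k(1) ideal_add[OF Q3(1)] unfolding K_def by blast
  qed
  \<comment> \<open>Now \<open>\<mm> I\<close>, which equals \<open>\<mm>\<^sup>3\<close> and
    contains \<open>w\<^sup>3\<close>, would consist of multiples of \<open>w\<^sup>4\<close> modulo
    \<open>Q\<close>, although \<open>w\<close> is a uniformizer there.\<close>
  have "pw 3 \<subseteq> adj Q (w \<otimes> w [^] (3::nat))" unfolding mI_eq[symmetric]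
  proof (rule ideal_prod_least[OF adj_ideal[OF Qi]])
    show "w \<otimes> w [^] (3::nat) \<in> carrier R" using c w3 by simp
    fix a b assume "a \<in> \<mm>" "b \<in> I"
    then have "a \<in> adj Q w" "b \<in> adj Q (w [^] (3::nat))" using I3 Q(3)[of "Suc 0"] pw_1 c by auto
    then show "a \<otimes> b \<in> adj Q (w \<otimes> w [^] (3::nat))" by (rule adj_sum_mult[OF Qi c(3) w3(1)])
  qed
  moreover have "w \<otimes> w [^] (3::nat) = w [^] Suc 3" unfolding nat_pow_Suc by (rule m_comm[OF c(3) w3(1)])
  ultimately have "w [^] (3::nat) \<in> adj Q (w [^] Suc 3)" using pw_nat_pow[OF wm, of 3] by (metis subsetD)
  then show False using Q(4)[of \<one> 3] one_notin_mm w3(1) by simp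
qed

text \<open>For \<open>x\<close> in \<open>\<mm>\<close> this is smaller than
  \<open>\<mm>\<^sup>2\<close> exactly if some nonzero functional on \<open>\<mm>\<^sup>2/I\<close>
  kills \<open>x \<mm>\<close>, that is, if \<open>x\<close> lies in the radical of a member of the
  pencil.\<close>

definition mult_image :: "'a \<Rightarrow> 'a set" where
  "mult_image x = {z. \<exists>u\<in>\<mm>. \<exists>i\<in>I. z = x \<otimes> u \<oplus> i}"

lemma mult_image_ideal: "x \<in> carrier R \<Longrightarrow> ideal (mult_image x) R"
proof (rule idealI')
  assume x: "x \<in> carrier R"
  show "mult_image x \<subseteq> carrier R" unfolding mult_image_def using x mm_carr ideal_carr[OF I_ideal] by auto
  have "\<zero> = x \<otimes> \<zero> \<oplus> \<zero>" using x by simp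
  then show "\<zero> \<in> mult_image x" unfolding mult_image_def using ideal_zero[OF I_ideal] ideal_zero[OF mm_ideal] by blast
  fix a assume "a \<in> mult_image x"
  then obtain u i where a: "u \<in> \<mm>" "i \<in> I" "a = x \<otimes> u \<oplus> i" unfolding mult_image_def by blast
  note ac = mm_carr[OF a(1)] ideal_carr[OF I_ideal a(2)]
  { fix b assume "b \<in> mult_image x"
    then obtain v j where b: "v \<in> \<mm>" "j \<in> I" "b = x \<otimes> v \<oplus> j" unfolding mult_image_def by blast
    note bc = mm_carr[OF b(1)] ideal_carr[OF I_ideal b(2)]
    have "a \<oplus> b = x \<otimes> (u \<oplus> v) \<oplus> (i \<oplus> j)" unfolding a(3) b(3) using x ac bc by algebra
    then show "a \<oplus> b \<in> mult_image x"
      unfolding mult_image_def using ideal_add[OF mm_ideal a(1) b(1)] ideal_add[OF I_ideal a(2) b(2)] by blast }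
  { fix e assume e: "e \<in> carrier R"
    have "e \<otimes> a = x \<otimes> (e \<otimes> u) \<oplus> e \<otimes> i" unfolding a(3) using x ac e by algebra
    then show "e \<otimes> a \<in> mult_image x"
      unfolding mult_image_def using ideal_mult[OF mm_ideal a(1) e] ideal_mult[OF I_ideal a(2) e] by blast }
qed

lemma mult_image_mult: "x \<in> carrier R \<Longrightarrow> u \<in> \<mm> \<Longrightarrow> x \<otimes> u \<in> mult_image x"
proof -
  assume x: "x \<in> carrier R" and u: "u \<in> \<mm>"
  then have "x \<otimes> u = x \<otimes> u \<oplus> \<zero>" using mm_carr by simp
  then show ?thesis unfolding mult_image_def using ideal_zero[OF I_ideal] u by blast
qed

lemma I_sub_mult_image: "x \<in> carrier R \<Longrightarrow> I \<subseteq> mult_image x"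
proof
  fix i assume x: "x \<in> carrier R" and i: "i \<in> I"
  then have "i = x \<otimes> \<zero> \<oplus> i" using ideal_carr[OF I_ideal] by simp
  then show "i \<in> mult_image x" unfolding mult_image_def using ideal_zero[OF mm_ideal] i by blast
qed

lemma mult_image_least: "ideal K R \<Longrightarrow> I \<subseteq> K \<Longrightarrow> (\<And>u. u \<in> \<mm> \<Longrightarrow> x \<otimes> u \<in> K) \<Longrightarrow> mult_image x \<subseteq> K"
  unfolding mult_image_def by (auto intro!: ideal_add)

lemma surjI:
  assumes x: "x \<in> \<mm>" and G: "G \<in> mult_image x" "G \<notin> I" and v: "v \<in> \<mm>" "x \<otimes> v \<notin> adj I G"
  shows "pw 2 \<subseteq> mult_image x"
proof -
  note xc = mm_carr[OF x]
  have "mult_image x \<subseteq> pw 2" by (rule mult_image_least[OF pw_ideal I_sub]) (use ideal_prod.prod[OF x, of _ \<mm> R] pw_2 in auto)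
  then have "adj (adj I G) (x \<otimes> v) = pw 2" using pw2_eq[of G "x \<otimes> v"] G v mult_image_mult[OF xc v(1)] by blast
  moreover have "adj (adj I G) (x \<otimes> v) \<subseteq> mult_image x"
    by (intro adj_least mult_image_ideal xc I_sub_mult_image G(1) mult_image_mult v(1))
  ultimately show ?thesis by simp
qed

lemma mult_image_pw2: "x \<in> pw 2 \<Longrightarrow> mult_image x \<subseteq> I"
proof (rule mult_image_least[OF I_ideal order_refl])
  fix u assume x: "x \<in> pw 2" and u: "u \<in> \<mm>"
  show "x \<otimes> u \<in> I" using pw2_mult[OF x u] pw3_sub_I m_comm[OF pw_carr[OF x] mm_carr[OF u]] by auto
qed

text \<open>Multiplication by \<open>x\<close> maps the three-dimensional
  \<open>\<mm>/\<mm>\<^sup>2\<close> onto the plane \<open>\<mm>\<^sup>2/I\<close>, so its kernel is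
  the line of \<open>y\<close>. The part of the annihilator inside \<open>\<mm>\<^sup>2\<close> lies
  in \<open>(y) + I\<close> because multiplication by \<open>y\<close> is onto as well.\<close>

lemma exact_colon:
  assumes x: "x \<in> \<mm>" and y: "y \<in> \<mm>" and xy: "x \<otimes> y \<in> I" and sx: "pw 2 \<subseteq> mult_image x" and sy: "pw 2 \<subseteq> mult_image y"
  shows "ideal_colon R I {x} = adj I y"
proof
  note xc = mm_carr[OF x] and yc = mm_carr[OF y]
  note Iy = adj_ideal[OF I_ideal yc] adj_sub[OF I_ideal yc] adj_self[OF I_ideal yc]
  have C: "ideal (ideal_colon R K {x}) R" if "ideal K R" for K by (rule colon_ideal[OF that]) (use xc in simp)
  have Isub: "I \<subseteq> ideal_colon R I {x}" using ideal_carr[OF I_ideal] ideal_multr[OF I_ideal _ xc] unfolding subset_iff colon_mem by blast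
  have yC: "y \<in> ideal_colon R I {x}" unfolding colon_mem using xy m_comm[OF xc yc] yc by simp
  show "adj I y \<subseteq> ideal_colon R I {x}" by (rule adj_least[OF C[OF I_ideal] Isub yC])
  have yn: "y \<notin> pw 2" using mult_image_pw2[of y] sy pw2_not_sub_I by blast
  have "mult_image y \<subseteq> adj I y"
    by (rule mult_image_least[OF Iy(1,2)]) (use ideal_multr[OF Iy(1,3)] mm_carr in blast)
  then have pw2y: "adj (pw 2) y \<subseteq> adj I y" using adj_least[OF Iy(1) _ Iy(3)] sy by blast
  obtain q1 q2 where q: "q1 \<in> pw 2" "q2 \<in> pw 2" "q1 \<notin> I" "q2 \<notin> adj I q1" by (rule socle_basis)
  note q1c = pw_carr[OF q(1)]
  obtain u i where u: "u \<in> \<mm>" "i \<in> I" "q1 = x \<otimes> u \<oplus> i" using q(1) sx unfolding mult_image_def by blast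
  obtain v j where v: "v \<in> \<mm>" "j \<in> I" "q2 = x \<otimes> v \<oplus> j" using q(2) sx unfolding mult_image_def by blast
  note uvc = mm_carr[OF u(1)] mm_carr[OF v(1)]
  have xu: "u \<otimes> x \<notin> I" using u(2,3) q(3) ideal_add[OF I_ideal] m_comm[OF xc uvc(1)] by auto
  have xv: "v \<otimes> x \<notin> adj I q1"
    using v(2,3) q(4) ideal_add[OF adj_ideal[OF I_ideal q1c]] adj_sub[OF I_ideal q1c] m_comm[OF xc uvc(2)] by auto
  show "ideal_colon R I {x} \<subseteq> adj I y"
  proof
    fix a assume aC: "a \<in> ideal_colon R I {x}"
    then have a: "a \<in> carrier R" "a \<otimes> x \<in> I" unfolding colon_mem by auto
    have am: "a \<in> \<mm>"
    proof (rule ccontr)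
      assume "a \<notin> \<mm>"
      then have "x \<in> I" using unit_cancel[OF I_ideal a(1) _ xc a(2)] by blast
      then show False using mult_image_pw2[of x] I_sub sx pw2_not_sub_I by blast
    qed
    have "a \<in> adj (pw 2) y"
    proof (rule ccontr)
      assume an: "a \<notin> adj (pw 2) y"
      \<comment> \<open>A further kernel vector \<open>a\<close>, together with \<open>y\<close> and
        preimages \<open>u\<close>, \<open>v\<close> of the socle basis, would give four independent
        vectors modulo \<open>\<mm>\<^sup>2\<close>.\<close>
      have pC: "pw 2 \<subseteq> ideal_colon R I {x}"
        using pw2_mult[OF _ x] pw3_sub_I m_comm[OF xc] pw_carr unfolding subset_iff colon_mem by metis
      have "adjl (pw 2) [y, a] \<subseteq> ideal_colon R I {x}" by (rule adjl_least[OF C[OF I_ideal] pC]) (use yC aC in simp)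
      then have un: "u \<notin> adjl (pw 2) [y, a]" using xu colon_mem by blast
      have CI: "ideal_colon R I {x} \<subseteq> ideal_colon R (adj I q1) {x}"
        using adj_sub[OF I_ideal q1c] unfolding subset_iff colon_mem by blast
      have "x \<otimes> u = q1 \<ominus> i" unfolding u(3) using xc uvc ideal_carr[OF I_ideal u(2)] by algebra
      then have "u \<otimes> x \<in> adj I q1"
        using adj_self[OF I_ideal q1c] adj_sub[OF I_ideal q1c] u(2) ideal_minus[OF adj_ideal[OF I_ideal q1c]] m_comm[OF xc uvc(1)] by auto
      then have "adjl (pw 2) [y, a, u] \<subseteq> ideal_colon R (adj I q1) {x}"
        by (intro adjl_least[OF C[OF adj_ideal[OF I_ideal q1c]]]) (use pC CI yC aC uvc colon_mem in auto)
      then have vn: "v \<notin> adjl (pw 2) [y, a, u]" using xv colon_mem by blast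
      have ind: "indep (pw 2) [y, a, u, v]" using yn an un vn by simp
      have S: "set [y, a, u, v] \<subseteq> \<mm>" using y am u v by simp
      show False by (rule basis_extend[OF S ind]) (use d_eq_3 in simp)
    qed
    then show "a \<in> adj I y" using pw2y by blast
  qed
qed

end

section \<open>Dimension three: exact pairs of zero-divisors\<close>

context non_burch_quotient
begin

definition exact_mod :: "'a \<Rightarrow> 'a \<Rightarrow> bool" where
  "exact_mod x y \<longleftrightarrow> x \<in> \<mm> \<and> y \<in> \<mm> \<and> x \<otimes> y \<in> I \<and> pw 2 \<subseteq> mult_image x \<and> pw 2 \<subseteq> mult_image y"

section \<open>Criteria for multiplication to be onto the socle\<close>

lemma mem_mult_image:
  assumes "x \<in> carrier R" "e \<in> \<mm>" "G \<in> carrier R" "c \<in> carrier R" "c \<notin> \<mm>" "i \<in> I" "x \<otimes> e = i \<oplus> c \<otimes> G"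
  shows "G \<in> mult_image x"
proof -
  note T = mult_image_ideal[OF assms(1)]
  have i: "i \<in> mult_image x" using I_sub_mult_image[OF assms(1)] assms(6) by blast
  have "c \<otimes> G = x \<otimes> e \<ominus> i" unfolding assms(7) using ideal_carr[OF I_ideal assms(6)] assms(3,4) by algebra
  also have "\<dots> \<in> mult_image x" by (rule ideal_minus[OF T mult_image_mult[OF assms(1,2)] i])
  finally show ?thesis by (rule unit_cancel[OF T assms(4,5,3)])
qed

lemma notin_add_unit:
  assumes H: "ideal H R" "h \<in> H" and c: "c \<in> carrier R" "c \<notin> \<mm>" and F: "F \<in> carrier R" "F \<notin> H"
  shows "h \<oplus> c \<otimes> F \<notin> H"
proof
  assume "h \<oplus> c \<otimes> F \<in> H"
  then have "(h \<oplus> c \<otimes> F) \<ominus> h \<in> H" using ideal_minus[OF H(1) _ H(2)] by blast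
  moreover have "(h \<oplus> c \<otimes> F) \<ominus> h = c \<otimes> F" using c F ideal_carr[OF H] by algebra
  ultimately show False using unit_cancel[OF H(1) c F(1)] F(2) by simp
qed

text \<open>A triangular system: \<open>x e\<close> is a unit times \<open>G\<close> modulo
  \<open>I\<close>, and \<open>x v\<close> is a unit times \<open>F\<close> modulo
  \<open>I + (G)\<close>. Hence \<open>x\<close> reaches two independent vectors of the plane
  \<open>\<mm>\<^sup>2/I\<close>.\<close>

lemma surj_mod:
  assumes x: "x \<in> \<mm>" and G: "G \<in> carrier R" "G \<notin> I" and F: "F \<in> carrier R" "F \<notin> adj I G"
    and e: "e \<in> \<mm>" "c \<in> carrier R" "c \<notin> \<mm>" "i \<in> I" "x \<otimes> e = i \<oplus> c \<otimes> G"
    and v: "v \<in> \<mm>" "k \<in> carrier R" "k \<notin> \<mm>" "h \<in> adj I G" "x \<otimes> v = h \<oplus> k \<otimes> F"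
  shows "pw 2 \<subseteq> mult_image x"
proof (rule surjI[OF x _ G(2) v(1)])
  show "G \<in> mult_image x" by (rule mem_mult_image[OF mm_carr[OF x] e(1) G(1) e(2-5)])
  show "x \<otimes> v \<notin> adj I G" unfolding v(5) by (rule notin_add_unit[OF adj_ideal[OF I_ideal G(1)] v(4,2,3) F])
qed

lemma neg_unit: "c \<in> carrier R \<Longrightarrow> c \<notin> \<mm> \<Longrightarrow> \<ominus> c \<notin> \<mm>"
  using ideal_neg[OF mm_ideal, of "\<ominus> c"] by auto

lemma pw2_prod: "a \<in> \<mm> \<Longrightarrow> b \<in> \<mm> \<Longrightarrow> a \<otimes> b \<in> pw 2"
  unfolding pw_2 by (rule ideal_prod.prod)

lemma pw2_expand:
  assumes "G \<in> pw 2" "G \<notin> I" "F \<in> pw 2" "F \<notin> adj I G" "q \<in> pw 2"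
  obtains i c k where "i \<in> I" "c \<in> carrier R" "k \<in> carrier R" "q = i \<oplus> c \<otimes> G \<oplus> k \<otimes> F"
proof -
  have "q \<in> adj (adj I G) F" using pw2_eq[OF assms(1-4)] assms(5) by simp
  then obtain j k where j: "j \<in> adj I G" "k \<in> carrier R" "q = j \<oplus> k \<otimes> F" by (rule adjE)
  obtain i c where "i \<in> I" "c \<in> carrier R" "j = i \<oplus> c \<otimes> G" using j(1) by (rule adjE)
  then show ?thesis using that j by blast
qed

lemma colon_I: "u \<in> \<mm> \<Longrightarrow> ideal (ideal_colon R I {u}) R \<and> pw 2 \<subseteq> ideal_colon R I {u}"
proof
  assume u: "u \<in> \<mm>"
  show "ideal (ideal_colon R I {u}) R" by (rule colon_ideal[OF I_ideal]) (use u mm_carr in simp)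
  show "pw 2 \<subseteq> ideal_colon R I {u}"
    using pw2_mult[OF _ u] pw3_sub_I m_comm[OF mm_carr[OF u]] pw_carr unfolding subset_iff colon_mem by metis
qed

lemma notin_pw2: "e \<in> \<mm> \<Longrightarrow> e \<otimes> b \<notin> I \<Longrightarrow> b \<in> \<mm> \<Longrightarrow> e \<notin> pw 2"
  using colon_I[of b] colon_mem by blast

text \<open>All products of \<open>e, a, b\<close> are combinations of \<open>e b\<close> and
  \<open>a\<^sup>2\<close> modulo \<open>I\<close>. In
  \<open>b\<^sup>2 = k e b + r a\<^sup>2\<close> the coefficient \<open>r\<close> must be a unit,
  since otherwise the form reading off \<open>a\<^sup>2\<close> would have \<open>e\<close> and
  \<open>b\<close> in its radical and hence rank one.\<close>

lemma exact_pair_diagonal: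
  assumes m: "e \<in> \<mm>" "a \<in> \<mm>" "b \<in> \<mm>" and I: "e \<otimes> e \<in> I" "e \<otimes> a \<in> I" "a \<otimes> b \<in> I"
    and G: "e \<otimes> b \<notin> I" and F: "a \<otimes> a \<notin> adj I (e \<otimes> b)" and span: "\<mm> \<subseteq> adjl (pw 2) [e, a, b]"
  shows "\<exists>x y. exact_mod x y"
proof -
  note c = mm_carr[OF m(1)] mm_carr[OF m(2)] mm_carr[OF m(3)]
  have p: "e \<otimes> b \<in> pw 2" "a \<otimes> a \<in> pw 2" "b \<otimes> b \<in> pw 2" using m pw2_prod by auto
  note pc = p(1)[THEN pw_carr] p(2)[THEN pw_carr] p(3)[THEN pw_carr]
  define H where "H = adj I (e \<otimes> b)"
  have H: "ideal H R" "I \<subseteq> H" "e \<otimes> b \<in> H" "a \<otimes> a \<notin> H"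
    unfolding H_def using adj_ideal[OF I_ideal pc(1)] adj_sub[OF I_ideal pc(1)] adj_self[OF I_ideal pc(1)] F by auto
  obtain i k r where bb: "i \<in> I" "k \<in> carrier R" "r \<in> carrier R" "b \<otimes> b = i \<oplus> k \<otimes> (e \<otimes> b) \<oplus> r \<otimes> (a \<otimes> a)"
    by (rule pw2_expand[OF p(1) G p(2) F p(3)])
  have ic: "i \<in> carrier R" using ideal_carr[OF I_ideal bb(1)] .
  have r: "r \<notin> \<mm>"
  proof
    assume "r \<in> \<mm>"
    then have "r \<otimes> (a \<otimes> a) \<in> I" using pw2_mult[OF p(2)] pw3_sub_I by blast
    then have bbH: "b \<otimes> b \<in> H" unfolding bb(4) using bb(1,2) H by (auto intro!: ideal_add[OF H(1)] ideal_mult[OF H(1) H(3)])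
    have K3: "pw 3 \<subseteq> H" using pw3_sub_I H(2) by blast
    have xs: "set [e, a, b] \<subseteq> \<mm>" using m by simp
    have cm: "a \<otimes> e = e \<otimes> a" "b \<otimes> e = e \<otimes> b" using c m_comm by auto
    have "q \<otimes> e \<in> H" if "q \<in> \<mm>" for q
      by (rule mult_span_left[OF H(1) K3 xs span m(1) _ that]) (use I H cm in auto)
    moreover have "q \<otimes> b \<in> H" if "q \<in> \<mm>" for q
      by (rule mult_span_left[OF H(1) K3 xs span m(3) _ that]) (use I H bbH in auto)
    ultimately have "b \<in> adj (pw 2) e"
      using no_rank_one[OF H(1,2) _ m(1) _ m(3)] p(2) H(4) notin_pw2[OF m(1) G m(3)] by blast
    moreover have "adj (pw 2) e \<subseteq> ideal_colon R I {e}"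
      using colon_I[OF m(1)] I(1) c by (intro adj_least) (auto simp: colon_mem)
    ultimately show False using G m_comm[OF c(1,3)] colon_mem by auto
  qed
  \<comment> \<open>The form \<open>y\<close> is chosen so that \<open>x y\<close> equals
    \<open>b\<^sup>2 - k e b - r a\<^sup>2\<close> up to products that vanish modulo
    \<open>I\<close>. As \<open>r\<close> is a unit, \<open>y a\<close> still reaches
    \<open>a\<^sup>2\<close>.\<close>
  define x where "x = a \<oplus> b"
  define y where "y = b \<ominus> r \<otimes> a \<ominus> k \<otimes> e"
  have xm: "x \<in> \<mm>" unfolding x_def using m ideal_add[OF mm_ideal] by blast
  have ym: "y \<in> \<mm>" unfolding y_def using ideal_minus[OF mm_ideal ideal_minus[OF mm_ideal m(3) ideal_mult[OF mm_ideal m(2) bb(3)]] ideal_mult[OF mm_ideal m(1) bb(2)]] .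
  have "x \<otimes> y = (a \<otimes> b \<ominus> r \<otimes> (a \<otimes> b) \<ominus> k \<otimes> (e \<otimes> a)) \<oplus> (b \<otimes> b \<ominus> k \<otimes> (e \<otimes> b) \<ominus> r \<otimes> (a \<otimes> a))"
    unfolding x_def y_def using c bb(2,3) by algebra
  also have "b \<otimes> b \<ominus> k \<otimes> (e \<otimes> b) \<ominus> r \<otimes> (a \<otimes> a) = i" unfolding bb(4) using ic bb(2,3) c by algebra
  also have "(a \<otimes> b \<ominus> r \<otimes> (a \<otimes> b) \<ominus> k \<otimes> (e \<otimes> a)) \<oplus> i \<in> I"
    using ideal_add[OF I_ideal ideal_minus[OF I_ideal ideal_minus[OF I_ideal I(3) ideal_mult[OF I_ideal I(3) bb(3)]] ideal_mult[OF I_ideal I(2) bb(2)]] bb(1)] .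
  finally have xy: "x \<otimes> y \<in> I" .
  have "pw 2 \<subseteq> mult_image x"
  proof (rule surj_mod[OF xm pc(1) G pc(2) F m(1) one_closed one_notin_mm I(2) _ m(2) one_closed one_notin_mm])
    show "x \<otimes> e = e \<otimes> a \<oplus> \<one> \<otimes> (e \<otimes> b)" unfolding x_def using c by algebra
    show "x \<otimes> a = a \<otimes> b \<oplus> \<one> \<otimes> (a \<otimes> a)" unfolding x_def using c by algebra
    show "a \<otimes> b \<in> adj I (e \<otimes> b)" using I(3) H(2) H_def by blast
  qed
  moreover have "pw 2 \<subseteq> mult_image y"
  proof (rule surj_mod[OF ym pc(1) G pc(2) F m(1) one_closed one_notin_mm _ _ m(2) _ neg_unit[OF bb(3) r]])
    show "(\<ominus> r) \<otimes> (e \<otimes> a) \<ominus> k \<otimes> (e \<otimes> e) \<in> I"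
      by (rule ideal_minus[OF I_ideal ideal_mult[OF I_ideal I(2)] ideal_mult[OF I_ideal I(1)]]) (use bb in auto)
    show "y \<otimes> e = (\<ominus> r) \<otimes> (e \<otimes> a) \<ominus> k \<otimes> (e \<otimes> e) \<oplus> \<one> \<otimes> (e \<otimes> b)" unfolding y_def using c bb(2,3) by algebra
    have "a \<otimes> b \<ominus> k \<otimes> (e \<otimes> a) \<in> I" by (rule ideal_minus[OF I_ideal I(3) ideal_mult[OF I_ideal I(2) bb(2)]])
    then show "a \<otimes> b \<ominus> k \<otimes> (e \<otimes> a) \<in> adj I (e \<otimes> b)" using H(2) H_def by blast
    show "y \<otimes> a = a \<otimes> b \<ominus> k \<otimes> (e \<otimes> a) \<oplus> (\<ominus> r) \<otimes> (a \<otimes> a)" unfolding y_def using c bb(2,3) by algebra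
  qed (use bb in simp)
  ultimately show ?thesis unfolding exact_mod_def using xm ym xy by blast
qed

text \<open>Since the image of \<open>e\<close> is a line, its kernel in
  \<open>\<mm>/\<mm>\<^sup>2\<close> is a plane, and it contains \<open>e\<close>. A second kernel
  vector \<open>a\<close> and a vector \<open>z\<close> with \<open>e z\<close> nonzero complete a
  basis. The cases differ in whether \<open>a\<^sup>2\<close> falls on the line of
  \<open>e z\<close>.\<close>

lemma exact_pair_isotropic:
  assumes e: "e \<in> \<mm>" "e \<notin> pw 2" "e \<otimes> e \<in> I" and ns: "\<not> pw 2 \<subseteq> mult_image e"
  shows "\<exists>x y. exact_mod x y"
proof -
  note ec = mm_carr[OF e(1)]
  obtain z where z: "z \<in> \<mm>" "z \<otimes> e \<notin> I" using e(2) soc_eq soc_iff ec by blast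
  note zc = mm_carr[OF z(1)]
  have G: "e \<otimes> z \<notin> I" using z m_comm[OF ec zc] by simp
  define H where "H = mult_image e"
  have H: "ideal H R" "I \<subseteq> H" "\<not> pw 2 \<subseteq> H" "\<And>p. p \<in> \<mm> \<Longrightarrow> p \<otimes> e \<in> H"
    unfolding H_def using mult_image_ideal[OF ec] I_sub_mult_image[OF ec] ns mult_image_mult[OF ec] m_comm[OF ec] mm_carr by auto
  have "H \<subseteq> pw 2" unfolding H_def by (rule mult_image_least[OF pw_ideal I_sub pw2_prod[OF e(1)]])
  moreover have "e \<otimes> z \<in> H" unfolding H_def by (rule mult_image_mult[OF ec z(1)])
  ultimately have HG: "H = adj I (e \<otimes> z)" using line_eq[OF H(1,2) _ H(3) _ G] by blast
  note C = colon_I[OF e(1)]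
  have "\<exists>a. a \<in> \<mm> \<and> e \<otimes> a \<in> I \<and> a \<notin> adj (pw 2) e"
  proof (rule ccontr)
    assume "\<not> ?thesis"
    \<comment> \<open>If \<open>e\<close> alone spanned the kernel, subtracting from any
      \<open>v\<close> a multiple of \<open>z\<close> with the same image would show that
      \<open>e\<close> and \<open>z\<close> span \<open>\<mm>\<close> modulo
      \<open>\<mm>\<^sup>2\<close>.\<close>
    then have no: "v \<in> adj (pw 2) e" if "v \<in> \<mm>" "e \<otimes> v \<in> I" for v using that by blast
    have ez: "set [e, z] \<subseteq> carrier R" using ec zc by simp
    note A = adjl_ideal[OF pw_ideal[of 2] ez] adjl_gens[OF pw_ideal[of 2] ez]
    have "\<mm> \<subseteq> adjl (pw 2) [e, z]"
    proof
      fix v assume v: "v \<in> \<mm>"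
      note vc = mm_carr[OF v]
      have "e \<otimes> v \<in> H" unfolding H_def by (rule mult_image_mult[OF ec v])
      then obtain i c where i: "i \<in> I" "c \<in> carrier R" "e \<otimes> v = i \<oplus> c \<otimes> (e \<otimes> z)" unfolding HG by (rule adjE)
      have "e \<otimes> (v \<ominus> c \<otimes> z) = e \<otimes> v \<ominus> c \<otimes> (e \<otimes> z)" using ec vc zc i(2) by algebra
      also have "\<dots> = i" unfolding i(3) using ideal_carr[OF I_ideal i(1)] i(2) ec zc by algebra
      finally have "v \<ominus> c \<otimes> z \<in> adj (pw 2) e"
        using no[OF ideal_minus[OF mm_ideal v ideal_mult[OF mm_ideal z(1) i(2)]]] i(1) by simp
      from adjI[OF this i(2)] have "v \<ominus> c \<otimes> z \<oplus> c \<otimes> z \<in> adjl (pw 2) [e, z]" by simp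
      moreover have "v \<ominus> c \<otimes> z \<oplus> c \<otimes> z = v" using vc zc i(2) by algebra
      ultimately show "v \<in> adjl (pw 2) [e, z]" by simp
    qed
    then show False using span_length[of "[e, z]"] e(1) z(1) d_eq_3 by simp
  qed
  then obtain a where a: "a \<in> \<mm>" "e \<otimes> a \<in> I" "a \<notin> adj (pw 2) e" by blast
  note ac = mm_carr[OF a(1)]
  have "adjl (pw 2) [e, a] \<subseteq> ideal_colon R I {e}"
    using C e(3) a(2) ec ac m_comm[OF ec ac] by (intro adjl_least) (auto simp: colon_mem)
  then have "z \<notin> adjl (pw 2) [e, a]" using z(2) colon_mem by blast
  then have ind: "indep (pw 2) [e, a, z]" using e(2) a(3) by simp
  have eaz: "set [e, a, z] \<subseteq> \<mm>" using e a z by simp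
  obtain zs where "length [e, a, z] + length zs = d" "adjl (pw 2) ([e, a, z] @ zs) = \<mm>"
    by (rule basis_extend[OF eaz ind])
  then have span: "\<mm> \<subseteq> adjl (pw 2) [e, a, z]" using d_eq_3 by simp
  have p: "e \<otimes> z \<in> pw 2" "a \<otimes> a \<in> pw 2" "a \<otimes> z \<in> pw 2" "z \<otimes> z \<in> pw 2" using e(1) a(1) z(1) pw2_prod by auto
  note pc = p(1)[THEN pw_carr] p(2)[THEN pw_carr] p(3)[THEN pw_carr]
  have GH: "e \<otimes> z \<in> H" unfolding HG by (rule adj_self[OF I_ideal pc(1)])
  show ?thesis
  proof (cases "a \<otimes> a \<in> H")
    case True
    \<comment> \<open>Otherwise both \<open>e\<close> and \<open>a\<close> would lie in the radical
      of the member vanishing on \<open>H\<close>.\<close>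
    have F: "a \<otimes> z \<notin> adj I (e \<otimes> z)"
    proof
      assume az: "a \<otimes> z \<in> adj I (e \<otimes> z)"
      have "q \<otimes> a \<in> H" if "q \<in> \<mm>" for q
        by (rule mult_span_left[OF H(1) _ eaz span a(1) _ that])
          (use True az HG H(2) a(2) pw3_sub_I m_comm[OF zc ac] in auto)
      from no_rank_one[OF H(1-3) e(1) H(4) a(1) this e(2)] a(3) show False by blast
    qed
    obtain i k r where zz: "i \<in> I" "k \<in> carrier R" "r \<in> carrier R" "z \<otimes> z = i \<oplus> k \<otimes> (e \<otimes> z) \<oplus> r \<otimes> (a \<otimes> z)"
      by (rule pw2_expand[OF p(1) G p(3) F p(4)])
    have ic: "i \<in> carrier R" using ideal_carr[OF I_ideal zz(1)] .
    \<comment> \<open>With this choice \<open>z y\<close> is \<open>z\<^sup>2\<close> minus its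
      expansion in \<open>e z\<close> and \<open>a z\<close>.\<close>
    define y where "y = z \<ominus> r \<otimes> a \<ominus> k \<otimes> e"
    have ym: "y \<in> \<mm>" unfolding y_def using ideal_minus[OF mm_ideal ideal_minus[OF mm_ideal z(1) ideal_mult[OF mm_ideal a(1) zz(3)]] ideal_mult[OF mm_ideal e(1) zz(2)]] .
    have "z \<otimes> y = z \<otimes> z \<ominus> k \<otimes> (e \<otimes> z) \<ominus> r \<otimes> (a \<otimes> z)" unfolding y_def using ec ac zc zz(2,3) by algebra
    also have "\<dots> = i" unfolding zz(4) using ic zz(2,3) ec ac zc by algebra
    finally have zy: "z \<otimes> y \<in> I" using zz(1) by simp
    have "pw 2 \<subseteq> mult_image z"
    proof (rule surj_mod[OF z(1) pc(1) G pc(3) F e(1) one_closed one_notin_mm ideal_zero[OF I_ideal] _ a(1) one_closed one_notin_mm])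
      show "z \<otimes> e = \<zero> \<oplus> \<one> \<otimes> (e \<otimes> z)" using ec zc by algebra
      show "z \<otimes> a = \<zero> \<oplus> \<one> \<otimes> (a \<otimes> z)" using ac zc by algebra
      show "\<zero> \<in> adj I (e \<otimes> z)" using ideal_zero[OF H(1)] HG by simp
    qed
    moreover have "pw 2 \<subseteq> mult_image y"
    proof (rule surj_mod[OF ym pc(1) G pc(3) F e(1) one_closed one_notin_mm _ _ a(1) one_closed one_notin_mm])
      show "(\<ominus> r) \<otimes> (e \<otimes> a) \<ominus> k \<otimes> (e \<otimes> e) \<in> I"
        by (rule ideal_minus[OF I_ideal ideal_mult[OF I_ideal a(2)] ideal_mult[OF I_ideal e(3)]]) (use zz in auto)
      show "y \<otimes> e = (\<ominus> r) \<otimes> (e \<otimes> a) \<ominus> k \<otimes> (e \<otimes> e) \<oplus> \<one> \<otimes> (e \<otimes> z)" unfolding y_def using ec ac zc zz(2,3) by algebra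
      have "(\<ominus> r) \<otimes> (a \<otimes> a) \<ominus> k \<otimes> (e \<otimes> a) \<in> H"
        by (rule ideal_minus[OF H(1) ideal_mult[OF H(1) True] ideal_mult[OF H(1)]]) (use zz a(2) H(2) in auto)
      then show "(\<ominus> r) \<otimes> (a \<otimes> a) \<ominus> k \<otimes> (e \<otimes> a) \<in> adj I (e \<otimes> z)" using HG by simp
      show "y \<otimes> a = (\<ominus> r) \<otimes> (a \<otimes> a) \<ominus> k \<otimes> (e \<otimes> a) \<oplus> \<one> \<otimes> (a \<otimes> z)" unfolding y_def using ec ac zc zz(2,3) by algebra
    qed
    ultimately show ?thesis unfolding exact_mod_def using z(1) ym zy by blast
  next
    case False
    then have F: "a \<otimes> a \<notin> adj I (e \<otimes> z)" using HG by simp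
    obtain i k q where az: "i \<in> I" "k \<in> carrier R" "q \<in> carrier R" "a \<otimes> z = i \<oplus> k \<otimes> (e \<otimes> z) \<oplus> q \<otimes> (a \<otimes> a)"
      by (rule pw2_expand[OF p(1) G p(2) F p(3)])
    have ic: "i \<in> carrier R" using ideal_carr[OF I_ideal az(1)] .
    \<comment> \<open>The change of basis removes both coefficients of \<open>a z\<close>:
      \<open>a' b\<close> vanishes modulo \<open>I\<close>, while \<open>e b\<close> and the square
      of \<open>a'\<close> keep the roles of \<open>e z\<close> and \<open>a\<^sup>2\<close>, so the
      diagonal case applies.\<close>
    define a' where "a' = a \<ominus> k \<otimes> e"
    define b where "b = z \<ominus> q \<otimes> a"
    have am: "a' \<in> \<mm>" unfolding a'_def using ideal_minus[OF mm_ideal a(1) ideal_mult[OF mm_ideal e(1) az(2)]] .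
    have bm: "b \<in> \<mm>" unfolding b_def using ideal_minus[OF mm_ideal z(1) ideal_mult[OF mm_ideal a(1) az(3)]] .
    have "e \<otimes> a' = e \<otimes> a \<ominus> k \<otimes> (e \<otimes> e)" unfolding a'_def using ec ac az(2) by algebra
    then have ea: "e \<otimes> a' \<in> I" using ideal_minus[OF I_ideal a(2) ideal_mult[OF I_ideal e(3) az(2)]] by simp
    have "a' \<otimes> b = (a \<otimes> z \<ominus> k \<otimes> (e \<otimes> z) \<ominus> q \<otimes> (a \<otimes> a)) \<oplus> (k \<otimes> q) \<otimes> (e \<otimes> a)"
      unfolding a'_def b_def using ec ac zc az(2,3) by algebra
    also have "a \<otimes> z \<ominus> k \<otimes> (e \<otimes> z) \<ominus> q \<otimes> (a \<otimes> a) = i" unfolding az(4) using ic az(2,3) ec ac zc by algebra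
    finally have ab: "a' \<otimes> b \<in> I" using ideal_add[OF I_ideal az(1) ideal_mult[OF I_ideal a(2), of "k \<otimes> q"]] az(2,3) by simp
    have eb': "e \<otimes> b = (\<ominus> q) \<otimes> (e \<otimes> a) \<oplus> \<one> \<otimes> (e \<otimes> z)" unfolding b_def using ec ac zc az(3) by algebra
    have qea: "(\<ominus> q) \<otimes> (e \<otimes> a) \<in> I" using ideal_mult[OF I_ideal a(2)] az(3) by simp
    have eb: "e \<otimes> b \<notin> I" unfolding eb' by (rule notin_add_unit[OF I_ideal qea one_closed one_notin_mm pc(1) G])
    have ebH: "e \<otimes> b \<in> H" unfolding eb' using qea H(2) GH ideal_mult[OF H(1)] by (intro ideal_add[OF H(1)]) auto
    have "a' \<otimes> a' = ((k \<otimes> k) \<otimes> (e \<otimes> e) \<ominus> (k \<oplus> k) \<otimes> (e \<otimes> a)) \<oplus> \<one> \<otimes> (a \<otimes> a)"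
      unfolding a'_def using ec ac az(2) by algebra
    moreover have "(k \<otimes> k) \<otimes> (e \<otimes> e) \<ominus> (k \<oplus> k) \<otimes> (e \<otimes> a) \<in> H"
      using H(2) ideal_minus[OF I_ideal ideal_mult[OF I_ideal e(3), of "k \<otimes> k"] ideal_mult[OF I_ideal a(2), of "k \<oplus> k"]] az(2) by auto
    ultimately have "a' \<otimes> a' \<notin> H" using notin_add_unit[OF H(1) _ one_closed one_notin_mm pc(2) False] by simp
    moreover have "adj I (e \<otimes> b) \<subseteq> H" by (rule adj_least[OF H(1,2) ebH])
    ultimately have aa: "a' \<otimes> a' \<notin> adj I (e \<otimes> b)" by blast
    have Sm: "set [e, a', b] \<subseteq> \<mm>" using e am bm by simp
    then have Sc: "set [e, a', b] \<subseteq> carrier R" using mm_carr by blast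
    note A = adjl_ideal[OF pw_ideal[of 2] Sc] adjl_gens[OF pw_ideal[of 2] Sc]
    have "a = a' \<oplus> k \<otimes> e" unfolding a'_def using ac ec az(2) by algebra
    then have aA: "a \<in> adjl (pw 2) [e, a', b]" using ideal_add[OF A(1) _ ideal_mult[OF A(1) _ az(2)]] A(2) by auto
    have "z = b \<oplus> q \<otimes> a" unfolding b_def using ac zc az(3) by algebra
    then have zA: "z \<in> adjl (pw 2) [e, a', b]" using ideal_add[OF A(1) _ ideal_mult[OF A(1) aA az(3)]] A(2) by auto
    have "\<mm> \<subseteq> adjl (pw 2) [e, a', b]" by (rule span_trans[OF span Sm]) (use aA zA A(2) in auto)
    then show ?thesis using exact_pair_diagonal[OF e(1) am bm e(3) ea ab eb aa] by blast
  qed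
qed

text \<open>The orthogonal complement \<open>U\<close> of \<open>e\<close> together with
  \<open>e\<close> spans \<open>\<mm>\<close>. If \<open>u, w\<close> in \<open>U\<close> satisfy
  \<open>u w = k e\<^sup>2\<close> modulo \<open>I\<close> with a unit \<open>k\<close>, then
  \<open>(e + u)(w - k e)\<close> vanishes there. The task is to find such \<open>u, w\<close>
  without solving quadratic equations.\<close>

lemma exact_pair_anisotropic:
  assumes e: "e \<in> \<mm>" "e \<otimes> e \<notin> I" and ns: "\<not> pw 2 \<subseteq> mult_image e"
  shows "\<exists>x y. exact_mod x y"
proof -
  note ec = mm_carr[OF e(1)]
  define G where "G = e \<otimes> e"
  have G: "G \<in> pw 2" "G \<notin> I" and Gc: "G \<in> carrier R" unfolding G_def using e pw2_prod ec by auto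
  define H where "H = mult_image e"
  have H: "ideal H R" "I \<subseteq> H" "\<not> pw 2 \<subseteq> H" "\<And>p. p \<in> \<mm> \<Longrightarrow> p \<otimes> e \<in> H" "\<And>p. p \<in> \<mm> \<Longrightarrow> e \<otimes> p \<in> H"
    unfolding H_def using mult_image_ideal[OF ec] I_sub_mult_image[OF ec] ns mult_image_mult[OF ec] m_comm[OF ec] mm_carr by auto
  have Hpw: "H \<subseteq> pw 2" unfolding H_def by (rule mult_image_least[OF pw_ideal I_sub pw2_prod[OF e(1)]])
  have GH: "G \<in> H" unfolding G_def by (rule H(5)[OF e(1)])
  have HG: "H = adj I G" by (rule line_eq[OF H(1,2) Hpw H(3) GH G(2)])
  have e2: "e \<notin> pw 2" using notin_pw2 e by blast
  define U where "U = {v \<in> \<mm>. e \<otimes> v \<in> I}"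
  have Um: "u \<in> \<mm>" "e \<otimes> u \<in> I" "u \<in> carrier R" if "u \<in> U" for u using that mm_carr unfolding U_def by auto
  have U_add: "u \<oplus> w \<in> U" if "u \<in> U" "w \<in> U" for u w
    unfolding U_def using ideal_add[OF mm_ideal Um(1)[OF that(1)] Um(1)[OF that(2)]]
      ideal_add[OF I_ideal Um(2)[OF that(1)] Um(2)[OF that(2)]] Um(3)[OF that(1)] Um(3)[OF that(2)] ec by (simp add: r_distr)
  have U_mult: "c \<otimes> u \<in> U" if "u \<in> U" "c \<in> carrier R" for u c
    unfolding U_def using ideal_mult[OF mm_ideal Um(1)[OF that(1)] that(2)]
      ideal_mult[OF I_ideal Um(2)[OF that(1)] that(2)] Um(3)[OF that(1)] ec that(2) by (simp add: m_lcomm)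
  have decomp: "\<exists>v'\<in>U. \<exists>c\<in>carrier R. v = v' \<oplus> c \<otimes> e" if v: "v \<in> \<mm>" for v
  proof -
    note vc = mm_carr[OF v]
    obtain i c where i: "i \<in> I" "c \<in> carrier R" "e \<otimes> v = i \<oplus> c \<otimes> G" using H(5)[OF v] unfolding HG by (rule adjE)
    have "e \<otimes> (v \<ominus> c \<otimes> e) = e \<otimes> v \<ominus> c \<otimes> G" unfolding G_def using ec vc i(2) by algebra
    also have "\<dots> = i" unfolding i(3) using ideal_carr[OF I_ideal i(1)] i(2) Gc by algebra
    finally have "v \<ominus> c \<otimes> e \<in> U"
      unfolding U_def using ideal_minus[OF mm_ideal v ideal_mult[OF mm_ideal e(1) i(2)]] i(1) by simp
    moreover have "v = (v \<ominus> c \<otimes> e) \<oplus> c \<otimes> e" using vc ec i(2) by algebra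
    ultimately show ?thesis using i(2) by blast
  qed
  have mult_all: "p \<otimes> u \<in> K" if u: "u \<in> U" and p: "p \<in> \<mm>" and K: "ideal K R" "I \<subseteq> K" "\<And>w. w \<in> U \<Longrightarrow> w \<otimes> u \<in> K" for u p K
  proof -
    obtain p' c where p': "p' \<in> U" "c \<in> carrier R" "p = p' \<oplus> c \<otimes> e" using decomp[OF p] by blast
    have "p \<otimes> u = p' \<otimes> u \<oplus> c \<otimes> (e \<otimes> u)" unfolding p'(3) using Um(3)[OF p'(1)] Um(3)[OF u] p'(2) ec by algebra
    moreover have "c \<otimes> (e \<otimes> u) \<in> K" using K(2) ideal_mult[OF I_ideal Um(2)[OF u] p'(2)] by blast
    ultimately show ?thesis using ideal_add[OF K(1) K(3)[OF p'(1)]] by simp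
  qed
  have span_e: "\<not> U \<subseteq> adj (pw 2) u" if u: "u \<in> \<mm>" for u
  proof
    assume Uu: "U \<subseteq> adj (pw 2) u"
    have "\<mm> \<subseteq> adjl (pw 2) [u, e]"
    proof
      fix v assume "v \<in> \<mm>"
      then obtain v' c where "v' \<in> U" "c \<in> carrier R" "v = v' \<oplus> c \<otimes> e" using decomp by blast
      then show "v \<in> adjl (pw 2) [u, e]" using adjI[of v' "adj (pw 2) u" c e] Uu by auto
    qed
    then show False using span_length[of "[u, e]"] u e(1) d_eq_3 by simp
  qed
  \<comment> \<open>Both \<open>e\<close> and \<open>u\<close> are radical for the member vanishing
    on \<open>H\<close>, so \<open>u\<close> is a multiple of \<open>e\<close> modulo
    \<open>\<mm>\<^sup>2\<close>. As \<open>e u\<close> vanishes and \<open>e\<^sup>2\<close> does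
    not, the coefficient is not a unit.\<close>
  have rad: "u \<in> pw 2" if u: "u \<in> U" and uH: "\<And>w. w \<in> \<mm> \<Longrightarrow> w \<otimes> u \<in> H" for u
  proof -
    have "u \<in> adj (pw 2) e" by (rule no_rank_one[OF H(1-3) e(1) H(4) Um(1)[OF u] uH e2])
    then obtain w c where w: "w \<in> pw 2" "c \<in> carrier R" "u = w \<oplus> c \<otimes> e" by (rule adjE)
    note wc = pw_carr[OF w(1)]
    have "w \<otimes> e \<in> I" using colon_I[OF e(1)] w(1) colon_mem by blast
    then have "e \<otimes> u \<ominus> w \<otimes> e \<in> I" using ideal_minus[OF I_ideal Um(2)[OF u]] by blast
    moreover have "e \<otimes> u \<ominus> w \<otimes> e = c \<otimes> G" unfolding w(3) G_def using wc w(2) ec by algebra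
    ultimately have "c \<in> \<mm>" using unit_cancel[OF I_ideal w(2) _ Gc] G(2) by auto
    then have "c \<otimes> e \<in> pw 2" using pw2_prod e(1) by blast
    then show ?thesis unfolding w(3) using w(1) ideal_add[OF pw_ideal] by blast
  qed
  \<comment> \<open>As \<open>e\<close> annihilates \<open>U\<close> modulo \<open>I\<close>, a
    proper \<open>K\<close> containing all products of \<open>U\<close> would have two independent
    vectors of \<open>U\<close> in the radical of one member.\<close>
  have prods: "\<exists>u\<in>U. \<exists>w\<in>U. u \<otimes> w \<notin> K" if K: "ideal K R" "I \<subseteq> K" "\<not> pw 2 \<subseteq> K" for K
  proof (rule ccontr)
    assume "\<not> ?thesis"
    then have UK: "\<And>u w. u \<in> U \<Longrightarrow> w \<in> U \<Longrightarrow> u \<otimes> w \<in> K" by blast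
    have all: "p \<otimes> u \<in> K" if "u \<in> U" "p \<in> \<mm>" for u p using mult_all[OF that K(1,2) UK[OF _ that(1)]] .
    obtain u where u: "u \<in> U" "u \<notin> pw 2"
      using span_e[OF ideal_zero[OF mm_ideal]] adj_absorb[OF pw_ideal ideal_zero[OF pw_ideal]] by auto
    have "v \<in> adj (pw 2) u" if v: "v \<in> U" for v
      by (rule no_rank_one[OF K Um(1)[OF u(1)] all[OF u(1)] Um(1)[OF v] all[OF v] u(2)])
    then show False using span_e[OF Um(1)[OF u(1)]] by blast
  qed
  \<comment> \<open>If no product from \<open>U\<close> fell on the line \<open>H\<close> without
    vanishing, all these products would be multiples of a single one, which \<open>prods\<close>
    excludes.\<close>
  obtain u w where uw: "u \<in> U" "w \<in> U" "u \<otimes> w \<in> H" "u \<otimes> w \<notin> I"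
  proof (rule ccontr)
    assume "\<not> thesis"
    then have N: "\<And>u w. u \<in> U \<Longrightarrow> w \<in> U \<Longrightarrow> u \<otimes> w \<in> H \<Longrightarrow> u \<otimes> w \<in> I" using that by blast
    \<comment> \<open>For a suitable \<open>k\<close> the product of \<open>u\<close> with
      \<open>w - k w'\<close> falls into \<open>H\<close>, and hence into \<open>I\<close> by
      \<open>N\<close>.\<close>
    have lin: "u \<otimes> w \<in> adj I (u \<otimes> w')" if u: "u \<in> U" "w \<in> U" "w' \<in> U" "u \<otimes> w' \<notin> H" for u w w'
    proof -
      note c = Um(3)[OF u(1)] Um(3)[OF u(2)] Um(3)[OF u(3)]
      have "u \<otimes> w' \<in> pw 2" "u \<otimes> w \<in> pw 2" using pw2_prod Um(1) u by auto
      then obtain i c k where i: "i \<in> I" "c \<in> carrier R" "k \<in> carrier R" "u \<otimes> w = i \<oplus> c \<otimes> G \<oplus> k \<otimes> (u \<otimes> w')"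
        using pw2_expand[OF G] u(4) HG by metis
      have "u \<otimes> (w \<oplus> (\<ominus> k) \<otimes> w') = u \<otimes> w \<ominus> k \<otimes> (u \<otimes> w')" using c i(3) by algebra
      also have "\<dots> = i \<oplus> c \<otimes> G" unfolding i(4) using c i(2,3) Gc ideal_carr[OF I_ideal i(1)] by algebra
      also have "\<dots> \<in> H" unfolding HG by (rule adjI[OF i(1,2)])
      finally have "u \<otimes> (w \<oplus> (\<ominus> k) \<otimes> w') \<in> I" using N[OF u(1) U_add[OF u(2) U_mult[OF u(3)]]] i(3) by simp
      from adjI[OF this i(3), of "u \<otimes> w'"] have "u \<otimes> (w \<oplus> (\<ominus> k) \<otimes> w') \<oplus> k \<otimes> (u \<otimes> w') \<in> adj I (u \<otimes> w')" .
      moreover have "u \<otimes> (w \<oplus> (\<ominus> k) \<otimes> w') \<oplus> k \<otimes> (u \<otimes> w') = u \<otimes> w" using c i(3) by algebra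
      ultimately show ?thesis by simp
    qed
    obtain u0 w0 where u0: "u0 \<in> U" "w0 \<in> U" "u0 \<otimes> w0 \<notin> H" using prods[OF H(1-3)] by blast
    note c0 = Um(3)[OF u0(1)] Um(3)[OF u0(2)]
    define F where "F = u0 \<otimes> w0"
    have Fc: "F \<in> carrier R" unfolding F_def using c0 by simp
    define K where "K = adj I F"
    have K: "ideal K R" "I \<subseteq> K" "F \<in> K" unfolding K_def using adj_ideal[OF I_ideal Fc] adj_sub[OF I_ideal Fc] adj_self[OF I_ideal Fc] by auto
    have first: "u0 \<otimes> w \<in> K" if "w \<in> U" for w unfolding K_def F_def by (rule lin[OF u0(1) that u0(2,3)])
    have second: "u \<otimes> w \<in> K" if u: "u \<in> U" "w \<in> U" and n: "u \<otimes> w0 \<notin> H" for u w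
    proof -
      have "w0 \<otimes> u \<in> adj I (w0 \<otimes> u0)" by (rule lin[OF u0(2) u(1) u0(1)]) (use u0(3) m_comm[OF c0] in simp)
      then have "u \<otimes> w0 \<in> K" unfolding K_def F_def using m_comm[OF c0] m_comm[OF Um(3)[OF u(1)] c0(2)] by simp
      then have "adj I (u \<otimes> w0) \<subseteq> K" by (rule adj_least[OF K(1,2)])
      then show ?thesis using lin[OF u(1,2) u0(2) n] by blast
    qed
    have "u \<otimes> w \<in> K" if u: "u \<in> U" "w \<in> U" for u w
    proof (cases "u \<otimes> w0 \<in> H")
      case False then show ?thesis using second u by blast
    next
      \<comment> \<open>Replacing \<open>u\<close> by \<open>u + u0\<close> moves the product with
        \<open>w0\<close> off \<open>H\<close>; the contribution of \<open>u0\<close> is known from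
        \<open>first\<close>.\<close>
      case True
      note c = Um(3)[OF u(1)] Um(3)[OF u(2)]
      have "u \<otimes> w0 \<oplus> \<one> \<otimes> F \<notin> H" by (rule notin_add_unit[OF H(1) True one_closed one_notin_mm Fc]) (use u0 F_def in simp)
      moreover have "u \<otimes> w0 \<oplus> \<one> \<otimes> F = (u \<oplus> u0) \<otimes> w0" unfolding F_def using c c0 by algebra
      ultimately have "(u \<oplus> u0) \<otimes> w \<in> K" using second[OF U_add[OF u(1) u0(1)] u(2)] by simp
      then have "(u \<oplus> u0) \<otimes> w \<ominus> u0 \<otimes> w \<in> K" using ideal_minus[OF K(1) _ first[OF u(2)]] by blast
      moreover have "(u \<oplus> u0) \<otimes> w \<ominus> u0 \<otimes> w = u \<otimes> w" using c c0 by algebra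
      ultimately show ?thesis by simp
    qed
    moreover have "\<not> pw 2 \<subseteq> K"
    proof
      assume "pw 2 \<subseteq> K"
      then have "G \<in> adj I F" using G(1) K_def by blast
      moreover have "q \<otimes> F \<in> I" if "q \<in> \<mm>" for q
        using pw2_mult[OF pw2_prod[OF Um(1)[OF u0(1)] Um(1)[OF u0(2)]] that] pw3_sub_I unfolding F_def by blast
      ultimately have "F \<in> adj I G" using adj_unit[OF I_ideal Fc _ G(2)] by blast
      then show False using u0(3) HG F_def by simp
    qed
    ultimately show False using prods[OF K(1,2)] by blast
  qed
  note c = Um(3)[OF uw(1)] Um(3)[OF uw(2)]
  obtain i k where k: "i \<in> I" "k \<in> carrier R" "u \<otimes> w = i \<oplus> k \<otimes> G" using uw(3) unfolding HG by (rule adjE)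
  have kn: "k \<notin> \<mm>" using k uw(4) pw2_mult[OF G(1), of k] pw3_sub_I ideal_add[OF I_ideal] by auto
  define x where "x = e \<oplus> u"
  define y where "y = (\<ominus> k) \<otimes> e \<oplus> w"
  have xm: "x \<in> \<mm>" unfolding x_def by (rule ideal_add[OF mm_ideal e(1) Um(1)[OF uw(1)]])
  have ym: "y \<in> \<mm>" unfolding y_def using ideal_add[OF mm_ideal ideal_mult[OF mm_ideal e(1)] Um(1)[OF uw(2)]] k(2) by simp
  have "x \<otimes> y = (e \<otimes> w \<oplus> (\<ominus> k) \<otimes> (e \<otimes> u)) \<oplus> (u \<otimes> w \<ominus> k \<otimes> G)" unfolding x_def y_def G_def using ec c k(2) by algebra
  also have "u \<otimes> w \<ominus> k \<otimes> G = i" unfolding k(3) using ideal_carr[OF I_ideal k(1)] k(2) Gc by algebra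
  finally have xy: "x \<otimes> y \<in> I"
    using ideal_add[OF I_ideal ideal_add[OF I_ideal Um(2)[OF uw(2)] ideal_mult[OF I_ideal Um(2)[OF uw(1)], of "\<ominus> k"]] k(1)] k(2) by simp
  \<comment> \<open>Products off \<open>H\<close> supply the second vector \<open>F\<close> of the
    triangular criterion for \<open>x\<close> and for \<open>y\<close>.\<close>
  have esc: "\<exists>p\<in>\<mm>. p \<otimes> v \<notin> H" if "v \<in> U" "v \<notin> pw 2" for v using rad that by blast
  have "u \<notin> pw 2" using notin_pw2[OF Um(1)[OF uw(1)] uw(4) Um(1)[OF uw(2)]] .
  then obtain p where p: "p \<in> \<mm>" "p \<otimes> u \<notin> H" using esc uw(1) by blast
  have "w \<otimes> u \<notin> I" using uw(4) m_comm[OF c] by simp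
  then have "w \<notin> pw 2" using notin_pw2[OF Um(1)[OF uw(2)] _ Um(1)[OF uw(1)]] by blast
  then obtain q where q: "q \<in> \<mm>" "q \<otimes> w \<notin> H" using esc uw(2) by blast
  note pqc = mm_carr[OF p(1)] mm_carr[OF q(1)]
  have "pw 2 \<subseteq> mult_image x"
  proof (rule surj_mod[OF xm Gc G(2) _ _ e(1) one_closed one_notin_mm Um(2)[OF uw(1)] _ p(1) one_closed one_notin_mm])
    show "p \<otimes> u \<in> carrier R" "p \<otimes> u \<notin> adj I G" using p HG pqc c by auto
    show "x \<otimes> e = e \<otimes> u \<oplus> \<one> \<otimes> G" unfolding x_def G_def using ec c by algebra
    show "e \<otimes> p \<in> adj I G" using H(5)[OF p(1)] HG by simp
    show "x \<otimes> p = e \<otimes> p \<oplus> \<one> \<otimes> (p \<otimes> u)" unfolding x_def using ec c pqc by algebra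
  qed
  moreover have "pw 2 \<subseteq> mult_image y"
  proof (rule surj_mod[OF ym Gc G(2) _ _ e(1) _ neg_unit[OF k(2) kn] Um(2)[OF uw(2)] _ q(1) one_closed one_notin_mm])
    show "q \<otimes> w \<in> carrier R" "q \<otimes> w \<notin> adj I G" using q HG pqc c by auto
    show "\<ominus> k \<in> carrier R" using k by simp
    show "y \<otimes> e = e \<otimes> w \<oplus> (\<ominus> k) \<otimes> G" unfolding y_def G_def using ec c k(2) by algebra
    show "(\<ominus> k) \<otimes> (e \<otimes> q) \<in> adj I G" using ideal_mult[OF H(1) H(5)[OF q(1)]] k(2) HG by simp
    show "y \<otimes> q = (\<ominus> k) \<otimes> (e \<otimes> q) \<oplus> \<one> \<otimes> (q \<otimes> w)" unfolding y_def using ec c pqc k(2) by algebra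
  qed
  ultimately show ?thesis unfolding exact_mod_def using xm ym xy by blast
qed

text \<open>Here no member of the pencil is degenerate, which happens only over a residue field with
  a binary cubic without nontrivial zeros. Any \<open>x\<close> outside \<open>\<mm>\<^sup>2\<close>
  will do: by dimension it has a kernel vector \<open>y\<close> outside
  \<open>\<mm>\<^sup>2\<close>, and multiplication by \<open>y\<close> is onto as well.\<close>

lemma exact_pair_generic:
  assumes surj: "\<And>e. e \<in> \<mm> \<Longrightarrow> e \<notin> pw 2 \<Longrightarrow> pw 2 \<subseteq> mult_image e"
  shows "\<exists>x y. exact_mod x y"
proof -
  obtain x where x: "x \<in> \<mm>" "x \<notin> pw 2" using mm_not_sub_pw2 by blast
  note xc = mm_carr[OF x(1)]
  obtain q1 q2 where q: "q1 \<in> pw 2" "q2 \<in> pw 2" "q1 \<notin> I" "q2 \<notin> adj I q1" by (rule socle_basis)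
  note sx = surj[OF x]
  obtain u i where u: "u \<in> \<mm>" "i \<in> I" "q1 = x \<otimes> u \<oplus> i" using q(1) sx unfolding mult_image_def by blast
  obtain v j where v: "v \<in> \<mm>" "j \<in> I" "q2 = x \<otimes> v \<oplus> j" using q(2) sx unfolding mult_image_def by blast
  note c = mm_carr[OF u(1)] mm_carr[OF v(1)] ideal_carr[OF I_ideal u(2)] ideal_carr[OF I_ideal v(2)]
  have "\<not> \<mm> \<subseteq> adjl (pw 2) [u, v]" using span_length[of "[u, v]"] u v d_eq_3 by auto
  then obtain w where w: "w \<in> \<mm>" "w \<notin> adjl (pw 2) [u, v]" by blast
  note wc = mm_carr[OF w(1)]
  obtain l a b where xw: "l \<in> I" "a \<in> carrier R" "b \<in> carrier R" "x \<otimes> w = l \<oplus> a \<otimes> q1 \<oplus> b \<otimes> q2"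
    by (rule pw2_expand[OF q(1,3,2,4) pw2_prod[OF x(1) w(1)]])
  \<comment> \<open>Subtracting a preimage \<open>a u + b v\<close> of the value \<open>x w\<close>
    moves \<open>w\<close> into the kernel; independence of \<open>w\<close> from \<open>u\<close>
    and \<open>v\<close> keeps \<open>y\<close> outside \<open>\<mm>\<^sup>2\<close>.\<close>
  define y where "y = w \<ominus> a \<otimes> u \<ominus> b \<otimes> v"
  have ym: "y \<in> \<mm>" unfolding y_def using ideal_minus[OF mm_ideal ideal_minus[OF mm_ideal w(1) ideal_mult[OF mm_ideal u(1) xw(2)]] ideal_mult[OF mm_ideal v(1) xw(3)]] .
  have yn: "y \<notin> pw 2"
  proof
    assume "y \<in> pw 2"
    then have "y \<oplus> a \<otimes> u \<oplus> b \<otimes> v \<in> adjl (pw 2) [u, v]" using xw by (simp add: adjI)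
    moreover have "y \<oplus> a \<otimes> u \<oplus> b \<otimes> v = w" unfolding y_def using wc c xw(2,3) by algebra
    ultimately show False using w by simp
  qed
  have "x \<otimes> y = x \<otimes> w \<ominus> a \<otimes> (x \<otimes> u) \<ominus> b \<otimes> (x \<otimes> v)" unfolding y_def using xc wc c xw(2,3) by algebra
  also have "\<dots> = l \<oplus> a \<otimes> i \<oplus> b \<otimes> j"
    unfolding xw(4) u(3) v(3) using xc c xw(2,3) ideal_carr[OF I_ideal xw(1)] by algebra
  also have "\<dots> \<in> I" using ideal_add[OF I_ideal ideal_add[OF I_ideal xw(1) ideal_mult[OF I_ideal u(2) xw(2)]] ideal_mult[OF I_ideal v(2) xw(3)]] .
  finally show ?thesis unfolding exact_mod_def using x ym sx surj[OF ym yn] by blast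
qed

lemma ex_exact_pair:
  obtains x y where "x \<in> \<mm>" "y \<in> \<mm>" "ideal_colon R I {x} = adj I y" "ideal_colon R I {y} = adj I x"
proof -
  obtain x y where "exact_mod x y"
  proof (cases "\<exists>e\<in>\<mm>. e \<notin> pw 2 \<and> \<not> pw 2 \<subseteq> mult_image e")
    case True
    then obtain e where e: "e \<in> \<mm>" "e \<notin> pw 2" "\<not> pw 2 \<subseteq> mult_image e" by blast
    then show ?thesis using exact_pair_isotropic exact_pair_anisotropic that by (cases "e \<otimes> e \<in> I") blast+
  next
    case False then show ?thesis using exact_pair_generic that by blast
  qed
  then have xy: "x \<in> \<mm>" "y \<in> \<mm>" "x \<otimes> y \<in> I" "pw 2 \<subseteq> mult_image x" "pw 2 \<subseteq> mult_image y" unfolding exact_mod_def by auto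
  then have "y \<otimes> x \<in> I" using m_comm[of x y] mm_carr by simp
  then show ?thesis using that[OF xy(1,2)] exact_colon xy by blast
qed

end

section \<open>Isomorphism invariance\<close>

lemma local_ring_max_ideal:
  assumes "local_ring R"
  shows "maximalideal (max_ideal R) R" "maximalideal m R \<Longrightarrow> m = max_ideal R"
proof -
  have ex: "\<exists>!m. maximalideal m R" using assms unfolding local_ring_def by blast
  show "maximalideal (max_ideal R) R" unfolding max_ideal_def by (rule theI'[OF ex])
  then show "maximalideal m R \<Longrightarrow> m = max_ideal R" using ex by blast
qed

text \<open>Both directions are fixed, so that a transfer can be proved for one of them and
  \<open>flip\<close> gives the converse.\<close>

locale ring_isomorphism =
  fixes R :: "('a, 'm) ring_scheme" and S :: "('b, 'n) ring_scheme" and h :: "'a \<Rightarrow> 'b" and g :: "'b \<Rightarrow> 'a"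
  assumes R_cring: "cring R" and S_cring: "cring S" and h_iso: "h \<in> ring_iso R S" and g_iso: "g \<in> ring_iso S R"
    and gh: "\<And>x. x \<in> carrier R \<Longrightarrow> g (h x) = x" and hg: "\<And>y. y \<in> carrier S \<Longrightarrow> h (g y) = y"
begin

lemma flip: "ring_isomorphism S R g h"
  by (rule ring_isomorphism.intro[OF S_cring R_cring g_iso h_iso hg gh])

lemma g_hom: "ring_hom_ring S R g"
  using g_iso R_cring S_cring by (auto intro!: ring_hom_ringI2 cring.axioms(1) simp: ring_iso_def)

lemma h_closed: "x \<in> carrier R \<Longrightarrow> h x \<in> carrier S" and g_closed: "y \<in> carrier S \<Longrightarrow> g y \<in> carrier R"
  using ring_iso_memE(1)[OF h_iso] ring_iso_memE(1)[OF g_iso] by auto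

text \<open>Turns the transport of ideals and primes into pulling back along \<open>g\<close>, where
  it holds for any homomorphism of these commutative rings.\<close>

lemma image_eq_vimage: "J \<subseteq> carrier R \<Longrightarrow> h ` J = {y \<in> carrier S. g y \<in> J}"
proof
  assume J: "J \<subseteq> carrier R"
  show "h ` J \<subseteq> {y \<in> carrier S. g y \<in> J}" using J gh h_closed by (auto simp: subset_iff)
  show "{y \<in> carrier S. g y \<in> J} \<subseteq> h ` J" using hg by (metis (mono_tags, lifting) image_eqI mem_Collect_eq subsetI)
qed

lemma image_inv: "J \<subseteq> carrier R \<Longrightarrow> g ` h ` J = J"
proof -
  assume J: "J \<subseteq> carrier R"
  have "g ` h ` J = (\<lambda>x. g (h x)) ` J" by (simp add: image_image)
  also have "\<dots> = (\<lambda>x. x) ` J" by (rule image_cong[OF refl]) (use J gh in blast)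
  finally show ?thesis by simp
qed

lemma ideal_sub: "ideal J R \<Longrightarrow> J \<subseteq> carrier R"
  by (rule subsetI) (rule ideal.Icarr)

lemma image_ideal: "ideal J R \<Longrightarrow> ideal (h ` J) S"
  using ring_hom_ring.ideal_vimage[OF g_hom, of J] image_eq_vimage[OF ideal_sub] by simp

lemma image_prime: "primeideal P R \<Longrightarrow> primeideal (h ` P) S"
  using ring_hom_ring.primeideal_vimage[OF g_hom S_cring, of P] image_eq_vimage[OF ideal_sub[OF primeideal.axioms(1)]] by simp

lemma image_carrier: "h ` carrier R = carrier S"
  using ring_iso_memE(5)[OF h_iso] by (simp add: bij_betw_def)

lemma h_inj: "inj_on h (carrier R)"
  using ring_iso_memE(5)[OF h_iso] by (simp add: bij_betw_def)

lemma image_psubset: "A \<subset> B \<Longrightarrow> B \<subseteq> carrier R \<Longrightarrow> h ` A \<subset> h ` B"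
  using inj_on_image_eq_iff[OF h_inj, of A B] by auto

lemma image_genideal_sub: "A \<subseteq> carrier R \<Longrightarrow> genideal S (h ` A) \<subseteq> h ` genideal R A"
  using ring.genideal_minimal[OF cring.axioms(1)[OF S_cring] image_ideal[OF ring.genideal_ideal[OF cring.axioms(1)[OF R_cring]]]]
    ring.genideal_self[OF cring.axioms(1)[OF R_cring]] by (simp add: image_mono)

lemma image_genideal:
  assumes A: "A \<subseteq> carrier R"
  shows "genideal S (h ` A) = h ` genideal R A"
proof
  interpret F: ring_isomorphism S R g h by (rule flip)
  have hA: "h ` A \<subseteq> carrier S" using A h_closed by blast
  have "genideal R A \<subseteq> g ` genideal S (h ` A)" using F.image_genideal_sub[OF hA] image_inv[OF A] by simp
  then have "h ` genideal R A \<subseteq> h ` g ` genideal S (h ` A)" by (rule image_mono)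
  also have "\<dots> = genideal S (h ` A)"
    by (rule F.image_inv[OF F.ideal_sub[OF ring.genideal_ideal[OF cring.axioms(1)[OF S_cring] hA]]])
  finally show "h ` genideal R A \<subseteq> genideal S (h ` A)" .
qed (rule image_genideal_sub[OF A])

lemma image_maximal:
  assumes "maximalideal M R"
  shows "maximalideal (h ` M) S"
proof (rule maximalidealI)
  interpret F: ring_isomorphism S R g h by (rule flip)
  have M: "ideal M R" using assms by (rule maximalideal.axioms(1))
  show "ideal (h ` M) S" by (rule image_ideal[OF M])
  have "carrier R \<noteq> M" using maximalideal.I_notcarr[OF assms] .
  then show "carrier S \<noteq> h ` M"
    using inj_on_image_eq_iff[OF h_inj order_refl ideal_sub[OF M]] image_carrier by simp
  fix K assume K: "ideal K S" "h ` M \<subseteq> K" "K \<subseteq> carrier S"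
  have "M \<subseteq> g ` K" using image_mono[OF K(2), of g] image_inv[OF ideal_sub[OF M]] by simp
  then have "g ` K = M \<or> g ` K = carrier R"
    using maximalideal.I_maximal[OF assms F.image_ideal[OF K(1)]] F.ideal_sub[OF K(1)] F.h_closed by blast
  then show "K = h ` M \<or> K = carrier S" using F.image_inv[OF K(3)] image_carrier by metis
qed

lemma image_local:
  assumes "local_ring R"
  shows "local_ring S" "max_ideal S = h ` max_ideal R"
proof -
  interpret F: ring_isomorphism S R g h by (rule flip)
  obtain m where m: "maximalideal m R" "\<And>m'. maximalideal m' R \<Longrightarrow> m' = m"
    using assms unfolding local_ring_def by blast
  have u: "m' = h ` m" if "maximalideal m' S" for m'
    using m(2)[OF F.image_maximal[OF that]] F.image_inv[OF F.ideal_sub[OF maximalideal.axioms(1)[OF that]]] by metis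
  have ex: "maximalideal (h ` m) S" by (rule image_maximal[OF m(1)])
  show "local_ring S" unfolding local_ring_def using S_cring ex u by blast
  have "max_ideal S = h ` m" unfolding max_ideal_def using ex u by (rule the_equality)
  moreover have "max_ideal R = m" unfolding max_ideal_def using m by (rule the_equality)
  ultimately show "max_ideal S = h ` max_ideal R" by simp
qed

lemma image_noetherian:
  assumes "noetherian_ring R"
  shows "noetherian_ring S"
proof (rule ring.noetherian_ringI[OF cring.axioms(1)[OF S_cring]])
  interpret F: ring_isomorphism S R g h by (rule flip)
  fix K assume K: "ideal K S"
  obtain A where A: "A \<subseteq> carrier R" "finite A" "g ` K = genideal R A"
    using noetherian_ring.finetely_gen[OF assms F.image_ideal[OF K]] by blast
  have "genideal S (h ` A) = K" using image_genideal[OF A(1)] A(3) F.image_inv[OF F.ideal_sub[OF K]] by simp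
  then show "\<exists>A\<subseteq>carrier S. finite A \<and> K = genideal S A" using A h_closed by (intro exI[of _ "h ` A"]) auto
qed

lemma image_prime_chain: "prime_chain R e \<Longrightarrow> prime_chain S e"
  unfolding prime_chain_def
proof (elim exE conjE)
  fix P assume P: "\<forall>i\<le>e. primeideal (P i) R" "\<forall>i<e. P i \<subset> P (Suc i)"
  have "h ` P i \<subset> h ` P (Suc i)" if "i < e" for i
    by (rule image_psubset) (use P that ideal_sub[OF primeideal.axioms(1)] in auto)
  then show "\<exists>P. (\<forall>i\<le>e. primeideal (P i) S) \<and> (\<forall>i<e. P i \<subset> P (Suc i))"
    using P image_prime by (intro exI[of _ "\<lambda>i. h ` P i"]) auto
qed

lemma image_num_gens_ex:
  assumes "finite G" "G \<subseteq> carrier R" "card G = n" "genideal R G = J"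
  shows "\<exists>G. finite G \<and> G \<subseteq> carrier S \<and> card G = n \<and> genideal S G = h ` J"
  using assms card_image[OF inj_on_subset[OF h_inj assms(2)]] image_genideal[OF assms(2)] h_closed
  by (intro exI[of _ "h ` G"]) auto

lemma image_num_gens:
  assumes J: "J \<subseteq> carrier R"
  shows "num_gens S (h ` J) = num_gens R J"
proof -
  interpret F: ring_isomorphism S R g h by (rule flip)
  have "(\<exists>G. finite G \<and> G \<subseteq> carrier S \<and> card G = n \<and> genideal S G = h ` J) \<longleftrightarrow>
    (\<exists>G. finite G \<and> G \<subseteq> carrier R \<and> card G = n \<and> genideal R G = J)" for n
    using image_num_gens_ex[of _ n J] F.image_num_gens_ex[of _ n "h ` J"] image_inv[OF J] by metis
  then show ?thesis unfolding num_gens_def by simp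
qed

lemma image_regular:
  assumes "regular_local_ring R"
  shows "regular_local_ring S"
proof -
  interpret F: ring_isomorphism S R g h by (rule flip)
  obtain d where R: "local_ring R" "noetherian_ring R" "krull_dim_eq R d" "num_gens R (max_ideal R) = d"
    using assms unfolding regular_local_ring_def by blast
  have "max_ideal R \<subseteq> carrier R"
    by (rule ideal_sub[OF maximalideal.axioms(1)[OF local_ring_max_ideal(1)[OF R(1)]]])
  then have "num_gens S (max_ideal S) = d" using image_num_gens image_local(2)[OF R(1)] R(4) by simp
  moreover have "krull_dim_eq S d"
    using R(3) image_prime_chain F.image_prime_chain unfolding krull_dim_eq_def by blast
  ultimately show ?thesis unfolding regular_local_ring_def using image_local(1)[OF R(1)] image_noetherian[OF R(2)] by blast
qed

lemma image_ideal_prod: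
  assumes "A \<subseteq> carrier R" "B \<subseteq> carrier R"
  shows "h ` ideal_prod R A B = ideal_prod S (h ` A) (h ` B)"
proof
  have carr: "x \<in> carrier R" if "x \<in> ideal_prod R A B" for x
    using that by induction (use assms R_cring in \<open>auto simp: subset_iff cring_def ring.ring_simprules\<close>)
  have "h x \<in> ideal_prod S (h ` A) (h ` B)" if "x \<in> ideal_prod R A B" for x
    using that
  proof induction
    case (prod i j)
    then have "h (i \<otimes>\<^bsub>R\<^esub> j) = h i \<otimes>\<^bsub>S\<^esub> h j" using ring_iso_memE(2)[OF h_iso] assms by blast
    then show ?case using prod ideal_prod.prod[of "h i" "h ` A" "h j" "h ` B" S] by simp
  next
    case (sum s t)
    then have "h (s \<oplus>\<^bsub>R\<^esub> t) = h s \<oplus>\<^bsub>S\<^esub> h t" using ring_iso_memE(3)[OF h_iso] carr by blast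
    then show ?case using ideal_prod.sum[OF sum.IH] by simp
  qed
  then show "h ` ideal_prod R A B \<subseteq> ideal_prod S (h ` A) (h ` B)" by blast
  have "y \<in> h ` ideal_prod R A B" if "y \<in> ideal_prod S (h ` A) (h ` B)" for y
    using that
  proof induction
    case (prod i j)
    then obtain a b where "a \<in> A" "b \<in> B" "i = h a" "j = h b" by blast
    then have "i \<otimes>\<^bsub>S\<^esub> j = h (a \<otimes>\<^bsub>R\<^esub> b)" "a \<otimes>\<^bsub>R\<^esub> b \<in> ideal_prod R A B"
      using ring_iso_memE(2)[OF h_iso, of a b] assms by (auto intro: ideal_prod.prod simp: subset_iff)
    then show ?case by simp
  next
    case (sum s t)
    then obtain a b where "a \<in> ideal_prod R A B" "b \<in> ideal_prod R A B" "s = h a" "t = h b" by blast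
    then have "s \<oplus>\<^bsub>S\<^esub> t = h (a \<oplus>\<^bsub>R\<^esub> b)" "a \<oplus>\<^bsub>R\<^esub> b \<in> ideal_prod R A B"
      using ring_iso_memE(3)[OF h_iso, of a b] carr by (auto intro: ideal_prod.sum)
    then show ?case by simp
  qed
  then show "ideal_prod S (h ` A) (h ` B) \<subseteq> h ` ideal_prod R A B" by blast
qed

lemma image_colon:
  assumes J: "J \<subseteq> carrier R" and M: "M \<subseteq> carrier R"
  shows "h ` ideal_colon R J M = ideal_colon S (h ` J) (h ` M)"
proof -
  have mem: "h (x \<otimes>\<^bsub>R\<^esub> a) \<in> h ` J \<longleftrightarrow> x \<otimes>\<^bsub>R\<^esub> a \<in> J" if "x \<in> carrier R" "a \<in> carrier R" for x a
    by (rule inj_on_image_mem_iff[OF h_inj _ J]) (use that R_cring in \<open>simp add: cring_def ring.ring_simprules\<close>)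
  have *: "x \<in> ideal_colon R J M \<longleftrightarrow> h x \<in> ideal_colon S (h ` J) (h ` M)" if "x \<in> carrier R" for x
    using that mem M h_closed unfolding ideal_colon_def
    by (auto simp: subset_iff ring_iso_memE(2)[OF h_iso, symmetric])
  have sub: "ideal_colon R J M \<subseteq> carrier R" "ideal_colon S (h ` J) (h ` M) \<subseteq> carrier S" by (auto simp: ideal_colon_def)
  show ?thesis
  proof
    show "h ` ideal_colon R J M \<subseteq> ideal_colon S (h ` J) (h ` M)" using * sub(1) by blast
    show "ideal_colon S (h ` J) (h ` M) \<subseteq> h ` ideal_colon R J M"
    proof
      fix y assume y: "y \<in> ideal_colon S (h ` J) (h ` M)"
      then have "y \<in> h ` carrier R" using sub(2) image_carrier by blast
      then show "y \<in> h ` ideal_colon R J M" using * y by blast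
    qed
  qed
qed

lemma image_burch:
  assumes loc: "local_ring R" and I: "ideal I R" and burch: "burch_ideal R I"
  shows "burch_ideal S (h ` I)"
proof -
  have mi: "ideal (max_ideal R) R" by (rule maximalideal.axioms(1)[OF local_ring_max_ideal(1)[OF loc]])
  have m: "max_ideal R \<subseteq> carrier R" by (rule ideal_sub[OF mi])
  note Is = ideal_sub[OF I]
  have c: "ideal_colon R I (max_ideal R) \<subseteq> carrier R" by (auto simp: ideal_colon_def)
  have R: "ring R" using R_cring by (rule cring.axioms(1))
  have prod_sub: "ideal_prod R (max_ideal R) B \<subseteq> carrier R" if "B \<subseteq> carrier R" for B
  proof
    fix x assume "x \<in> ideal_prod R (max_ideal R) B"
    then show "x \<in> carrier R" by induction (use that m R in \<open>auto simp: subset_iff ring.ring_simprules\<close>)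
  qed
  show ?thesis
    using burch inj_on_image_eq_iff[OF h_inj prod_sub[OF c] prod_sub[OF Is]]
    unfolding burch_ideal_def image_local(2)[OF loc] image_colon[OF Is m, symmetric]
      image_ideal_prod[OF m c, symmetric] image_ideal_prod[OF m Is, symmetric] by simp
qed

text \<open>The first isomorphism theorem for \<open>h\<close> followed by the projection, whose
  kernel is \<open>I\<close> because \<open>h\<close> is injective.\<close>

lemma Quot_iso:
  assumes I: "ideal I R"
  shows "R Quot I \<simeq> S Quot (h ` I)"
proof -
  interpret S: ring S using S_cring by (rule cring.axioms(1))
  note hI = image_ideal[OF I]
  let ?k = "\<lambda>x. h ` I +>\<^bsub>S\<^esub> h x"
  have "(\<lambda>y. h ` I +>\<^bsub>S\<^esub> y) \<circ> h \<in> ring_hom R (S Quot (h ` I))"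
    using ring_hom_trans[of h R S] ideal.rcos_ring_hom[OF hI] h_iso unfolding ring_iso_def by blast
  then have k: "?k \<in> ring_hom R (S Quot (h ` I))" by (simp add: comp_def)
  have hom: "ring_hom_ring R (S Quot (h ` I)) ?k"
    by (rule ring_hom_ringI2[OF cring.axioms(1)[OF R_cring] ideal.quotient_is_ring[OF hI] k])
  have surj: "?k ` carrier R = carrier (S Quot (h ` I))"
  proof -
    have "?k ` carrier R = (\<lambda>y. h ` I +>\<^bsub>S\<^esub> y) ` carrier S"
      unfolding image_carrier[symmetric] image_image ..
    also have "\<dots> = carrier (S Quot (h ` I))" unfolding FactRing_def A_RCOSETS_def' by auto
    finally show ?thesis .
  qed
  have "a_kernel R (S Quot (h ` I)) ?k = {x \<in> carrier R. h x \<in> h ` I}"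
    unfolding a_kernel_def' using S.quotient_eq_iff_same_a_r_cos[OF hI _ S.zero_closed]
      S.a_rcos_zero[OF hI] h_closed ideal.rcos_const_imp_mem[OF hI]
    by (auto simp: FactRing_def)
  also have "\<dots> = I" using inj_on_image_mem_iff[OF h_inj _ ideal_sub[OF I]] ideal_sub[OF I] by blast
  finally show ?thesis using ring_hom_ring.FactRing_iso[OF hom surj] by simp
qed

end

text \<open>The definition of Burch rings only ranges over regular local rings whose elements are functions
  from the naturals into the residue classes; \<open>S\<close> embeds there by \<open>a \<mapsto> (\<lambda>_. {a})\<close>.\<close>

lemma burch_ideal_imp_burch_quotient:
  fixes S :: "'a ring"
  assumes reg: "regular_local_ring S" and I: "ideal I S" and burch: "burch_ideal S I"
  shows "burch_artinian_ring (S Quot I)"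
proof -
  have loc: "local_ring S" and cr: "cring S" using reg unfolding regular_local_ring_def local_ring_def by auto
  define h where "h = (\<lambda>a (n::nat). {a :: 'a})"
  define g where "g = (\<lambda>f :: nat \<Rightarrow> 'a set. the_elem (f 0))"
  have gh: "g (h x) = x" for x unfolding g_def h_def by simp
  define T :: "(nat \<Rightarrow> 'a set) ring" where
    "T = \<lparr>carrier = h ` carrier S, monoid.mult = \<lambda>x y. h (g x \<otimes>\<^bsub>S\<^esub> g y), one = h \<one>\<^bsub>S\<^esub>,
      ring.zero = h \<zero>\<^bsub>S\<^esub>, ring.add = \<lambda>x y. h (g x \<oplus>\<^bsub>S\<^esub> g y)\<rparr>"
  have h: "h \<in> ring_iso S T"
    by (rule ring_iso_memI) (auto simp: T_def gh bij_betw_def intro!: inj_on_inverseI[of _ g])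
  \<comment> \<open>The record update changes nothing, as \<open>h\<close> of zero is already the
    zero of \<open>T\<close>.\<close>
  have "cring (T\<lparr>ring.zero := h \<zero>\<^bsub>S\<^esub>\<rparr>)" by (rule cring.ring_iso_imp_img_cring[OF cr h])
  then have crT: "cring T" unfolding T_def by simp
  have hg: "h (g y) = y" if "y \<in> carrier T" for y using that gh by (auto simp: T_def)
  have R: "ring S" using cr by (rule cring.axioms(1))
  have g: "g \<in> ring_iso T S"
  proof (rule ring_iso_memI)
    show "bij_betw g (carrier T) (carrier S)"
      by (rule bij_betw_byWitness[where f' = h]) (auto simp: T_def gh)
  qed (auto simp: T_def gh)
  interpret ring_isomorphism S T h g by (rule ring_isomorphism.intro[OF cr crT h g gh hg])
  show ?thesis unfolding burch_artinian_ring_def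
    using image_regular[OF reg] image_ideal[OF I] image_burch[OF loc I burch] Quot_iso[OF I] by blast
qed

section \<open>Passage to the quotient ring\<close>

lemma regular_local_ringD:
  assumes reg: "regular_local_ring S" and dim: "krull_dim_eq S d" and gens: "num_gens S (max_ideal S) = d"
  shows "regular_local S (max_ideal S) d"
proof -
  have loc: "local_ring S" and noeth: "noetherian_ring S" and cr: "cring S"
    using reg unfolding regular_local_ring_def local_ring_def by auto
  have NC: "noetherian_cring S" by (rule noetherian_cring.intro[OF noeth cr])
  have L: "noetherian_local_ring S (max_ideal S)"
    by (rule noetherian_local_ring.intro[OF NC noetherian_local_ring_axioms.intro[OF local_ring_max_ideal[OF loc]]])
  interpret noetherian_local_ring S "max_ideal S" by (rule L)
  have "\<exists>P. is_prime_chain P d \<and> P d = max_ideal S"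
  proof -
    obtain P where P: "\<forall>i\<le>d. primeideal (P i) S" "\<forall>i<d. P i \<subset> P (Suc i)"
      using dim unfolding krull_dim_eq_def prime_chain_def by blast
    have "primeideal (P d) S" using P(1) by simp
    then have pd: "ideal (P d) S" "P d \<noteq> carrier S"
      using primeideal.axioms(1) primeideal.I_notcarr by blast+
    \<comment> \<open>A chain ending strictly below the maximal ideal could be prolonged by it, past
      the dimension.\<close>
    have "P d = max_ideal S"
    proof (rule ccontr)
      assume "P d \<noteq> max_ideal S"
      then have lt: "P d \<subset> max_ideal S" using proper_ideal_sub_mm[OF pd] by blast
      have "prime_chain S (Suc d)" unfolding prime_chain_def
      proof (intro exI[of _ "P(Suc d := max_ideal S)"] conjI allI impI)
        show "primeideal ((P(Suc d := max_ideal S)) i) S" if "i \<le> Suc d" for i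
          using that P(1) mm_prime by (cases "i = Suc d") simp_all
        show "(P(Suc d := max_ideal S)) i \<subset> (P(Suc d := max_ideal S)) (Suc i)" if "i < Suc d" for i
          using that P(2) lt by (cases "i = d") simp_all
      qed
      then show False using dim unfolding krull_dim_eq_def by fastforce
    qed
    then show ?thesis using P unfolding is_prime_chain_def by blast
  qed
  moreover have "\<exists>xs. length xs = d \<and> set xs \<subseteq> carrier S \<and> max_ideal S = adjl {\<zero>\<^bsub>S\<^esub>} xs"
  proof -
    \<comment> \<open>The noetherian property provides some finite generating set, so the least
      cardinality is attained.\<close>
    let ?P = "\<lambda>n. \<exists>G. finite G \<and> G \<subseteq> carrier S \<and> card G = n \<and> genideal S G = max_ideal S"
    obtain A where "A \<subseteq> carrier S" "finite A" "max_ideal S = genideal S A" using finetely_gen[OF mm_ideal] by blast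
    then have "?P (card A)" by blast
    then have "?P (LEAST n. ?P n)" by (rule LeastI)
    then obtain G where G: "finite G" "G \<subseteq> carrier S" "card G = d" "genideal S G = max_ideal S"
      using gens unfolding num_gens_def by auto
    obtain xs where xs: "set xs = G" "distinct xs" using finite_distinct_list[OF G(1)] by blast
    have xc: "set xs \<subseteq> carrier S" using xs G by simp
    have "max_ideal S = adjl {\<zero>\<^bsub>S\<^esub>} xs"
    proof
      show "max_ideal S \<subseteq> adjl {\<zero>\<^bsub>S\<^esub>} xs"
        unfolding G(4)[symmetric] using genideal_minimal[OF adjl_ideal[OF zeroideal xc]] adjl_gens[OF zeroideal xc] xs(1) by simp
      show "adjl {\<zero>\<^bsub>S\<^esub>} xs \<subseteq> max_ideal S"
        by (rule adjl_least[OF mm_ideal]) (use ideal_zero[OF mm_ideal] genideal_self[OF G(2)] G(4) xs(1) in auto)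
    qed
    then show ?thesis using xc distinct_card[OF xs(2)] xs(1) G(3) by auto
  qed
  ultimately show ?thesis by (intro regular_local.intro L regular_local_axioms.intro)
qed

lemma (in abelian_monoid) finsum_lessThan_two:
  "f 0 \<in> carrier G \<Longrightarrow> f 1 \<in> carrier G \<Longrightarrow> finsum G f {..<2::nat} = f 0 \<oplus> f 1"
  by (simp add: numeral_2_eq_2 lessThan_Suc a_comm)

lemma (in abelian_monoid) finsum_lessThan_one: "f 0 \<in> carrier G \<Longrightarrow> finsum G f {..<1::nat} = f 0"
  by (simp add: lessThan_Suc)

section \<open>The projection to the quotient: socle, annihilators and type\<close>

locale local_ring_quotient = noetherian_local_ring +
  fixes I :: "'a set"
  assumes I_id: "ideal I R" and I_mm: "I \<subseteq> \<mm>"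
begin

abbreviation "Q \<equiv> R Quot I"
abbreviation "\<pi> \<equiv> (+>) I"

lemma Q_cring: "cring Q"
  by (rule ideal.quotient_is_cring[OF I_id cring_axioms])

lemma proj_ring_hom: "\<pi> \<in> ring_hom R Q"
  by (rule ideal.rcos_ring_hom[OF I_id])

lemma proj_hom: "ring_hom_ring R Q \<pi>"
  by (rule ideal.rcos_ring_hom_ring[OF I_id])

lemma proj_mult: "a \<in> carrier R \<Longrightarrow> b \<in> carrier R \<Longrightarrow> \<pi> (a \<otimes> b) = \<pi> a \<otimes>\<^bsub>Q\<^esub> \<pi> b"
  and proj_add: "a \<in> carrier R \<Longrightarrow> b \<in> carrier R \<Longrightarrow> \<pi> (a \<oplus> b) = \<pi> a \<oplus>\<^bsub>Q\<^esub> \<pi> b"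
  and proj_one: "\<pi> \<one> = \<one>\<^bsub>Q\<^esub>"
  and proj_closed: "a \<in> carrier R \<Longrightarrow> \<pi> a \<in> carrier Q"
  using proj_ring_hom unfolding ring_hom_def by auto

lemma carrier_Q: "carrier Q = \<pi> ` carrier R"
  unfolding FactRing_def A_RCOSETS_def' by auto

lemma proj_zero_iff: "a \<in> carrier R \<Longrightarrow> \<pi> a = \<zero>\<^bsub>Q\<^esub> \<longleftrightarrow> a \<in> I"
  using ideal.rcos_const_imp_mem[OF I_id, of a] a_rcos_zero[OF I_id, of a] by (auto simp: FactRing_def)

lemma proj_mem_iff:
  assumes K: "ideal K R" "I \<subseteq> K" and a: "a \<in> carrier R"
  shows "\<pi> a \<in> \<pi> ` K \<longleftrightarrow> a \<in> K"
proof
  assume "\<pi> a \<in> \<pi> ` K"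
  then obtain b where b: "b \<in> K" "\<pi> a = \<pi> b" by blast
  then have "a \<ominus> b \<in> I" using quotient_eq_iff_same_a_r_cos[OF I_id a ideal_carr[OF K(1) b(1)]] by simp
  then show "a \<in> K" using ideal_cancel'[OF K(1) _ b(1) a] K(2) by blast
qed blast

text \<open>Proper ideals of the quotient have proper preimages, which lie in \<open>\<mm>\<close>;
  this gives the uniqueness needed to evaluate the definite description.\<close>

lemma max_ideal_Q: "max_ideal Q = \<pi> ` \<mm>"
proof -
  have pre: "ideal {a \<in> carrier R. \<pi> a \<in> K} R" if "ideal K Q" for K
    by (rule ring_hom_ring.ideal_vimage[OF proj_hom that])
  have im: "\<pi> ` {a \<in> carrier R. \<pi> a \<in> K} = K" if "ideal K Q" for K
    using ideal.Icarr[OF that] unfolding carrier_Q by blast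
  have one: "\<one>\<^bsub>Q\<^esub> \<notin> \<pi> ` \<mm>"
    using proj_mem_iff[OF mm_ideal I_mm one_closed] one_notin_mm unfolding proj_one by blast
  have mi: "ideal (\<pi> ` \<mm>) Q" by (rule ring_ideal_imp_quot_ideal[OF I_id mm_ideal])
  have max: "maximalideal (\<pi> ` \<mm>) Q"
  proof (rule maximalidealI[OF mi])
    show "carrier Q \<noteq> \<pi> ` \<mm>" using one proj_closed[OF one_closed] unfolding proj_one by blast
    fix K assume K: "ideal K Q" "\<pi> ` \<mm> \<subseteq> K" "K \<subseteq> carrier Q"
    let ?K = "{a \<in> carrier R. \<pi> a \<in> K}"
    have "\<mm> \<subseteq> ?K" using K(2) mm_carr by blast
    then have "?K = \<mm> \<or> ?K = carrier R" using maximalideal.I_maximal[OF maxi pre[OF K(1)]] by blast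
    then have "\<pi> ` ?K = \<pi> ` \<mm> \<or> \<pi> ` ?K = \<pi> ` carrier R" by (elim disjE) simp_all
    then show "K = \<pi> ` \<mm> \<or> K = carrier Q" unfolding im[OF K(1)] carrier_Q .
  qed
  moreover have "m = \<pi> ` \<mm>" if m: "maximalideal m Q" for m
  proof -
    have mid: "ideal m Q" by (rule maximalideal.axioms(1)[OF m])
    let ?m = "{a \<in> carrier R. \<pi> a \<in> m}"
    have "?m \<noteq> carrier R"
    proof
      assume "?m = carrier R"
      then have "\<pi> ` ?m = \<pi> ` carrier R" by simp
      then show False using maximalideal.I_notcarr[OF m] unfolding im[OF mid] carrier_Q by simp
    qed
    then have "?m \<subseteq> \<mm>" by (rule proper_ideal_sub_mm[OF pre[OF mid]])
    then have "m \<subseteq> \<pi> ` \<mm>" using im[OF mid] by blast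
    then have "\<pi> ` \<mm> = m \<or> \<pi> ` \<mm> = carrier Q"
      using maximalideal.I_maximal[OF m mi] ideal.Icarr[OF mi] by blast
    then show ?thesis using one proj_closed[OF one_closed] unfolding proj_one by blast
  qed
  ultimately show ?thesis unfolding max_ideal_def by (rule the_equality)
qed

text \<open>Serves both the socle, with \<open>M = \<mm>\<close>, and the annihilators of single
  elements in exact pairs.\<close>

lemma proj_colon:
  assumes M: "M \<subseteq> carrier R"
  shows "ideal_colon Q {\<zero>\<^bsub>Q\<^esub>} (\<pi> ` M) = \<pi> ` ideal_colon R I M"
proof -
  have *: "\<pi> a \<in> ideal_colon Q {\<zero>\<^bsub>Q\<^esub>} (\<pi> ` M) \<longleftrightarrow> a \<in> ideal_colon R I M" if a: "a \<in> carrier R" for a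
  proof -
    have "\<pi> a \<otimes>\<^bsub>Q\<^esub> \<pi> b = \<zero>\<^bsub>Q\<^esub> \<longleftrightarrow> a \<otimes> b \<in> I" if "b \<in> M" for b
      using proj_mult[of a b] proj_zero_iff[of "a \<otimes> b"] a that M by auto
    then show ?thesis using a proj_closed unfolding ideal_colon_def by auto
  qed
  have "ideal_colon Q {\<zero>\<^bsub>Q\<^esub>} (\<pi> ` M) \<subseteq> \<pi> ` carrier R" unfolding carrier_Q[symmetric] by (auto simp: ideal_colon_def)
  moreover have "ideal_colon R I M \<subseteq> carrier R" by (auto simp: ideal_colon_def)
  ultimately show ?thesis using * by blast
qed

lemma socle_Q: "socle Q = \<pi> ` ideal_colon R I \<mm>"
  unfolding socle_def max_ideal_Q by (rule proj_colon) (use mm_carr in blast)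

lemma proj_max_iff: "a \<in> carrier R \<Longrightarrow> \<pi> a \<in> max_ideal Q \<longleftrightarrow> a \<in> \<mm>"
  unfolding max_ideal_Q by (rule proj_mem_iff[OF mm_ideal I_mm])

lemma proj_cgenideal:
  assumes y: "y \<in> carrier R"
  shows "cgenideal Q (\<pi> y) = \<pi> ` adj I y"
proof -
  have "\<pi> (i \<oplus> c \<otimes> y) = \<pi> c \<otimes>\<^bsub>Q\<^esub> \<pi> y" if "i \<in> I" "c \<in> carrier R" for i c
  proof -
    have ic: "i \<in> carrier R" using ideal_carr[OF I_id that(1)] .
    have cy: "c \<otimes> y \<in> carrier R" using that y by simp
    have "(i \<oplus> c \<otimes> y) \<ominus> (c \<otimes> y) = i" using ic cy by algebra
    then have "\<pi> (i \<oplus> c \<otimes> y) = \<pi> (c \<otimes> y)"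
      using quotient_eq_iff_same_a_r_cos[OF I_id, of "i \<oplus> c \<otimes> y" "c \<otimes> y"] that(1) ic cy by simp
    then show ?thesis using proj_mult that(2) y by simp
  qed
  note * = this
  show ?thesis
  proof
    show "cgenideal Q (\<pi> y) \<subseteq> \<pi> ` adj I y"
    proof
      fix z assume "z \<in> cgenideal Q (\<pi> y)"
      then obtain c where c: "c \<in> carrier R" "z = \<pi> c \<otimes>\<^bsub>Q\<^esub> \<pi> y" unfolding cgenideal_def carrier_Q by blast
      have "z = \<pi> (\<zero> \<oplus> c \<otimes> y)" using *[OF ideal_zero[OF I_id] c(1)] c(2) by simp
      then show "z \<in> \<pi> ` adj I y" using adjI[OF ideal_zero[OF I_id] c(1)] by blast
    qed
    show "\<pi> ` adj I y \<subseteq> cgenideal Q (\<pi> y)"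
      using * proj_closed unfolding cgenideal_def by (auto elim!: adjE)
  qed
qed

lemma exact_pair_Q:
  assumes "x \<in> \<mm>" "y \<in> \<mm>" "ideal_colon R I {x} = adj I y" "ideal_colon R I {y} = adj I x"
  shows "exact_pair_zd Q (\<pi> x) (\<pi> y)"
  using proj_colon[of "{x}"] proj_colon[of "{y}"] proj_cgenideal mm_carr assms
  unfolding exact_pair_zd_def max_ideal_Q by simp

text \<open>Read contrapositively, this derives \<open>not_gorenstein\<close> from the failure of
  the Gorenstein property.\<close>

lemma type_one_Q:
  assumes t: "t \<in> ideal_colon R I \<mm>" "t \<notin> I" and span: "ideal_colon R I \<mm> \<subseteq> adj I t"
  shows "ring_type_eq Q 1"
proof -
  interpret Q: cring Q by (rule Q_cring)
  have tc: "t \<in> carrier R" using t by (simp add: ideal_colon_def)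
  have fs: "finsum Q (\<lambda>i. c i \<otimes>\<^bsub>Q\<^esub> \<pi> t) {..<1::nat} = c 0 \<otimes>\<^bsub>Q\<^esub> \<pi> t" if "c 0 \<in> carrier Q" for c
    using Q.finsum_lessThan_one[of "\<lambda>i. c i \<otimes>\<^bsub>Q\<^esub> \<pi> t"] that proj_closed[OF tc] by simp
  show ?thesis unfolding ring_type_eq_def
  proof (rule exI[of _ "\<lambda>_. \<pi> t"], intro conjI ballI allI impI)
    show "\<pi> t \<in> socle Q" unfolding socle_Q using t by blast
    fix z assume "z \<in> socle Q"
    then have "z \<in> cgenideal Q (\<pi> t)" unfolding socle_Q proj_cgenideal[OF tc] using span by blast
    then obtain c where "c \<in> carrier Q" "z = c \<otimes>\<^bsub>Q\<^esub> \<pi> t" unfolding cgenideal_def by blast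
    then show "\<exists>c. (\<forall>i<1. c i \<in> carrier Q) \<and> z = (\<Oplus>\<^bsub>Q\<^esub>i\<in>{..<1::nat}. c i \<otimes>\<^bsub>Q\<^esub> \<pi> t)"
      using fs[of "\<lambda>_. c"] by (intro exI[of _ "\<lambda>_. c"]) simp
  next
    fix c and i :: nat
    assume c: "\<forall>i<1. c i \<in> carrier Q" "(\<Oplus>\<^bsub>Q\<^esub>i\<in>{..<1::nat}. c i \<otimes>\<^bsub>Q\<^esub> \<pi> t) = \<zero>\<^bsub>Q\<^esub>" and i: "i < 1"
    obtain b where b: "b \<in> carrier R" "c 0 = \<pi> b" using c(1) unfolding carrier_Q by auto
    have "\<pi> (b \<otimes> t) = \<zero>\<^bsub>Q\<^esub>" using c fs[of c] b proj_mult[OF b(1) tc] by simp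
    then have "b \<otimes> t \<in> I" using proj_zero_iff[of "b \<otimes> t"] b(1) tc by simp
    then have "b \<in> \<mm>" using unit_cancel[OF I_id b(1) _ tc] t(2) by blast
    then show "c i \<in> max_ideal Q" using proj_max_iff[OF b(1)] b(2) i by simp
  qed
qed

lemma type_two_Q:
  assumes q: "q1 \<in> ideal_colon R I \<mm>" "q2 \<in> ideal_colon R I \<mm>" "q1 \<notin> I" "q2 \<notin> adj I q1"
    and span: "ideal_colon R I \<mm> \<subseteq> adj (adj I q1) q2"
  shows "ring_type_eq Q 2"
proof -
  interpret Q: cring Q by (rule Q_cring)
  have qc: "q1 \<in> carrier R" "q2 \<in> carrier R" using q by (simp_all add: ideal_colon_def)
  note a1 = adj_ideal[OF I_id qc(1)] adj_sub[OF I_id qc(1)]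
  define s where "s i = \<pi> (if i = (0::nat) then q1 else q2)" for i
  have fs: "finsum Q (\<lambda>i. c i \<otimes>\<^bsub>Q\<^esub> s i) {..<2::nat} = c 0 \<otimes>\<^bsub>Q\<^esub> \<pi> q1 \<oplus>\<^bsub>Q\<^esub> c 1 \<otimes>\<^bsub>Q\<^esub> \<pi> q2"
    if "c 0 \<in> carrier Q" "c 1 \<in> carrier Q" for c
    using Q.finsum_lessThan_two[of "\<lambda>i. c i \<otimes>\<^bsub>Q\<^esub> s i"] that proj_closed qc unfolding s_def by simp
  have lin: "\<pi> (b1 \<otimes> q1 \<oplus> b2 \<otimes> q2) = \<pi> b1 \<otimes>\<^bsub>Q\<^esub> \<pi> q1 \<oplus>\<^bsub>Q\<^esub> \<pi> b2 \<otimes>\<^bsub>Q\<^esub> \<pi> q2"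
    if "b1 \<in> carrier R" "b2 \<in> carrier R" for b1 b2
    using that qc proj_mult proj_add by simp
  show ?thesis unfolding ring_type_eq_def
  proof (rule exI[of _ s], intro conjI ballI allI impI)
    show "s i \<in> socle Q" for i unfolding socle_Q s_def using q by auto
    fix z assume "z \<in> socle Q"
    then obtain a where a: "a \<in> ideal_colon R I \<mm>" "z = \<pi> a" unfolding socle_Q by blast
    then have "a \<in> adj (adj I q1) q2" using span by blast
    then obtain j b2 where j: "j \<in> adj I q1" "b2 \<in> carrier R" "a = j \<oplus> b2 \<otimes> q2" by (rule adjE)
    obtain i b1 where i: "i \<in> I" "b1 \<in> carrier R" "j = i \<oplus> b1 \<otimes> q1" using j(1) by (rule adjE)
    have ic: "i \<in> carrier R" using ideal_carr[OF I_id i(1)] .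
    have "a \<ominus> (b1 \<otimes> q1 \<oplus> b2 \<otimes> q2) = i" unfolding j(3) i(3) using ic i(2) j(2) qc by algebra
    moreover have "a \<in> carrier R" unfolding j(3) i(3) using ic i(2) j(2) qc by simp
    ultimately have "\<pi> a = \<pi> (b1 \<otimes> q1 \<oplus> b2 \<otimes> q2)"
      using quotient_eq_iff_same_a_r_cos[OF I_id, of a "b1 \<otimes> q1 \<oplus> b2 \<otimes> q2"] i j qc by simp
    then have "z = \<pi> b1 \<otimes>\<^bsub>Q\<^esub> \<pi> q1 \<oplus>\<^bsub>Q\<^esub> \<pi> b2 \<otimes>\<^bsub>Q\<^esub> \<pi> q2" using lin[OF i(2) j(2)] a(2) by simp
    then show "\<exists>c. (\<forall>i<2. c i \<in> carrier Q) \<and> z = (\<Oplus>\<^bsub>Q\<^esub>i\<in>{..<2::nat}. c i \<otimes>\<^bsub>Q\<^esub> s i)"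
      using fs[of "\<lambda>i. if i = 0 then \<pi> b1 else \<pi> b2"] proj_closed i(2) j(2)
      by (intro exI[of _ "\<lambda>i. if i = 0 then \<pi> b1 else \<pi> b2"]) simp
  next
    fix c and i :: nat
    assume c: "\<forall>i<2. c i \<in> carrier Q" "(\<Oplus>\<^bsub>Q\<^esub>i\<in>{..<2::nat}. c i \<otimes>\<^bsub>Q\<^esub> s i) = \<zero>\<^bsub>Q\<^esub>" and i: "i < 2"
    have c01: "c 0 \<in> carrier Q" "c 1 \<in> carrier Q" using c(1) by simp_all
    obtain b1 where b1: "b1 \<in> carrier R" "c 0 = \<pi> b1" using c01(1) unfolding carrier_Q by blast
    obtain b2 where b2: "b2 \<in> carrier R" "c 1 = \<pi> b2" using c01(2) unfolding carrier_Q by blast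
    have "\<pi> (b1 \<otimes> q1 \<oplus> b2 \<otimes> q2) = \<zero>\<^bsub>Q\<^esub>" using c(2) fs[OF c01] lin[OF b1(1) b2(1)] b1(2) b2(2) by simp
    then have rel: "b1 \<otimes> q1 \<oplus> b2 \<otimes> q2 \<in> I" using proj_zero_iff[of "b1 \<otimes> q1 \<oplus> b2 \<otimes> q2"] b1(1) b2(1) qc by simp
    \<comment> \<open>Modulo \<open>I + (q1)\<close> the coefficient \<open>b2\<close> cannot be a
      unit. Then \<open>b2 q2\<close> lies in \<open>I\<close>, as \<open>q2\<close> represents a
      socle element, and what remains of the relation forces \<open>b1\<close> into
      \<open>\<mm>\<close> in the same way.\<close>
    have "b2 \<otimes> q2 \<oplus> b1 \<otimes> q1 \<in> adj I q1" using rel a1(2) a_comm b1(1) b2(1) qc by auto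
    then have "b2 \<otimes> q2 \<in> adj I q1"
      using ideal_cancel[OF a1(1) _ ideal_mult[OF a1(1) adj_self[OF I_id qc(1)] b1(1)]] b2(1) qc by simp
    then have b2m: "b2 \<in> \<mm>" using unit_cancel[OF a1(1) b2(1) _ qc(2)] q(4) by blast
    have "b2 \<otimes> q2 \<in> I" using q(2) b2m m_comm[OF b2(1) qc(2)] unfolding ideal_colon_def by auto
    then have "b1 \<otimes> q1 \<in> I" using ideal_cancel[OF I_id rel] b1(1) qc by simp
    then have b1m: "b1 \<in> \<mm>" using unit_cancel[OF I_id b1(1) _ qc(1)] q(3) by blast
    have "i = 0 \<or> i = 1" using i by auto
    then show "c i \<in> max_ideal Q" using proj_max_iff b1 b2 b1m b2m by auto
  qed
qed

end

theorem theorem5p3: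
  fixes S :: "'a ring" and I :: "'a set"
  assumes "regular_local_ring S"
    and "primary_to S I (max_ideal S)"
    and "I \<subseteq> ideal_prod S (max_ideal S) (max_ideal S)"
    and "quot_length_eq S I 6"
    and "\<not> artinian_gorenstein (S Quot I)"
    and "\<not> burch_artinian_ring (S Quot I)"
  shows "krull_dim_eq S 3 \<and> ring_type_eq (S Quot I) 2 \<and> num_gens S I = 4 \<and>
         (\<exists>x y. exact_pair_zd (S Quot I) x y)"
proof -
  obtain d where d: "krull_dim_eq S d" "num_gens S (max_ideal S) = d"
    using assms(1) unfolding regular_local_ring_def by blast
  have I: "ideal I S" using assms(2) unfolding primary_to_def primary_ideal_def by blast
  interpret reg: regular_local S "max_ideal S" d by (rule regular_local_ringD[OF assms(1) d])
  have I2: "I \<subseteq> reg.pw 2" using assms(3) reg.pw_2 by simp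
  then have Im: "I \<subseteq> max_ideal S" using reg.pw_anti[of "Suc 0" 2] reg.pw_1 by auto
  have quot: "local_ring_quotient S (max_ideal S) I"
    by (rule local_ring_quotient.intro[OF reg.noetherian_local_ring_axioms local_ring_quotient_axioms.intro[OF I Im]])
  have nb: "non_burch_quotient S (max_ideal S) d I"
  proof (rule non_burch_quotient.intro[OF reg.regular_local_axioms], rule non_burch_quotient_axioms.intro[OF I I2])
    show "e \<le> 6" if "reg.chain_len I (carrier S) e" for e
    proof -
      have "ideal_chain_from S I e" using that unfolding ideal_chain_from_def reg.chain_len_def .
      then show ?thesis using assms(4) unfolding quot_length_eq_def by simp
    qed
    \<comment> \<open>The presentation of the quotient by \<open>S\<close> itself is the one used: a
      Burch ideal \<open>I\<close> would make the quotient a Burch ring.\<close>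
    show "ideal_prod S (max_ideal S) (ideal_colon S I (max_ideal S)) = ideal_prod S (max_ideal S) I"
    proof (rule ccontr)
      assume "\<not> ?thesis"
      then have "burch_ideal S I" unfolding burch_ideal_def .
      then show False using burch_ideal_imp_burch_quotient[OF assms(1) I] assms(6) by simp
    qed
    show "\<not> ideal_colon S I (max_ideal S) \<subseteq> reg.adj I t" if "t \<in> ideal_colon S I (max_ideal S)" "t \<notin> I" for t
      using local_ring_quotient.type_one_Q[OF quot that] assms(5) unfolding artinian_gorenstein_def by blast
  qed
  obtain q1 q2 where q: "q1 \<in> reg.pw 2" "q2 \<in> reg.pw 2" "q1 \<notin> I" "q2 \<notin> reg.adj I q1"
    "reg.adj (reg.adj I q1) q2 = reg.pw 2"
    by (rule non_burch_quotient.socle_basis[OF nb])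
  have "ring_type_eq (S Quot I) 2"
    by (rule local_ring_quotient.type_two_Q[OF quot, of q1 q2]) (use q non_burch_quotient.soc_eq[OF nb] in auto)
  moreover obtain x y where "x \<in> max_ideal S" "y \<in> max_ideal S" "ideal_colon S I {x} = reg.adj I y"
    "ideal_colon S I {y} = reg.adj I x"
    by (rule non_burch_quotient.ex_exact_pair[OF nb])
  then have "\<exists>x y. exact_pair_zd (S Quot I) x y" using local_ring_quotient.exact_pair_Q[OF quot] by blast
  ultimately show ?thesis using d(1) non_burch_quotient.d_eq_3[OF nb] non_burch_quotient.num_gens_I[OF nb] by simp
qed

end
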